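(* Let $\lambda,\mu\in\Lambda^+(n,r)$ be such that $\lambda\unlhd\mu$ and $\lambda\in P(\mu)$, and let $m=\ell(\mu)$. Suppose that (1) $p^{l_p(c_s)}$ divides $\lambda_s-\mu_{s+1}+1$ for all $s=1,\dots,m-2$, and $p^{l_p(c'_{m-1})}$ divides $\lambda_{m-1}-\mu_m+1$ (this condition (1) being empty if $m=1$), and (2) $p^{l_p(\lambda_{s+1})}$ divides $\lambda_s+1$ for all $s=m,\dots,n-1$. Then the map $\psi=\sum_{T\in\mathrm{SST}_\lambda(\mu)}\phi_T:D(\lambda)\to\Delta(\mu)$ induces a nonzero homomorphism of $G$-modules $\Delta(\lambda)\to\Delta(\mu)$, i.e. there is a nonzero $G$-homomorphism $\bar\psi:\Delta(\lambda)\to\Delta(\mu)$ with $\psi=\bar\psi\circ\pi_{\Delta(\lambda)}$.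
   Context: $K$ is an infinite field of characteristic $p>0$, $G=GL_n(K)$, $V=K^n$ the natural $G$-module, $r$ a positive integer. $\Lambda(n,r)$ is the set of sequences $(\alpha_1,\dots,\alpha_n)$ of nonnegative integers with sum $r$; $\Lambda^+(n,r)$ is the subset of partitions; $\ell(\mu)$ is the number of nonzero parts of $\mu$. $\alpha\unlhd\beta$ means $\alpha_1+\dots+\alpha_i\le\beta_1+\dots+\beta_i$ for all $i$. $P(\mu)$: let $m=\ell(\mu)$. If $m=1$, $P(\mu)=\Lambda(n,r)$; if $m\ge2$, $P(\mu)$ consists of all $\alpha\in\Lambda(n,r)$ with $\mu_1+\dots+\mu_{i-2}+\mu_i\le\alpha_1+\dots+\alpha_{i-1}$ for all $i=2,\dots,m$. $c_s=\sum_{i=1}^s(\mu_i-\lambda_i)$, $c'_{m-1}=\min\{c_{m-1},\lambda_m\}$. For a positive integer $a$, $l_p(a)$ is the least integer $i$ with $p^i>a$; $l_p(0)=0$. $DV=\bigoplus_{i\ge0}D_iV$ is the divided power (Hopf) algebra of $V$, and $D(\alpha)=D_{\alpha_1}V\otimes\dots\otimes D_{\alpha_n}V$. $\Delta(\mu)$ is the Weyl module of $G$ corresponding to the partition $\mu$ and $\pi_{\Delta(\mu)}:D(\mu)\to\Delta(\mu)$ is the natural projection (Akin–Buchsbaum–Weyman). A tableau of shape $\mu$ is a filling of the diagram of $\mu$ with entries in $\{1,\dots,n\}$; its weight is $\alpha=(\alpha_1,\dots,\alpha_n)$, $\alpha_i$ being the number of entries equal to $i$. It is row semistandard if rows weakly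 increase from left to right, and semistandard if moreover columns strictly increase from top to bottom. $\mathrm{SST}_\alpha(\mu)$ (resp. $\mathrm{RSST}_\alpha(\mu)$) is the set of semistandard (resp. row semistandard) tableaux of shape $\mu$ and weight $\alpha$. For $T\in\mathrm{RSST}_\alpha(\mu)$ let $a_{ij}$ be the number of entries $j$ in row $i$ of $T$ ($1\le i,j\le n$; $a_{ij}=0$ if $i>\ell(\mu)$). The $G$-map $\phi_T:D(\alpha)\to\Delta(\mu)$ is the composition: first apply, for each $j$, the component $D_{\alpha_j}V\to D_{a_{1j}}V\otimes\dots\otimes D_{a_{nj}}V$ of the comultiplication of $DV$ to the $j$-th tensor factor; then for each $i$ multiply (in $DV$) the resulting factors in $D_{a_{i1}}V,\dots,D_{a_{in}}V$ to get an element of $D_{\mu_i}V$, obtaining an element of $D(\mu)$; then apply $\pi_{\Delta(\mu)}$. *)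

theory Defs
  imports
    "HOL-Computational_Algebra.Computational_Algebra"
    "HOL-Combinatorics.Permutations"
    "Jordan_Normal_Form.Matrix"
begin

section \<open>Compositions, partitions and the numerical data\<close>

text \<open>Sequences are functions on the naturals indexed from 1, extended by 0.\<close>

definition compositions :: "nat \<Rightarrow> nat \<Rightarrow> (nat \<Rightarrow> nat) set" where
  "compositions n r =
     {\<alpha>. (\<forall>i. i \<notin> {1..n} \<longrightarrow> \<alpha> i = 0) \<and> (\<Sum>i=1..n. \<alpha> i) = r}"

definition partitions :: "nat \<Rightarrow> nat \<Rightarrow> (nat \<Rightarrow> nat) set" where
  "partitions n r =
     {\<alpha> \<in> compositions n r. \<forall>i\<in>{1..n}. \<forall>j\<in>{1..n}. i \<le> j \<longrightarrow> \<alpha> j \<le> \<alpha> i}"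

definition len :: "nat \<Rightarrow> (nat \<Rightarrow> nat) \<Rightarrow> nat" where
  "len n \<mu> = card {i \<in> {1..n}. \<mu> i \<noteq> 0}"

definition dominated :: "nat \<Rightarrow> (nat \<Rightarrow> nat) \<Rightarrow> (nat \<Rightarrow> nat) \<Rightarrow> bool" where
  "dominated n \<alpha> \<beta> \<longleftrightarrow> (\<forall>i\<in>{1..n}. (\<Sum>j=1..i. \<alpha> j) \<le> (\<Sum>j=1..i. \<beta> j))"

definition Pset :: "nat \<Rightarrow> nat \<Rightarrow> (nat \<Rightarrow> nat) \<Rightarrow> (nat \<Rightarrow> nat) set" where
  "Pset n r \<mu> =
     (if len n \<mu> = 1 then compositions n r
      else {\<alpha> \<in> compositions n r. \<forall>i\<in>{2..len n \<mu>}.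
              (\<Sum>j=1..i-2. \<mu> j) + \<mu> i \<le> (\<Sum>j=1..i-1. \<alpha> j)})"

text \<open>\<open>cdiff \<lambda> \<mu> s\<close> is \<open>c\<^sub>s\<close>; it is nonnegative when \<open>\<mu>\<close> dominates \<open>\<lambda>\<close>.\<close>

definition cdiff :: "(nat \<Rightarrow> nat) \<Rightarrow> (nat \<Rightarrow> nat) \<Rightarrow> nat \<Rightarrow> int" where
  "cdiff lam \<mu> s = (\<Sum>i=1..s. int (\<mu> i) - int (lam i))"

definition lp :: "nat \<Rightarrow> nat \<Rightarrow> nat" where
  "lp p a = (if a = 0 then 0 else (LEAST i. p ^ i > a))"


section \<open>Tableaux\<close>

definition diagram :: "(nat \<Rightarrow> nat) \<Rightarrow> (nat \<times> nat) set" where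
  "diagram \<mu> = {(i, c). 1 \<le> i \<and> 1 \<le> c \<and> c \<le> \<mu> i}"

text \<open>Fillings take the value 0, which is not an entry, outside the diagram.\<close>

definition tableaux :: "nat \<Rightarrow> (nat \<Rightarrow> nat) \<Rightarrow> (nat \<times> nat \<Rightarrow> nat) set" where
  "tableaux n \<mu> =
     {T. (\<forall>x\<in>diagram \<mu>. T x \<in> {1..n}) \<and> (\<forall>x. x \<notin> diagram \<mu> \<longrightarrow> T x = 0)}"

definition row_weakly_increasing :: "(nat \<Rightarrow> nat) \<Rightarrow> (nat \<times> nat \<Rightarrow> nat) \<Rightarrow> bool" where
  "row_weakly_increasing \<mu> T \<longleftrightarrow>
     (\<forall>i c d. (i, c) \<in> diagram \<mu> \<and> (i, d) \<in> diagram \<mu> \<and> c < d \<longrightarrow> T (i, c) \<le> T (i, d))"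

definition column_strict :: "(nat \<Rightarrow> nat) \<Rightarrow> (nat \<times> nat \<Rightarrow> nat) \<Rightarrow> bool" where
  "column_strict \<mu> T \<longleftrightarrow>
     (\<forall>i j c. (i, c) \<in> diagram \<mu> \<and> (j, c) \<in> diagram \<mu> \<and> i < j \<longrightarrow> T (i, c) < T (j, c))"

definition RSST :: "nat \<Rightarrow> (nat \<Rightarrow> nat) \<Rightarrow> (nat \<Rightarrow> nat) \<Rightarrow> (nat \<times> nat \<Rightarrow> nat) set" where
  "RSST n \<alpha> \<mu> =
     {T \<in> tableaux n \<mu>. row_weakly_increasing \<mu> T \<and>
        (\<forall>k\<in>{1..n}. card {x \<in> diagram \<mu>. T x = k} = \<alpha> k)}"

definition SST :: "nat \<Rightarrow> (nat \<Rightarrow> nat) \<Rightarrow> (nat \<Rightarrow> nat) \<Rightarrow> (nat \<times> nat \<Rightarrow> nat) set" where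
  "SST n \<alpha> \<mu> = {T \<in> RSST n \<alpha> \<mu>. column_strict \<mu> T}"

text \<open>\<open>row_content \<mu> T i k\<close> is the number of entries \<open>k\<close> in row \<open>i\<close>.\<close>

definition row_content :: "(nat \<Rightarrow> nat) \<Rightarrow> (nat \<times> nat \<Rightarrow> nat) \<Rightarrow> nat \<Rightarrow> nat \<Rightarrow> nat" where
  "row_content \<mu> T i k = card {c. (i, c) \<in> diagram \<mu> \<and> T (i, c) = k}"


section \<open>The general linear group\<close>

definition GL :: "nat \<Rightarrow> 'a::field mat set" where
  "GL n = {g \<in> carrier_mat n n. invertible_mat g}"

text \<open>The basis \<open>e\<^sub>1, \<dots>, e\<^sub>n\<close> of \<open>V\<close> is indexed from 1, whereas matrices of the library are
  indexed from 0; \<open>g e\<^sub>l\<close> is the sum of the \<open>entry g k l \<cdot> e\<^sub>k\<close>.\<close>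

definition entry :: "'a mat \<Rightarrow> nat \<Rightarrow> nat \<Rightarrow> 'a" where
  "entry g k l = g $$ (k - 1, l - 1)"


section \<open>Tensor products of divided powers\<close>

text \<open>
  \<open>DV\<close> has the basis of divided power monomials \<open>e\<^sub>1\<^sup>(\<^sup>b\<^sup>1\<^sup>) \<cdots> e\<^sub>n\<^sup>(\<^sup>b\<^sup>n\<^sup>)\<close>, with
  \<open>e\<^sub>k\<^sup>(\<^sup>a\<^sup>) e\<^sub>k\<^sup>(\<^sup>b\<^sup>) = (a + b choose a) e\<^sub>k\<^sup>(\<^sup>a\<^sup>+\<^sup>b\<^sup>)\<close>, and the comultiplication
  sends \<open>e\<^sub>k\<^sup>(\<^sup>a\<^sup>)\<close> to the sum of all \<open>e\<^sub>k\<^sup>(\<^sup>b\<^sup>) \<otimes> e\<^sub>k\<^sup>(\<^sup>c\<^sup>)\<close> with \<open>b + c = a\<close>.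

  A tensor product of copies of \<open>DV\<close>, with factors indexed by a finite set \<open>I\<close>, has the tensors of
  such monomials as a basis.  A basis tensor is given by its exponents \<open>B :: 'i \<Rightarrow> nat \<Rightarrow> nat\<close>,
  where \<open>B x k\<close> is the exponent of \<open>e\<^sub>k\<close> in the factor \<open>x\<close>, and an element is given by its
  coefficient function.  \<open>D_space n I \<beta>\<close> is the tensor product over \<open>x \<in> I\<close> of the
  \<open>D\<^bsub>\<beta> x\<^esub>V\<close>.
\<close>

definition D_basis :: "nat \<Rightarrow> 'i set \<Rightarrow> ('i \<Rightarrow> nat) \<Rightarrow> ('i \<Rightarrow> nat \<Rightarrow> nat) set" where
  "D_basis n I \<beta> =
     {B. (\<forall>x k. B x k \<noteq> 0 \<longrightarrow> x \<in> I \<and> k \<in> {1..n}) \<and> (\<forall>x\<in>I. (\<Sum>k=1..n. B x k) = \<beta> x)}"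

definition D_space ::
  "nat \<Rightarrow> 'i set \<Rightarrow> ('i \<Rightarrow> nat) \<Rightarrow> (('i \<Rightarrow> nat \<Rightarrow> nat) \<Rightarrow> 'a::field) set" where
  "D_space n I \<beta> = {f. \<forall>B. f B \<noteq> 0 \<longrightarrow> B \<in> D_basis n I \<beta>}"

abbreviation D :: "nat \<Rightarrow> (nat \<Rightarrow> nat) \<Rightarrow> ((nat \<Rightarrow> nat \<Rightarrow> nat) \<Rightarrow> 'a::field) set" where
  "D n \<alpha> \<equiv> D_space n {1..n} \<alpha>"

text \<open>
  The tensor product over \<open>j\<close> of the components of the iterated comultiplication from the factor
  \<open>j\<close> to the factors \<open>(i, j)\<close> with \<open>i \<in> I\<close>, these having degrees \<open>a (i, j)\<close>: a basis tensor
  \<open>A\<close> is sent to the sum of all basis tensors \<open>B\<close> of these degrees with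
  \<open>\<Sum>i\<in>I. B (i, j) k = A j k\<close>.
\<close>

definition D_comult ::
  "nat \<Rightarrow> 'i set \<Rightarrow> 'j set \<Rightarrow> ('i \<times> 'j \<Rightarrow> nat) \<Rightarrow>
   (('j \<Rightarrow> nat \<Rightarrow> nat) \<Rightarrow> 'a::field) \<Rightarrow> ('i \<times> 'j \<Rightarrow> nat \<Rightarrow> nat) \<Rightarrow> 'a" where
  "D_comult n I J a f =
     (\<lambda>B. if B \<in> D_basis n (I \<times> J) a then f (\<lambda>j k. \<Sum>i\<in>I. B (i, j) k) else 0)"

text \<open>
  The tensor product over \<open>i\<close> of the multiplications of the factors \<open>(i, j)\<close> with \<open>j \<in> J\<close> into
  the factor \<open>i\<close>: a basis tensor \<open>B\<close> is sent to a multiple of the basis tensor \<open>C\<close> with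
  \<open>C i k = (\<Sum>j\<in>J. B (i, j) k)\<close>, the multiple being a product of multinomial coefficients.
\<close>

definition D_mult ::
  "nat \<Rightarrow> 'i set \<Rightarrow> 'j set \<Rightarrow>
   (('i \<times> 'j \<Rightarrow> nat \<Rightarrow> nat) \<Rightarrow> 'a::field) \<Rightarrow> ('i \<Rightarrow> nat \<Rightarrow> nat) \<Rightarrow> 'a" where
  "D_mult n I J h =
     (\<lambda>C. \<Sum>B | (\<forall>x k. B x k \<noteq> 0 \<longrightarrow> x \<in> I \<times> J \<and> k \<in> {1..n}) \<and>
                (\<forall>i k. C i k = (\<Sum>j\<in>J. B (i, j) k)).
        of_nat (\<Prod>i\<in>I. \<Prod>k=1..n. fact (C i k) div (\<Prod>j\<in>J. fact (B (i, j) k))) * h B)"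


section \<open>Weyl modules\<close>

text \<open>
  Following Akin, Buchsbaum and Weyman, \<open>\<Delta>(\<mu>)\<close> is the image of the composite of
  \<open>D(\<mu>) \<rightarrow> \<Otimes>\<^sub>i V\<^sup>\<otimes>\<^sup>\<mu>\<^sup>i\<close> (comultiplication in each factor) and
  \<open>\<Otimes>\<^sub>c V\<^sup>\<otimes>\<^sup>h\<^sup>c \<rightarrow> \<Otimes>\<^sub>c \<Lambda>\<^sup>h\<^sup>cV\<close> (exterior multiplication along the columns of the
  diagram, \<open>hc\<close> being the length of column \<open>c\<close>), the two middle terms being identified through the
  cells of the diagram.  The middle term has as basis the tableaux of shape \<open>\<mu>\<close>, the cell \<open>x\<close>
  carrying the factor \<open>e\<^bsub>w x\<^esub>\<close>, and the last term the column strict ones.  Elements are given by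
  their coefficient functions.
\<close>

definition col_tableaux :: "nat \<Rightarrow> (nat \<Rightarrow> nat) \<Rightarrow> (nat \<times> nat \<Rightarrow> nat) set" where
  "col_tableaux n \<mu> = {T \<in> tableaux n \<mu>. column_strict \<mu> T}"

definition polarize ::
  "(nat \<Rightarrow> nat) \<Rightarrow> ((nat \<Rightarrow> nat \<Rightarrow> nat) \<Rightarrow> 'a::field) \<Rightarrow> (nat \<times> nat \<Rightarrow> nat) \<Rightarrow> 'a" where
  "polarize \<mu> f = (\<lambda>w. f (row_content \<mu> w))"

definition column_perms :: "(nat \<Rightarrow> nat) \<Rightarrow> (nat \<times> nat \<Rightarrow> nat \<times> nat) set" where
  "column_perms \<mu> =
     {\<sigma>. \<sigma> permutes diagram \<mu> \<and> (\<forall>x\<in>diagram \<mu>. snd (\<sigma> x) = snd x)}"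

text \<open>A basis tensor with a repeated entry in a column is sent to 0, and every other one is
  \<open>S \<circ> \<sigma>\<close> for a unique column strict \<open>S\<close> and a unique \<open>\<sigma>\<close>, and is sent to \<open>sign \<sigma>\<close> times
  the basis element \<open>S\<close>.\<close>

definition wedge ::
  "nat \<Rightarrow> (nat \<Rightarrow> nat) \<Rightarrow> ((nat \<times> nat \<Rightarrow> nat) \<Rightarrow> 'a::field) \<Rightarrow> (nat \<times> nat \<Rightarrow> nat) \<Rightarrow> 'a" where
  "wedge n \<mu> h =
     (\<lambda>S. if S \<in> col_tableaux n \<mu>
          then \<Sum>\<sigma>\<in>column_perms \<mu>. of_int (sign \<sigma>) * h (S \<circ> \<sigma>) else 0)"

definition weyl_proj ::
  "nat \<Rightarrow> (nat \<Rightarrow> nat) \<Rightarrow> ((nat \<Rightarrow> nat \<Rightarrow> nat) \<Rightarrow> 'a::field) \<Rightarrow> (nat \<times> nat \<Rightarrow> nat) \<Rightarrow> 'a" where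
  "weyl_proj n \<mu> f = wedge n \<mu> (polarize \<mu> f)"

definition weyl :: "nat \<Rightarrow> (nat \<Rightarrow> nat) \<Rightarrow> ((nat \<times> nat \<Rightarrow> nat) \<Rightarrow> 'a::field) set" where
  "weyl n \<mu> = weyl_proj n \<mu> ` D n \<mu>"

text \<open>The action of \<open>g\<close> on \<open>\<Otimes>\<^sub>c \<Lambda>\<^sup>h\<^sup>cV\<close>: the basis element \<open>T\<close> is sent to the exterior
  product along the columns of the vectors \<open>g e\<^bsub>T x\<^esub>\<close>.\<close>

definition weyl_act ::
  "nat \<Rightarrow> (nat \<Rightarrow> nat) \<Rightarrow> 'a::field mat \<Rightarrow>
   ((nat \<times> nat \<Rightarrow> nat) \<Rightarrow> 'a) \<Rightarrow> (nat \<times> nat \<Rightarrow> nat) \<Rightarrow> 'a" where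
  "weyl_act n \<mu> g u =
     (\<lambda>S. \<Sum>T\<in>col_tableaux n \<mu>.
        u T * wedge n \<mu> (\<lambda>w. \<Prod>x\<in>diagram \<mu>. entry g (w x) (T x)) S)"

text \<open>\<open>G\<close>-homomorphisms \<open>\<Delta>(\<lambda>) \<rightarrow> \<Delta>(\<mu>)\<close>, as functions constrained on \<open>\<Delta>(\<lambda>)\<close> only.\<close>

definition weyl_hom ::
  "nat \<Rightarrow> (nat \<Rightarrow> nat) \<Rightarrow> (nat \<Rightarrow> nat) \<Rightarrow>
   (((nat \<times> nat \<Rightarrow> nat) \<Rightarrow> 'a::field) \<Rightarrow> (nat \<times> nat \<Rightarrow> nat) \<Rightarrow> 'a) set" where
  "weyl_hom n lam \<mu> =
     {h. (\<forall>u\<in>weyl n lam. h u \<in> weyl n \<mu>) \<and>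
         (\<forall>u\<in>weyl n lam. \<forall>v\<in>weyl n lam. h (\<lambda>S. u S + v S) = (\<lambda>S. h u S + h v S)) \<and>
         (\<forall>c. \<forall>u\<in>weyl n lam. h (\<lambda>S. c * u S) = (\<lambda>S. c * h u S)) \<and>
         (\<forall>g\<in>GL n. \<forall>u\<in>weyl n lam. h (weyl_act n lam g u) = weyl_act n \<mu> g (h u))}"


section \<open>The maps attached to tableaux\<close>

definition phi ::
  "nat \<Rightarrow> (nat \<Rightarrow> nat) \<Rightarrow> (nat \<times> nat \<Rightarrow> nat) \<Rightarrow>
   ((nat \<Rightarrow> nat \<Rightarrow> nat) \<Rightarrow> 'a::field) \<Rightarrow> (nat \<times> nat \<Rightarrow> nat) \<Rightarrow> 'a" where
  "phi n \<mu> T f =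
     weyl_proj n \<mu>
       (D_mult n {1..n} {1..n}
         (D_comult n {1..n} {1..n} (\<lambda>(i, j). row_content \<mu> T i j) f))"

definition psi ::
  "nat \<Rightarrow> (nat \<Rightarrow> nat) \<Rightarrow> (nat \<Rightarrow> nat) \<Rightarrow>
   ((nat \<Rightarrow> nat \<Rightarrow> nat) \<Rightarrow> 'a::field) \<Rightarrow> (nat \<times> nat \<Rightarrow> nat) \<Rightarrow> 'a" where
  "psi n lam \<mu> f = (\<lambda>S. \<Sum>T\<in>SST n lam \<mu>. phi n \<mu> T f S)"

end

theory Submission
  imports Defs
begin

text \<open>
  Let \<open>M(U, w)\<close> be the matrix whose entry \<open>(j, k)\<close> counts the cells \<open>x\<close> with \<open>U x = j\<close> and
  \<open>w x = k\<close>.  A product of multinomial coefficients counts fillings, and so the multiplication and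
  comultiplication in the definition of \<open>\<phi>\<^sub>T\<close> merge: \<open>\<phi>\<^sub>T f\<close> is the image under \<open>wedge\<close> of the function
  \<open>w \<mapsto> \<Sum> f (M(U, w))\<close> on words, \<open>U\<close> running through the fillings with the row contents of \<open>T\<close>
  (\<open>phi_eq_wedge\<close>).  Call a filling triangular if its entries in row \<open>i\<close> are at least \<open>i\<close>.  Because
  \<open>\<lambda>\<close> lies in \<open>P(\<mu>)\<close>, there are so few entries larger than \<open>s\<close> in the first \<open>s\<close> rows of a triangular
  filling of weight \<open>\<lambda>\<close> that sorting its rows makes it semistandard.  Hence the coefficient of \<open>\<psi> f\<close>
  at \<open>S\<close> is the sum of \<open>sign \<sigma> \<cdot> f (M(U, S \<circ> \<sigma>))\<close> over all column permutations \<open>\<sigma>\<close> and all triangular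
  \<open>U\<close> of weight \<open>\<lambda>\<close> (\<open>psi_eq_wedge\<close>).

  This is a linear functional of \<open>f\<close>, and it is best read as the polynomial
  \<open>P\<^sub>S = \<Sum>\<^sub>U \<Sum>\<^sub>\<sigma> sign \<sigma> \<Prod>\<^sub>x X(U x, S (\<sigma> x))\<close> in the entries of an \<open>n \<times> n\<close> matrix \<open>X\<close>.  In the same way
  the coefficients of \<open>\<pi>\<^sub>\<Delta>\<^sub>(\<^sub>\<lambda>\<^sub>)\<close> are the bideterminants of shape \<open>\<lambda>\<close>, so \<open>\<psi>\<close> factors through the Weyl
  module as soon as every \<open>P\<^sub>S\<close> is a combination of these bideterminants.  They span all polynomials
  with row degrees \<open>\<lambda>\<close> that do not change when a multiple of row \<open>s\<close> is added to row \<open>s + 1\<close>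
  (\<open>invariants_spanned_by_bideterminants\<close>): in an invariant polynomial a monomial \<open>\<Prod> X(j, k)\<^bsup>B j k\<^esup>\<close> of
  maximal weight \<open>\<Sum> j k B j k\<close> is given by the row contents of a semistandard tableau, by a Garnir
  relation, and is therefore the leading monomial of a bideterminant.

  It remains to see that \<open>P\<^sub>S\<close> is invariant.  Adding \<open>z\<close> times row \<open>s\<close> to row \<open>s + 1\<close> gives, in degree
  \<open>t\<close> of \<open>z\<close>, the sum over all ways to change \<open>t\<close> entries \<open>s + 1\<close> of \<open>U\<close> into \<open>s\<close>.  Exchanging the
  entries of rows \<open>s\<close> and \<open>s + 1\<close> in one column changes the sign, and this cancels all \<open>U\<close> except those
  whose row \<open>s\<close> starts with \<open>\<mu>\<^sub>s\<^sub>+\<^sub>1\<close> entries \<open>s\<close>.  For these, changing an entry of row \<open>s + 1\<close> makes two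
  entries of a column equal and contributes 0.  The other changes lead to each triangular filling
  \<open>W\<close> of the new weight with the same start of row \<open>s\<close> exactly \<open>binom(\<lambda>\<^sub>s - \<mu>\<^sub>s\<^sub>+\<^sub>1 + t, t)\<close> times
  (\<open>row_raise_triangular\<close>), and there is such a \<open>W\<close> only if \<open>t \<le> c\<^sub>s\<close> and \<open>t \<le> \<lambda>\<^sub>s\<^sub>+\<^sub>1\<close>.  For these \<open>t\<close> the divisibility hypotheses imply
  that \<open>p\<close> divides the binomial coefficient.

  On tensors \<open>\<psi>\<close> is composed of place permutations and the exterior multiplication, which commute
  with \<open>GL\<^sub>n\<close>.  It does not vanish, because it takes the generator
  \<open>e\<^sub>1\<^sup>(\<^sup>\<lambda>\<^sup>1\<^sup>) \<otimes> \<cdots> \<otimes> e\<^sub>n\<^sup>(\<^sup>\<lambda>\<^sup>n\<^sup>)\<close> of \<open>D(\<lambda>)\<close> to an element with coefficient 1 at every semistandard tableau.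
\<close>

section \<open>Counting fillings and subsets of prescribed content\<close>

lemma card_subsets_with_content:
  assumes X: "finite X" and Q: "finite Q" "g ` X \<subseteq> Q"
  shows "card {Z. Z \<subseteq> X \<and> (\<forall>q\<in>Q. card {x\<in>Z. g x = q} = y q)}
         = (\<Prod>q\<in>Q. card {x\<in>X. g x = q} choose y q)"
proof -
  let ?F = "\<lambda>q. {A. A \<subseteq> {x\<in>X. g x = q} \<and> card A = y q}"
  let ?f = "\<lambda>Z. restrict (\<lambda>q. {x\<in>Z. g x = q}) Q"
  have "bij_betw ?f {Z. Z \<subseteq> X \<and> (\<forall>q\<in>Q. card {x\<in>Z. g x = q} = y q)} (PiE Q ?F)"
  proof (rule bij_betw_byWitness[where f' = "\<lambda>H. \<Union>q\<in>Q. H q"])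
    show "\<forall>H\<in>PiE Q ?F. ?f (\<Union>q\<in>Q. H q) = H"
    proof
      fix H assume H: "H \<in> PiE Q ?F"
      show "?f (\<Union>q\<in>Q. H q) = H"
      proof
        fix q
        show "?f (\<Union>q\<in>Q. H q) q = H q"
        proof (cases "q \<in> Q")
          case True
          have "{x \<in> (\<Union>q\<in>Q. H q). g x = q} = H q"
            using PiE_mem[OF H] True by fastforce
          then show ?thesis using True by simp
        next
          case False
          then show ?thesis using PiE_arb[OF H] by simp
        qed
      qed
    qed
    show "(\<lambda>H. \<Union>q\<in>Q. H q) ` PiE Q ?F
          \<subseteq> {Z. Z \<subseteq> X \<and> (\<forall>q\<in>Q. card {x\<in>Z. g x = q} = y q)}"
    proof
      fix Z assume "Z \<in> (\<lambda>H. \<Union>q\<in>Q. H q) ` PiE Q ?F"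
      then obtain H where H: "H \<in> PiE Q ?F" and Z: "Z = (\<Union>q\<in>Q. H q)" by blast
      have "{x \<in> Z. g x = q} = H q" if "q \<in> Q" for q
        using PiE_mem[OF H] that unfolding Z by fastforce
      then show "Z \<in> {Z. Z \<subseteq> X \<and> (\<forall>q\<in>Q. card {x\<in>Z. g x = q} = y q)}"
        using PiE_mem[OF H] unfolding Z by fastforce
    qed
  qed (use Q(2) in auto)
  then have "card {Z. Z \<subseteq> X \<and> (\<forall>q\<in>Q. card {x\<in>Z. g x = q} = y q)} = card (PiE Q ?F)"
    by (rule bij_betw_same_card)
  also have "\<dots> = (\<Prod>q\<in>Q. card (?F q))" by (rule card_PiE[OF Q(1)])
  also have "\<dots> = (\<Prod>q\<in>Q. card {x\<in>X. g x = q} choose y q)"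
    by (intro prod.cong refl n_subsets) (use X in auto)
  finally show ?thesis .
qed

lemma prod_fact_dvd_fact_sum:
  "finite J \<Longrightarrow> (\<Prod>j\<in>J. fact (b j)) dvd (fact (\<Sum>j\<in>J. b j) :: nat)"
proof (induction J rule: finite_induct)
  case (insert j J)
  have "fact (b j) * (\<Prod>j\<in>J. fact (b j)) dvd fact (b j) * (fact (\<Sum>j\<in>J. b j) :: nat)"
    using insert.IH by (intro mult_dvd_mono) auto
  also have "\<dots> dvd fact (b j + (\<Sum>j\<in>J. b j))" by (rule fact_fact_dvd_fact)
  finally show ?case using insert.hyps by simp
qed simp

text \<open>
  Induction on \<open>J\<close>: the cells with a chosen value \<open>j\<close> form a subset of prescribed content, the
  other cells a filling with one value less, and the multinomial coefficients obey the same
  recursion.  The value \<open>d\<close> outside \<open>X\<close> only makes the fillings unique as functions.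
\<close>

lemma card_fillings_with_content:
  assumes "finite J" "finite X" "finite Q" "g ` X \<subseteq> Q"
    and "\<And>q. q \<in> Q \<Longrightarrow> (\<Sum>j\<in>J. b q j) = card {x\<in>X. g x = q}"
  shows "card {U. (\<forall>x\<in>X. U x \<in> J) \<and> (\<forall>x. x \<notin> X \<longrightarrow> U x = d) \<and>
                  (\<forall>q\<in>Q. \<forall>j\<in>J. card {x\<in>X. g x = q \<and> U x = j} = b q j)}
         = (\<Prod>q\<in>Q. fact (card {x\<in>X. g x = q}) div (\<Prod>j\<in>J. fact (b q j)))"
  using assms
proof (induction J arbitrary: X rule: finite_induct)
  case empty
  have 0: "{x\<in>X. g x = q} = {}" if "q \<in> Q" for q
    using empty.prems(4)[OF that] empty.prems(1) by (simp add: card_eq_0_iff)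
  then have "X = {}" using empty.prems(3) by blast
  then have "{U. (\<forall>x\<in>X. U x \<in> {}) \<and> (\<forall>x. x \<notin> X \<longrightarrow> U x = d) \<and>
               (\<forall>q\<in>Q. \<forall>j\<in>{}. card {x\<in>X. g x = q \<and> U x = j} = b q j)} = {\<lambda>_. d}" by auto
  moreover have "card {x\<in>X. g x = q} = 0" for q using \<open>X = {}\<close> by simp
  ultimately show ?case by (simp del: card_eq_0_iff)
next
  case (insert j J)
  let ?A = "\<lambda>X J. {U. (\<forall>x\<in>X. U x \<in> J) \<and> (\<forall>x. x \<notin> X \<longrightarrow> U x = d) \<and>
                  (\<forall>q\<in>Q. \<forall>j\<in>J. card {x\<in>X. g x = q \<and> U x = j} = b q j)}"
  let ?S = "{Z. Z \<subseteq> X \<and> (\<forall>q\<in>Q. card {x\<in>Z. g x = q} = b q j)}"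
  have fS: "finite ?S" using insert.prems(1) by simp
  have nq: "card {x\<in>X - Z. g x = q} = card {x\<in>X. g x = q} - b q j"
    if "Z \<in> ?S" "q \<in> Q" for Z q
  proof -
    have "{x\<in>X - Z. g x = q} = {x\<in>X. g x = q} - {x\<in>Z. g x = q}" by auto
    then show ?thesis using that insert.prems(1)
      by (subst \<open>_ = _ - _\<close>, subst card_Diff_subset) (auto intro: finite_subset)
  qed
  have le: "b q j + (\<Sum>j\<in>J. b q j) = card {x\<in>X. g x = q}" if "q \<in> Q" for q
    using insert.prems(4)[OF that] insert.hyps by simp
  have IH: "card (?A (X - Z) J)
      = (\<Prod>q\<in>Q. fact (card {x\<in>X. g x = q} - b q j) div (\<Prod>j\<in>J. fact (b q j)))"
    if Z: "Z \<in> ?S" for Z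
  proof -
    have "card (?A (X - Z) J)
      = (\<Prod>q\<in>Q. fact (card {x\<in>X - Z. g x = q}) div (\<Prod>j\<in>J. fact (b q j)))"
    proof (rule insert.IH)
      show "finite (X - Z)" "finite Q" "g ` (X - Z) \<subseteq> Q" using insert.prems by auto
      show "(\<Sum>j\<in>J. b q j) = card {x \<in> X - Z. g x = q}" if "q \<in> Q" for q
        using nq[OF Z that] le[OF that] by simp
    qed
    also have "\<dots> = (\<Prod>q\<in>Q. fact (card {x\<in>X. g x = q} - b q j) div (\<Prod>j\<in>J. fact (b q j)))"
      using nq[OF Z] by (intro prod.cong) auto
    finally show ?thesis .
  qed
  have "bij_betw (\<lambda>U. ({x\<in>X. U x = j}, \<lambda>x. if x \<in> X \<and> U x = j then d else U x))
          (?A X (insert j J)) (SIGMA Z:?S. ?A (X - Z) J)"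
  proof (rule bij_betw_byWitness[where f' = "\<lambda>(Z, U) x. if x \<in> Z then j else U x"])
    show "\<forall>U\<in>?A X (insert j J). (case ({x\<in>X. U x = j}, \<lambda>x. if x \<in> X \<and> U x = j then d else U x)
            of (Z, U) \<Rightarrow> \<lambda>x. if x \<in> Z then j else U x) = U" by auto
    show "\<forall>ZU\<in>(SIGMA Z:?S. ?A (X - Z) J).
      (\<lambda>U. ({x\<in>X. U x = j}, \<lambda>x. if x \<in> X \<and> U x = j then d else U x))
        (case ZU of (Z, U) \<Rightarrow> \<lambda>x. if x \<in> Z then j else U x) = ZU"
    proof
      fix ZU assume "ZU \<in> (SIGMA Z:?S. ?A (X - Z) J)"
      then obtain Z U where ZU: "ZU = (Z, U)" and a: "Z \<subseteq> X" "\<forall>x\<in>X - Z. U x \<in> J"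
        "\<forall>x. x \<notin> X - Z \<longrightarrow> U x = d" by blast
      have "{x \<in> X. (if x \<in> Z then j else U x) = j} = Z" using a insert.hyps(2) by auto
      moreover have "(\<lambda>x. if x \<in> X \<and> (if x \<in> Z then j else U x) = j then d
          else if x \<in> Z then j else U x) = U"
        using a insert.hyps(2) by (intro ext) auto
      ultimately show "(\<lambda>U. ({x\<in>X. U x = j}, \<lambda>x. if x \<in> X \<and> U x = j then d else U x))
        (case ZU of (Z, U) \<Rightarrow> \<lambda>x. if x \<in> Z then j else U x) = ZU"
        unfolding ZU prod.case by (simp only:)
    qed
    show "(\<lambda>U. ({x\<in>X. U x = j}, \<lambda>x. if x \<in> X \<and> U x = j then d else U x)) ` ?A X (insert j J)
          \<subseteq> (SIGMA Z:?S. ?A (X - Z) J)"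
    proof (rule image_subsetI)
      fix U assume U: "U \<in> ?A X (insert j J)"
      let ?Z = "{x\<in>X. U x = j}" and ?U = "\<lambda>x. if x \<in> X \<and> U x = j then d else U x"
      have "{x\<in>?Z. g x = q} = {x \<in> X. g x = q \<and> U x = j}" for q by auto
      then have 1: "?Z \<in> ?S" using U by simp
      have "{x \<in> X - ?Z. g x = q \<and> ?U x = i} = {x \<in> X. g x = q \<and> U x = i}" if "i \<in> J" for q i
        using that insert.hyps(2) by auto
      moreover have "\<forall>x\<in>X - ?Z. ?U x \<in> J" "\<forall>x. x \<notin> X - ?Z \<longrightarrow> ?U x = d" using U by auto
      ultimately have 2: "?U \<in> ?A (X - ?Z) J" using U by simp
      show "(?Z, ?U) \<in> (SIGMA Z:?S. ?A (X - Z) J)" using 1 2 by (rule SigmaI)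
    qed
    show "(\<lambda>(Z, U) x. if x \<in> Z then j else U x) ` (SIGMA Z:?S. ?A (X - Z) J) \<subseteq> ?A X (insert j J)"
    proof (rule image_subsetI)
      fix ZU assume "ZU \<in> (SIGMA Z:?S. ?A (X - Z) J)"
      then obtain Z U where ZU: "ZU = (Z, U)" and Z: "Z \<in> ?S" and U: "U \<in> ?A (X - Z) J" by blast
      let ?U = "\<lambda>x. if x \<in> Z then j else U x"
      have "{x \<in> X. g x = q \<and> ?U x = j} = {x \<in> Z. g x = q}" for q
        using U Z insert.hyps(2) by auto
      moreover have "{x \<in> X. g x = q \<and> ?U x = i} = {x \<in> X - Z. g x = q \<and> U x = i}"
        if "i \<in> J" for q i
        using that insert.hyps(2) by auto
      ultimately have "\<forall>q\<in>Q. \<forall>i\<in>insert j J. card {x \<in> X. g x = q \<and> ?U x = i} = b q i"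
        using U Z by simp
      moreover have "\<forall>x\<in>X. ?U x \<in> insert j J" "\<forall>x. x \<notin> X \<longrightarrow> ?U x = d"
        using U Z by auto
      ultimately show "(case ZU of (Z, U) \<Rightarrow> \<lambda>x. if x \<in> Z then j else U x) \<in> ?A X (insert j J)"
        unfolding ZU by simp
    qed
  qed
  then have "card (?A X (insert j J)) = card (SIGMA Z:?S. ?A (X - Z) J)"
    by (rule bij_betw_same_card)
  also have "\<dots> = (\<Sum>Z\<in>?S. card (?A (X - Z) J))"
  proof (rule card_SigmaI[OF fS], rule ballI)
    fix Z
    have "?A (X - Z) J \<subseteq> {U. \<forall>x. (x \<in> X - Z \<longrightarrow> U x \<in> J) \<and> (x \<notin> X - Z \<longrightarrow> U x = d)}" by auto
    then show "finite (?A (X - Z) J)"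
      by (rule finite_subset)
        (rule finite_set_of_finite_funs, use insert.prems(1) insert.hyps(1) in simp_all)
  qed
  also have "\<dots> = (\<Sum>Z\<in>?S. \<Prod>q\<in>Q. fact (card {x\<in>X. g x = q} - b q j) div (\<Prod>j\<in>J. fact (b q j)))"
    by (rule sum.cong[OF refl IH])
  also have "\<dots> = card ?S * (\<Prod>q\<in>Q. fact (card {x\<in>X. g x = q} - b q j) div (\<Prod>j\<in>J. fact (b q j)))"
    by (simp only: sum_constant of_nat_id)
  also have "card ?S = (\<Prod>q\<in>Q. card {x\<in>X. g x = q} choose b q j)"
    by (rule card_subsets_with_content[OF insert.prems(1-3)])
  also have "\<dots> * (\<Prod>q\<in>Q. fact (card {x\<in>X. g x = q} - b q j) div (\<Prod>j\<in>J. fact (b q j)))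
      = (\<Prod>q\<in>Q. fact (card {x\<in>X. g x = q}) div (\<Prod>j\<in>insert j J. fact (b q j)))"
    unfolding prod.distrib[symmetric]
  proof (rule prod.cong[OF refl])
    fix q assume q: "q \<in> Q"
    let ?n = "card {x\<in>X. g x = q}" let ?R = "\<Prod>j\<in>J. fact (b q j) :: nat"
    have "?n - b q j = (\<Sum>j\<in>J. b q j)" using le[OF q] by simp
    then have R: "?R dvd fact (?n - b q j)" using prod_fact_dvd_fact_sum[OF insert.hyps(1)] by metis
    have "b q j \<le> ?n" using le[OF q] by simp
    then have "fact ?n = fact (b q j) * (fact (?n - b q j) * (?n choose b q j))"
      using binomial_fact_lemma[of "b q j" ?n] by (simp add: mult_ac)
    then have "fact ?n div (\<Prod>j\<in>insert j J. fact (b q j))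
        = (fact (?n - b q j) * (?n choose b q j)) div ?R"
      using insert.hyps by (simp add: div_mult2_eq)
    also have "\<dots> = (?n choose b q j) * (fact (?n - b q j) div ?R)"
      using div_mult_swap[OF R, of "?n choose b q j"] by (simp only: mult.commute)
    finally show "(?n choose b q j) * (fact (?n - b q j) div ?R)
        = fact ?n div (\<Prod>j\<in>insert j J. fact (b q j))" by simp
  qed
  finally show ?case .
qed

lemma bij_betw_of_equal_fibres:
  assumes "finite X" "finite Y"
    and eq: "\<And>a. card {x\<in>X. F x = a} = card {y\<in>Y. G y = a}"
  shows "\<exists>\<beta>. bij_betw \<beta> X Y \<and> (\<forall>x\<in>X. G (\<beta> x) = F x)"
proof -
  have "\<exists>h. bij_betw h {x\<in>X. F x = a} {y\<in>Y. G y = a}" for a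
    by (rule finite_same_card_bij) (use assms in auto)
  then obtain h where h: "\<And>a. bij_betw (h a) {x\<in>X. F x = a} {y\<in>Y. G y = a}" by metis
  have h1: "h (F x) x \<in> Y \<and> G (h (F x) x) = F x" if "x \<in> X" for x
    using bij_betwE[OF h[of "F x"], rule_format, of x] that by simp
  have "bij_betw (\<lambda>x. h (F x) x) X Y"
    unfolding bij_betw_def
  proof
    show "inj_on (\<lambda>x. h (F x) x) X"
    proof (rule inj_onI)
      fix x y assume xy: "x \<in> X" "y \<in> X" "h (F x) x = h (F y) y"
      then have e: "F x = F y" using h1[OF xy(1)] h1[OF xy(2)] by simp
      show "x = y"
        by (rule inj_onD[OF bij_betw_imp_inj_on[OF h[of "F x"]]]) (use xy e in simp_all)
    qed
    show "(\<lambda>x. h (F x) x) ` X = Y"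
    proof
      show "(\<lambda>x. h (F x) x) ` X \<subseteq> Y" using h1 by auto
      show "Y \<subseteq> (\<lambda>x. h (F x) x) ` X"
      proof
        fix y assume "y \<in> Y"
        then have "y \<in> h (G y) ` {x\<in>X. F x = G y}"
          using bij_betw_imp_surj_on[OF h[of "G y"]] by auto
        then obtain x where x: "x \<in> X" "F x = G y" "y = h (G y) x" by blast
        then have "y = h (F x) x" by simp
        then show "y \<in> (\<lambda>x. h (F x) x) ` X" using x(1) by blast
      qed
    qed
  qed
  then show ?thesis using h1 by blast
qed

lemma permutes_nondecreasing_imp_invariant:
  fixes f :: "'a \<Rightarrow> nat"
  assumes "\<sigma> permutes X" "finite X" "\<And>x. x \<in> X \<Longrightarrow> f x \<le> f (\<sigma> x)" "x \<in> X"
  shows "f (\<sigma> x) = f x"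
proof (rule ccontr)
  assume ne: "f (\<sigma> x) \<noteq> f x"
  have "f x < f (\<sigma> x)" using assms(3)[OF assms(4)] ne by simp
  then have "(\<Sum>x\<in>X. f x) < (\<Sum>x\<in>X. f (\<sigma> x))"
    using assms by (intro sum_strict_mono_ex1) auto
  then show False using sum.permute[OF assms(1), of f] by (simp add: comp_def)
qed

section \<open>Garnir relations\<close>

definition sub_indices :: "nat \<Rightarrow> (nat \<Rightarrow> nat) \<Rightarrow> nat \<Rightarrow> (nat \<Rightarrow> nat) set" where
  "sub_indices n \<alpha> t =
     {Y. (\<forall>k. Y k \<le> \<alpha> k) \<and> (\<forall>k. k \<notin> {1..n} \<longrightarrow> Y k = 0) \<and> (\<Sum>k=1..n. Y k) = t}"

text \<open>
  \<open>P\<close> stands for the polynomial with coefficient \<open>P B\<close> at \<open>\<Prod> X(j, k)\<^bsup>B j k\<^esup>\<close>.  Adding \<open>z\<close> times row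
  \<open>s\<close> of \<open>X\<close> to row \<open>s + 1\<close> and taking the coefficient of \<open>z\<^sup>t\<close> is a divided power of a root
  operator; the value below is its coefficient at the monomial \<open>M\<close>.
\<close>

definition row_raise ::
  "nat \<Rightarrow> nat \<Rightarrow> nat \<Rightarrow> ((nat \<Rightarrow> nat \<Rightarrow> nat) \<Rightarrow> 'a::comm_semiring_1) \<Rightarrow> (nat \<Rightarrow> nat \<Rightarrow> nat) \<Rightarrow> 'a"
  where
  "row_raise n s t P M =
     (\<Sum>Y\<in>sub_indices n (M s) t.
        of_nat (\<Prod>k=1..n. (M (Suc s) k + Y k) choose Y k) *
        P (M(s := \<lambda>k. M s k - Y k, Suc s := \<lambda>k. M (Suc s) k + Y k)))"

lemma finite_index_box:
  fixes u :: "nat \<Rightarrow> nat"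
  assumes "\<And>k. k \<notin> {1..n} \<Longrightarrow> u k = 0"
  shows "finite {Y. \<forall>k. Y k \<le> u k}"
proof (rule finite_subset)
  let ?B = "\<Union>k\<in>{1..n}. {..u k}"
  show "{Y. \<forall>k. Y k \<le> u k} \<subseteq> {Y. \<forall>k. (k \<in> {1..n} \<longrightarrow> Y k \<in> ?B) \<and> (k \<notin> {1..n} \<longrightarrow> Y k = 0)}"
  proof (rule subsetI, rule CollectI, intro allI conjI impI)
    fix Y k assume Y: "Y \<in> {Y. \<forall>k. Y k \<le> u k}"
    show "Y k \<in> ?B" if "k \<in> {1..n}" using Y that by blast
    show "Y k = 0" if "k \<notin> {1..n}" using Y assms[OF that] by (metis le_zero_eq mem_Collect_eq)
  qed
  show "finite {Y. \<forall>k. (k \<in> {1..n} \<longrightarrow> Y k \<in> ?B) \<and> (k \<notin> {1..n} \<longrightarrow> Y k = 0)}"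
    by (rule finite_set_of_finite_funs) auto
qed

lemma finite_sub_indices: "finite (sub_indices n \<alpha> t)"
  by (rule finite_subset[OF _ finite_index_box[of n "\<lambda>k. if k \<in> {1..n} then \<alpha> k else 0"]])
    (auto simp: sub_indices_def)

lemma sum_index_box_prod:
  fixes u :: "nat \<Rightarrow> nat" and f :: "nat \<Rightarrow> nat \<Rightarrow> 'a::comm_semiring_1"
  assumes u: "\<And>k. k \<notin> {1..n} \<Longrightarrow> u k = 0"
  shows "(\<Sum>Y\<in>{Y. \<forall>k. Y k \<le> u k}. \<Prod>k=1..n. f k (Y k)) = (\<Prod>k=1..n. \<Sum>j\<le>u k. f k j)"
proof -
  have "(\<Prod>k=1..n. \<Sum>j\<le>u k. f k j)
      = (\<Sum>Y\<in>PiE {1..n} (\<lambda>k. {..u k}). \<Prod>k=1..n. f k (Y k))"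
    by (rule prod_sum_PiE) auto
  also have "\<dots> = (\<Sum>Y\<in>{Y. \<forall>k. Y k \<le> u k}. \<Prod>k=1..n. f k (Y k))"
  proof (rule sum.reindex_bij_witness[where i = "\<lambda>Y. restrict Y {1..n}"
        and j = "\<lambda>Y k. if k \<in> {1..n} then Y k else 0"])
    fix Y assume Y: "Y \<in> {Y. \<forall>k. Y k \<le> u k}"
    have "Y k = 0" if "k \<notin> {1..n}" for k
      using Y u[OF that] by (metis le_zero_eq mem_Collect_eq)
    then show "(\<lambda>k. if k \<in> {1..n} then restrict Y {1..n} k else 0) = Y" by auto
    show "restrict Y {1..n} \<in> PiE {1..n} (\<lambda>k. {..u k})" using Y by auto
  next
    fix Y assume Y: "Y \<in> PiE {1..n} (\<lambda>k. {..u k})"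
    show "restrict (\<lambda>k. if k \<in> {1..n} then Y k else 0) {1..n} = Y"
      using Y by (auto simp: PiE_def extensional_def restrict_def)
    show "(\<lambda>k. if k \<in> {1..n} then Y k else 0) \<in> {Y. \<forall>k. Y k \<le> u k}"
      using PiE_mem[OF Y] by auto
  qed auto
  finally show ?thesis ..
qed

text \<open>
  Both sides are the trinomial coefficient of \<open>a\<close>, \<open>b\<close> and \<open>c\<close>.
\<close>

lemma trinomial_revision:
  fixes a b c :: nat
  shows "((a + b + c) choose (b + c)) * ((b + c) choose b)
       = ((a + b + c) choose (a + b)) * ((a + b) choose a)"
proof -
  have "((a + b + c) choose (b + c)) * ((b + c) choose b) = (a + b + c choose b) * (a + c choose c)"
    using choose_mult_lemma[of c a b] by (simp add: ac_simps)
  moreover have "((a + b + c) choose (a + b)) * ((a + b) choose b)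
      = (a + b + c choose b) * (a + c choose a)"
    using choose_mult_lemma[of a c b] by (simp add: ac_simps)
  moreover have "((a + b) choose b) = ((a + b) choose a)"
    using binomial_symmetric[of b "a + b"] by simp
  moreover have "((a + c) choose c) = ((a + c) choose a)"
    using binomial_symmetric[of c "a + c"] by simp
  ultimately show ?thesis by simp
qed

text \<open>
  Let \<open>F(a, b)\<close> be the polynomial in two rows with coefficients \<open>p\<close>; the hypothesis says that
  \<open>F(a, b + z a) = F(a, b)\<close>.  The sum in the conclusion is the coefficient of the monomial with
  exponents \<open>u\<close>, \<open>x\<close>, \<open>v\<close> in \<open>F(\<eta> + \<xi>, \<xi> + \<zeta>) = F(\<eta> + \<xi>, \<zeta> - \<eta>)\<close>.  It vanishes, because the part of
  \<open>F\<close> of degree \<open>t + |v|\<close> in \<open>b\<close> has at least this degree in \<open>\<eta>\<close> and \<open>\<zeta>\<close> together, and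
  \<open>|u| < t\<close>.

  On coefficients this becomes an induction on \<open>|u|\<close>: by Vandermonde's identity a multiple of the
  hypothesis for \<open>u + x\<close> is a combination of the relations for \<open>(u - w, x, v + w)\<close> with \<open>w \<le> u\<close>,
  in which the one for \<open>w = 0\<close> has coefficient 1.
\<close>

lemma garnir_relation:
  fixes p :: "(nat \<Rightarrow> nat) \<Rightarrow> (nat \<Rightarrow> nat) \<Rightarrow> 'a::comm_ring_1"
  assumes raise: "\<And>\<alpha> \<beta> t. t \<ge> 1 \<Longrightarrow>
      (\<Sum>Y\<in>sub_indices n \<alpha> t. of_nat (\<Prod>k=1..n. (\<beta> k + Y k) choose Y k) *
          p (\<lambda>k. \<alpha> k - Y k) (\<lambda>k. \<beta> k + Y k)) = 0"
  shows "\<lbrakk>\<And>k. k \<notin> {1..n} \<Longrightarrow> u k = 0; (\<Sum>k=1..n. u k) < t\<rbrakk> \<Longrightarrow>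
      (\<Sum>Y\<in>sub_indices n x t.
          of_nat (\<Prod>k=1..n. ((u k + (x k - Y k)) choose u k) * ((v k + Y k) choose v k)) *
          p (\<lambda>k. u k + (x k - Y k)) (\<lambda>k. v k + Y k)) = 0"
proof (induction "\<Sum>k=1..n. u k" arbitrary: u v t rule: less_induct)
  case less
  let ?B = "{w. \<forall>k. w k \<le> u k}"
  let ?G = "\<lambda>u v t. \<Sum>Y\<in>sub_indices n x t.
          of_nat (\<Prod>k=1..n. ((u k + (x k - Y k)) choose u k) * ((v k + Y k) choose v k)) *
          p (\<lambda>k. u k + (x k - Y k)) (\<lambda>k. v k + Y k)"
  let ?h = "\<lambda>w Y. \<Prod>k=1..n. ((v k + Y k) choose Y k) *
       ((Y k choose w k) * ((u k + x k - Y k) choose (u k - w k)))"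
  let ?q = "\<lambda>Y. p (\<lambda>k. u k + x k - Y k) (\<lambda>k. v k + Y k)"
  have finB: "finite ?B" by (rule finite_index_box) (use less.prems in auto)
  have inner: "(\<Sum>Y\<in>sub_indices n (\<lambda>k. u k + x k) t. of_nat (?h w Y) * ?q Y)
     = of_nat (\<Prod>k=1..n. (v k + w k) choose v k) *
       ?G (\<lambda>k. u k - w k) (\<lambda>k. v k + w k) (t - (\<Sum>k=1..n. w k))" if w: "w \<in> ?B" for w
  proof -
    have w0: "w k = 0" if "k \<notin> {1..n}" for k
      using w less.prems(1)[OF that] by (metis le_zero_eq mem_Collect_eq)
    have wt: "(\<Sum>k=1..n. w k) \<le> t"
      using sum_mono[of "{1..n}" w u] w less.prems(2) by simp
    let ?S = "{Y \<in> sub_indices n (\<lambda>k. u k + x k) t. \<forall>k. w k \<le> Y k \<and> Y k - w k \<le> x k}"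
    have "(\<Sum>Y\<in>sub_indices n (\<lambda>k. u k + x k) t. of_nat (?h w Y) * ?q Y)
        = (\<Sum>Y\<in>?S. of_nat (?h w Y) * ?q Y)"
    proof (rule sum.mono_neutral_right)
      show "\<forall>Y\<in>sub_indices n (\<lambda>k. u k + x k) t - ?S. of_nat (?h w Y) * ?q Y = 0"
      proof
        fix Y assume Y: "Y \<in> sub_indices n (\<lambda>k. u k + x k) t - ?S"
        then obtain k where k: "\<not> (w k \<le> Y k \<and> Y k - w k \<le> x k)" by blast
        have Yu: "Y k \<le> u k + x k" using Y by (auto simp: sub_indices_def)
        have kn: "k \<in> {1..n}"
        proof (rule ccontr)
          assume "k \<notin> {1..n}"
          then have "Y k = 0" "w k = 0" using Y w0 by (auto simp: sub_indices_def)
          then show False using k by simp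
        qed
        have "(Y k choose w k) * ((u k + x k - Y k) choose (u k - w k)) = 0"
        proof (cases "w k \<le> Y k")
          case True
          then have "u k + x k - Y k < u k - w k" using k Yu w by auto
          then show ?thesis by simp
        qed simp
        then have "?h w Y = 0" using kn by (intro prod_zero) auto
        then show "of_nat (?h w Y) * ?q Y = 0" by (simp only: of_nat_0 mult_zero_left)
      qed
    qed (auto intro: finite_sub_indices)
    also have "\<dots> = (\<Sum>Y\<in>sub_indices n x (t - (\<Sum>k=1..n. w k)).
        of_nat (?h w (\<lambda>k. w k + Y k)) * ?q (\<lambda>k. w k + Y k))"
    proof (rule sum.reindex_bij_witness[where i = "\<lambda>Y k. w k + Y k" and j = "\<lambda>Y k. Y k - w k"])
      fix Y assume Y: "Y \<in> ?S"
      then show "(\<lambda>k. w k + (Y k - w k)) = Y" by auto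
      have "(\<Sum>k=1..n. Y k - w k) = (\<Sum>k=1..n. Y k) - (\<Sum>k=1..n. w k)"
        by (rule sum_subtractf_nat) (use Y in auto)
      then show "(\<lambda>k. Y k - w k) \<in> sub_indices n x (t - (\<Sum>k=1..n. w k))"
        using Y by (auto simp: sub_indices_def)
      show "of_nat (?h w (\<lambda>k. w k + (Y k - w k))) * ?q (\<lambda>k. w k + (Y k - w k))
          = of_nat (?h w Y) * ?q Y"
        using \<open>(\<lambda>k. w k + (Y k - w k)) = Y\<close> by (simp add: fun_eq_iff)
    next
      fix Y assume Y: "Y \<in> sub_indices n x (t - (\<Sum>k=1..n. w k))"
      show "(\<lambda>k. w k + Y k - w k) = Y" by auto
      have "w k + Y k \<le> u k + x k" for k
        using Y w by (simp add: sub_indices_def add_mono)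
      then show "(\<lambda>k. w k + Y k) \<in> ?S"
        using Y w0 wt by (auto simp: sub_indices_def sum.distrib)
    qed
    also have "\<dots> = (\<Sum>Y\<in>sub_indices n x (t - (\<Sum>k=1..n. w k)).
        of_nat (\<Prod>k=1..n. (v k + w k) choose v k) *
        (of_nat (\<Prod>k=1..n. ((u k - w k + (x k - Y k)) choose (u k - w k)) *
              ((v k + w k + Y k) choose (v k + w k))) *
          p (\<lambda>k. u k - w k + (x k - Y k)) (\<lambda>k. v k + w k + Y k)))"
    proof (rule sum.cong[OF refl])
      fix Y assume Y: "Y \<in> sub_indices n x (t - (\<Sum>k=1..n. w k))"
      have uw: "u k + x k - (w k + Y k) = u k - w k + (x k - Y k)" for k
      proof -
        have "w k \<le> u k" "Y k \<le> x k" using Y w by (auto simp: sub_indices_def)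
        then show ?thesis by simp
      qed
      have "?h w (\<lambda>k. w k + Y k) = (\<Prod>k=1..n. (v k + w k) choose v k) *
          (\<Prod>k=1..n. ((u k - w k + (x k - Y k)) choose (u k - w k)) *
              ((v k + w k + Y k) choose (v k + w k)))"
        unfolding prod.distrib[symmetric]
      proof (rule prod.cong[OF refl])
        fix k
        have "((v k + (w k + Y k)) choose (w k + Y k)) * ((w k + Y k) choose w k)
            = ((v k + w k + Y k) choose (v k + w k)) * ((v k + w k) choose v k)"
          using trinomial_revision[of "v k" "w k" "Y k"] by (simp only: add.assoc)
        then have rev: "(((v k + (w k + Y k)) choose (w k + Y k)) * ((w k + Y k) choose w k)) * z
            = (((v k + w k + Y k) choose (v k + w k)) * ((v k + w k) choose v k)) * z" for z
          by (simp only:)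
        show "((v k + (w k + Y k)) choose (w k + Y k)) *
            (((w k + Y k) choose w k) * ((u k + x k - (w k + Y k)) choose (u k - w k)))
          = ((v k + w k) choose v k) * (((u k - w k + (x k - Y k)) choose (u k - w k)) *
              ((v k + w k + Y k) choose (v k + w k)))"
          unfolding uw using rev[of "(u k - w k + (x k - Y k)) choose (u k - w k)"]
          by (simp only: mult_ac)
      qed
      then show "of_nat (?h w (\<lambda>k. w k + Y k)) * ?q (\<lambda>k. w k + Y k)
          = of_nat (\<Prod>k=1..n. (v k + w k) choose v k) *
        (of_nat (\<Prod>k=1..n. ((u k - w k + (x k - Y k)) choose (u k - w k)) *
              ((v k + w k + Y k) choose (v k + w k))) *
          p (\<lambda>k. u k - w k + (x k - Y k)) (\<lambda>k. v k + w k + Y k))"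
        by (simp only: uw of_nat_mult mult.assoc add.assoc)
    qed
    also have "\<dots> = of_nat (\<Prod>k=1..n. (v k + w k) choose v k) *
       ?G (\<lambda>k. u k - w k) (\<lambda>k. v k + w k) (t - (\<Sum>k=1..n. w k))"
      by (simp only: sum_distrib_left)
    finally show ?thesis .
  qed
  have vdm: "(\<Sum>w\<in>?B. ?h w Y)
      = (\<Prod>k=1..n. (u k + x k) choose u k) * (\<Prod>k=1..n. (v k + Y k) choose Y k)"
    if "Y \<in> sub_indices n (\<lambda>k. u k + x k) t" for Y
  proof -
    have "(\<Sum>w\<in>?B. ?h w Y) = (\<Prod>k=1..n. \<Sum>j\<le>u k. ((v k + Y k) choose Y k) *
       ((Y k choose j) * ((u k + x k - Y k) choose (u k - j))))"
      using less.prems(1) by (rule sum_index_box_prod)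
    also have "\<dots> = (\<Prod>k=1..n. ((v k + Y k) choose Y k) * ((u k + x k) choose u k))"
    proof (rule prod.cong[OF refl])
      fix k
      have "Y k + (u k + x k - Y k) = u k + x k" using that by (simp add: sub_indices_def)
      then show "(\<Sum>j\<le>u k. ((v k + Y k) choose Y k) *
         ((Y k choose j) * ((u k + x k - Y k) choose (u k - j))))
         = ((v k + Y k) choose Y k) * ((u k + x k) choose u k)"
        unfolding sum_distrib_left[symmetric] vandermonde by simp
    qed
    finally show ?thesis by (simp add: prod.distrib)
  qed
  have "0 = of_nat (\<Prod>k=1..n. (u k + x k) choose u k) *
      (\<Sum>Y\<in>sub_indices n (\<lambda>k. u k + x k) t. of_nat (\<Prod>k=1..n. (v k + Y k) choose Y k) * ?q Y)"
    using raise[where t = t and \<alpha> = "\<lambda>k. u k + x k" and \<beta> = v] less.prems(2) by simp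
  also have "\<dots> = (\<Sum>Y\<in>sub_indices n (\<lambda>k. u k + x k) t. of_nat (\<Sum>w\<in>?B. ?h w Y) * ?q Y)"
    unfolding sum_distrib_left by (intro sum.cong refl) (simp only: vdm of_nat_mult mult.assoc)
  also have "\<dots> = (\<Sum>w\<in>?B. \<Sum>Y\<in>sub_indices n (\<lambda>k. u k + x k) t. of_nat (?h w Y) * ?q Y)"
    unfolding of_nat_sum sum_distrib_right by (rule sum.swap)
  also have "\<dots> = (\<Sum>w\<in>?B. of_nat (\<Prod>k=1..n. (v k + w k) choose v k) *
       ?G (\<lambda>k. u k - w k) (\<lambda>k. v k + w k) (t - (\<Sum>k=1..n. w k)))"
    by (rule sum.cong[OF refl inner])
  also have "\<dots> = (\<Sum>w\<in>{\<lambda>_. 0}. of_nat (\<Prod>k=1..n. (v k + w k) choose v k) *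
       ?G (\<lambda>k. u k - w k) (\<lambda>k. v k + w k) (t - (\<Sum>k=1..n. w k)))"
  proof (rule sum.mono_neutral_right[OF finB])
    show "\<forall>w\<in>?B - {\<lambda>_. 0}. of_nat (\<Prod>k=1..n. (v k + w k) choose v k) *
       ?G (\<lambda>k. u k - w k) (\<lambda>k. v k + w k) (t - (\<Sum>k=1..n. w k)) = 0"
    proof
      fix w assume w: "w \<in> ?B - {\<lambda>_. 0}"
      then have wu: "w k \<le> u k" for k by simp
      obtain k where k: "w k \<noteq> 0" using w by auto
      have "k \<in> {1..n}" using k wu[of k] less.prems(1)[of k] by (metis le_zero_eq)
      then have pos: "(\<Sum>k=1..n. w k) > 0"
        using k member_le_sum[of k "{1..n}" w] by simp
      have d: "(\<Sum>k=1..n. u k - w k) = (\<Sum>k=1..n. u k) - (\<Sum>k=1..n. w k)"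
        by (rule sum_subtractf_nat) (use wu in auto)
      have le: "(\<Sum>k=1..n. w k) \<le> (\<Sum>k=1..n. u k)" by (rule sum_mono) (rule wu)
      have "?G (\<lambda>k. u k - w k) (\<lambda>k. v k + w k) (t - (\<Sum>k=1..n. w k)) = 0"
      proof (rule less.hyps)
        show "(\<Sum>k=1..n. u k - w k) < (\<Sum>k=1..n. u k)" using d pos le by simp
        show "u k - w k = 0" if "k \<notin> {1..n}" for k using less.prems(1)[OF that] by simp
        show "(\<Sum>k=1..n. u k - w k) < t - (\<Sum>k=1..n. w k)" using d le less.prems(2) by simp
      qed
      then show "of_nat (\<Prod>k=1..n. (v k + w k) choose v k) *
       ?G (\<lambda>k. u k - w k) (\<lambda>k. v k + w k) (t - (\<Sum>k=1..n. w k)) = 0" by simp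
    qed
  qed auto
  also have "\<dots> = ?G u v t" by simp
  finally show ?case ..
qed

section \<open>Column permutations and alternating sums\<close>

text \<open>
  The exponents of the monomial \<open>\<Prod>\<^sub>x X(U x, w x)\<close>.
\<close>

definition pair_content ::
  "'x set \<Rightarrow> ('x \<Rightarrow> nat) \<Rightarrow> ('x \<Rightarrow> nat) \<Rightarrow> nat \<Rightarrow> nat \<Rightarrow> nat" where
  "pair_content X U w = (\<lambda>j k. card {x\<in>X. U x = j \<and> w x = k})"

lemma pair_content_cong:
  assumes "\<And>x. x \<in> X \<Longrightarrow> U x = U' x" "\<And>x. x \<in> X \<Longrightarrow> w x = w' x"
  shows "pair_content X U w = pair_content X U' w'"
proof -
  have "{x\<in>X. U x = j \<and> w x = k} = {x\<in>X. U' x = j \<and> w' x = k}" for j k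
    using assms by auto
  then show ?thesis by (simp add: pair_content_def)
qed

lemma pair_content_bij:
  assumes "bij_betw \<beta> X Y"
  shows "pair_content X (U \<circ> \<beta>) (w \<circ> \<beta>) = pair_content Y U w"
proof -
  have "card {x\<in>X. (U \<circ> \<beta>) x = j \<and> (w \<circ> \<beta>) x = k} = card {y\<in>Y. U y = j \<and> w y = k}" for j k
  proof (rule bij_betw_same_card[where f = \<beta>])
    show "bij_betw \<beta> {x\<in>X. (U \<circ> \<beta>) x = j \<and> (w \<circ> \<beta>) x = k} {y\<in>Y. U y = j \<and> w y = k}"
      using assms unfolding bij_betw_def inj_on_def by (auto simp: image_iff)
  qed
  then show ?thesis by (simp add: pair_content_def)
qed

lemma row_content_eq_pair_content: "row_content \<mu> w = pair_content (diagram \<mu>) fst w"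
proof (intro ext)
  fix i k
  show "row_content \<mu> w i k = pair_content (diagram \<mu>) fst w i k"
    unfolding row_content_def pair_content_def
    by (rule bij_betw_same_card[where f = "\<lambda>c. (i, c)"])
      (auto simp: bij_betw_def inj_on_def image_iff)
qed

lemma finite_diagram: "\<mu> \<in> compositions n r \<Longrightarrow> finite (diagram \<mu>)"
proof (rule finite_subset)
  assume "\<mu> \<in> compositions n r"
  then have 0: "\<mu> i = 0" if "i \<notin> {1..n}" for i using that by (auto simp: compositions_def)
  show "diagram \<mu> \<subseteq> (SIGMA i:{1..n}. {1..\<mu> i})"
  proof
    fix x assume "x \<in> diagram \<mu>"
    then obtain i c where x: "x = (i, c)" "1 \<le> i" "1 \<le> c" "c \<le> \<mu> i" by (auto simp: diagram_def)
    moreover have "i \<in> {1..n}" using 0[of i] x by (metis le_zero_eq not_one_le_zero)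
    ultimately show "x \<in> (SIGMA i:{1..n}. {1..\<mu> i})" by auto
  qed
qed auto

lemma fst_in_range:
  assumes "\<mu> \<in> compositions n r" "x \<in> diagram \<mu>"
  shows "fst x \<in> {1..n}"
proof -
  have "\<mu> i = 0" if "i \<notin> {1..n}" for i using that assms(1) by (auto simp: compositions_def)
  then show ?thesis using assms(2) by (cases x) (force simp: diagram_def)
qed

lemma column_permsD:
  assumes "\<sigma> \<in> column_perms \<mu>"
  shows "\<sigma> permutes diagram \<mu>" "\<And>x. snd (\<sigma> x) = snd x"
proof -
  show p: "\<sigma> permutes diagram \<mu>" using assms by (simp add: column_perms_def)
  show "snd (\<sigma> x) = snd x" for x
    using assms permutes_not_in[OF p, of x] by (cases "x \<in> diagram \<mu>") (auto simp: column_perms_def)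
qed

lemma finite_column_perms: "finite (diagram \<mu>) \<Longrightarrow> finite (column_perms \<mu>)"
  by (rule finite_subset[OF _ finite_permutations[of "diagram \<mu>"]]) (auto simp: column_perms_def)

lemma column_perms_id: "id \<in> column_perms \<mu>"
  by (simp add: column_perms_def)

lemma column_perms_comp:
  "\<sigma> \<in> column_perms \<mu> \<Longrightarrow> \<tau> \<in> column_perms \<mu> \<Longrightarrow> \<sigma> \<circ> \<tau> \<in> column_perms \<mu>"
  unfolding column_perms_def
  by (simp add: permutes_compose permutes_in_image)

lemma column_perms_inv: "\<sigma> \<in> column_perms \<mu> \<Longrightarrow> Hilbert_Choice.inv \<sigma> \<in> column_perms \<mu>"
  unfolding column_perms_def
proof (clarsimp, intro conjI)
  assume a: "\<sigma> permutes diagram \<mu>" "\<forall>x\<in>diagram \<mu>. snd (\<sigma> x) = snd x"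
  show "Hilbert_Choice.inv \<sigma> permutes diagram \<mu>" using a(1) by (rule permutes_inv)
  show "\<forall>x\<in>diagram \<mu>. snd (Hilbert_Choice.inv \<sigma> x) = snd x"
  proof
    fix x assume "x \<in> diagram \<mu>"
    then have "Hilbert_Choice.inv \<sigma> x \<in> diagram \<mu>" using permutes_in_image[OF permutes_inv[OF a(1)]] by simp
    then have "snd (\<sigma> (Hilbert_Choice.inv \<sigma> x)) = snd (Hilbert_Choice.inv \<sigma> x)" using a(2) by simp
    then show "snd (Hilbert_Choice.inv \<sigma> x) = snd x" using permutes_inverses(1)[OF a(1)] by simp
  qed
qed

lemma column_perms_transpose:
  "x \<in> diagram \<mu> \<Longrightarrow> y \<in> diagram \<mu> \<Longrightarrow> snd x = snd y \<Longrightarrow> transpose x y \<in> column_perms \<mu>"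
  by (auto simp: column_perms_def permutes_swap_id transpose_def)

lemma sum_column_perms_comp:
  assumes "\<tau> \<in> column_perms \<mu>"
  shows "(\<Sum>\<sigma>\<in>column_perms \<mu>. f (\<sigma> \<circ> \<tau>)) = (\<Sum>\<sigma>\<in>column_perms \<mu>. f \<sigma>)"
proof (rule sum.reindex_bij_witness[where i = "\<lambda>\<sigma>. \<sigma> \<circ> Hilbert_Choice.inv \<tau>" and j = "\<lambda>\<sigma>. \<sigma> \<circ> \<tau>"])
  note p = column_permsD(1)[OF assms]
  show "\<sigma> \<circ> \<tau> \<circ> Hilbert_Choice.inv \<tau> = \<sigma>" "\<sigma> \<circ> Hilbert_Choice.inv \<tau> \<circ> \<tau> = \<sigma>" for \<sigma> :: "nat \<times> nat \<Rightarrow> nat \<times> nat"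
    using permutes_inv_o[OF p] by (simp_all add: comp_assoc)
  show "\<sigma> \<circ> \<tau> \<in> column_perms \<mu>" "\<sigma> \<circ> Hilbert_Choice.inv \<tau> \<in> column_perms \<mu>" if "\<sigma> \<in> column_perms \<mu>" for \<sigma>
    using that assms by (simp_all add: column_perms_comp column_perms_inv)
qed simp

lemma sign_column_perms_comp:
  assumes "finite (diagram \<mu>)" "\<sigma> \<in> column_perms \<mu>" "\<tau> \<in> column_perms \<mu>"
  shows "sign (\<sigma> \<circ> \<tau>) = sign \<sigma> * sign \<tau>"
proof (rule sign_compose)
  show "permutation \<sigma>" using assms(1) column_permsD(1)[OF assms(2)] permutation_permutes by blast
  show "permutation \<tau>" using assms(1) column_permsD(1)[OF assms(3)] permutation_permutes by blast
qed

text \<open>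
  The coefficient of the monomial \<open>B\<close> in \<open>\<Sum>\<^sub>\<sigma> sign \<sigma> \<Prod>\<^sub>x X(U x, S (\<sigma> x))\<close>, which is a product of minors,
  one for each column; for \<open>U = fst\<close> it is the bideterminant of \<open>S\<close>.  The values are integers, so
  that antisymmetry gives 0 before any reduction modulo 2.
\<close>

definition alternant ::
  "(nat \<Rightarrow> nat) \<Rightarrow> (nat \<times> nat \<Rightarrow> nat) \<Rightarrow> (nat \<Rightarrow> nat \<Rightarrow> nat) \<Rightarrow> (nat \<times> nat \<Rightarrow> nat) \<Rightarrow> int" where
  "alternant \<mu> S B U =
     (\<Sum>\<sigma>\<in>column_perms \<mu>. sign \<sigma> * of_bool (pair_content (diagram \<mu>) U (S \<circ> \<sigma>) = B))"

lemma alternant_comp: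
  assumes "finite (diagram \<mu>)" "\<tau> \<in> column_perms \<mu>"
  shows "alternant \<mu> S B (U \<circ> \<tau>) = sign \<tau> * alternant \<mu> S B U"
proof -
  have "alternant \<mu> S B (U \<circ> \<tau>)
      = (\<Sum>\<sigma>\<in>column_perms \<mu>.
           sign (\<sigma> \<circ> \<tau>) * of_bool (pair_content (diagram \<mu>) (U \<circ> \<tau>) (S \<circ> (\<sigma> \<circ> \<tau>)) = B))"
    unfolding alternant_def by (rule sum_column_perms_comp[OF assms(2), symmetric])
  also have "\<dots> = (\<Sum>\<sigma>\<in>column_perms \<mu>.
      sign \<tau> * (sign \<sigma> * of_bool (pair_content (diagram \<mu>) U (S \<circ> \<sigma>) = B)))"
    using pair_content_bij[OF permutes_imp_bij[OF column_permsD(1)[OF assms(2)]]]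
      sign_column_perms_comp[OF assms(1) _ assms(2)]
    by (intro sum.cong refl) (simp add: comp_assoc[symmetric])
  finally show ?thesis by (simp add: alternant_def sum_distrib_left)
qed

lemma alternant_swap:
  assumes "finite (diagram \<mu>)" "x \<in> diagram \<mu>" "y \<in> diagram \<mu>" "snd x = snd y" "x \<noteq> y"
  shows "alternant \<mu> S B (U \<circ> transpose x y) = - alternant \<mu> S B U"
  using alternant_comp[OF assms(1) column_perms_transpose[OF assms(2-4)]] assms(5)
  by (simp add: sign_swap_id)

lemma alternant_eq_0:
  assumes "finite (diagram \<mu>)" "x \<in> diagram \<mu>" "y \<in> diagram \<mu>" "snd x = snd y" "x \<noteq> y" "U x = U y"
  shows "alternant \<mu> S B U = 0"
proof -
  have "U \<circ> transpose x y = U" using assms(6) by (auto simp: transpose_def)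
  then show ?thesis using alternant_swap[OF assms(1-5), of S B U] by simp
qed

definition cell_weight :: "(nat \<Rightarrow> nat) \<Rightarrow> (nat \<times> nat \<Rightarrow> nat) \<Rightarrow> nat" where
  "cell_weight \<mu> w = (\<Sum>x\<in>diagram \<mu>. fst x * w x)"

text \<open>
  The rearrangement inequality for two cells.
\<close>

lemma cell_weight_transpose:
  assumes fin: "finite (diagram \<mu>)" and x: "x \<in> diagram \<mu>" and y: "y \<in> diagram \<mu>"
    and "fst x < fst y" "w y < w x"
  shows "cell_weight \<mu> w < cell_weight \<mu> (w \<circ> transpose x y)"
proof -
  have xy: "x \<noteq> y" using assms(4) by auto
  have split: "(\<Sum>z\<in>diagram \<mu>. f z) = f x + (f y + (\<Sum>z\<in>diagram \<mu> - {x} - {y}. f z))"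
    for f :: "nat \<times> nat \<Rightarrow> nat"
    using sum.remove[OF fin x, of f] sum.remove[of "diagram \<mu> - {x}" y f] fin y xy by auto
  have "fst x * w x + fst y * w y < fst x * w y + fst y * w x"
  proof -
    obtain a b where "fst y = fst x + Suc a" "w x = w y + Suc b"
      using assms(4,5) by (metis less_natE add_Suc_right)
    then show ?thesis by (simp add: algebra_simps)
  qed
  moreover have "(\<Sum>z\<in>diagram \<mu> - {x} - {y}. fst z * (w \<circ> transpose x y) z)
      = (\<Sum>z\<in>diagram \<mu> - {x} - {y}. fst z * w z)"
    by (rule sum.cong) (auto simp: transpose_def)
  ultimately show ?thesis
    unfolding cell_weight_def split[of "\<lambda>z. fst z * w z"] split[of "\<lambda>z. fst z * (w \<circ> transpose x y) z"]
    using xy by simp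
qed

definition column_injective :: "(nat \<Rightarrow> nat) \<Rightarrow> (nat \<times> nat \<Rightarrow> nat) \<Rightarrow> bool" where
  "column_injective \<mu> w \<longleftrightarrow>
     (\<forall>x\<in>diagram \<mu>. \<forall>y\<in>diagram \<mu>. snd x = snd y \<and> w x = w y \<longrightarrow> x = y)"

lemma column_strict_iff:
  "column_strict \<mu> T \<longleftrightarrow>
     (\<forall>x\<in>diagram \<mu>. \<forall>y\<in>diagram \<mu>. snd x = snd y \<and> fst x < fst y \<longrightarrow> T x < T y)"
  unfolding column_strict_def by (metis fst_conv prod.collapse snd_conv)

lemma column_strict_imp_injective:
  assumes "column_strict \<mu> T" shows "column_injective \<mu> T"
  unfolding column_injective_def
proof (intro ballI impI)
  fix x y assume a: "x \<in> diagram \<mu>" "y \<in> diagram \<mu>" "snd x = snd y \<and> T x = T y"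
  have "\<not> fst x < fst y" "\<not> fst y < fst x"
    using assms a unfolding column_strict_iff by (metis less_irrefl)+
  then show "x = y" using a(3) by (simp add: prod_eq_iff)
qed

lemma column_injective_comp:
  assumes "column_injective \<mu> w" "\<sigma> \<in> column_perms \<mu>"
  shows "column_injective \<mu> (w \<circ> \<sigma>)"
  unfolding column_injective_def
proof (intro ballI impI)
  fix x y assume a: "x \<in> diagram \<mu>" "y \<in> diagram \<mu>" "snd x = snd y \<and> (w \<circ> \<sigma>) x = (w \<circ> \<sigma>) y"
  note p = column_permsD[OF assms(2)]
  have "\<sigma> x = \<sigma> y"
    using assms(1) a permutes_in_image[OF p(1)] p(2) unfolding column_injective_def by auto
  then show "x = y" using permutes_inj[OF p(1)] by (auto dest: injD)
qed

text \<open>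
  An inversion in a column could be undone by a transposition, which increases the weight.
\<close>

lemma column_strict_of_maximal_weight:
  assumes fin: "finite (diagram \<mu>)" and w: "column_injective \<mu> w" and \<tau>: "\<tau> \<in> column_perms \<mu>"
    and max: "\<And>\<rho>. \<rho> \<in> column_perms \<mu> \<Longrightarrow> cell_weight \<mu> (w \<circ> \<rho>) \<le> cell_weight \<mu> (w \<circ> \<tau>)"
  shows "column_strict \<mu> (w \<circ> \<tau>)"
  unfolding column_strict_iff
proof (intro ballI impI)
  fix x y assume a: "x \<in> diagram \<mu>" "y \<in> diagram \<mu>" "snd x = snd y \<and> fst x < fst y"
  show "(w \<circ> \<tau>) x < (w \<circ> \<tau>) y"
  proof (rule ccontr)
    assume n: "\<not> ?thesis"
    moreover have "(w \<circ> \<tau>) x \<noteq> (w \<circ> \<tau>) y"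
      using column_injective_comp[OF w \<tau>] a unfolding column_injective_def by blast
    ultimately have "cell_weight \<mu> (w \<circ> \<tau>) < cell_weight \<mu> (w \<circ> \<tau> \<circ> transpose x y)"
      using a by (intro cell_weight_transpose[OF fin]) auto
    moreover have "\<tau> \<circ> transpose x y \<in> column_perms \<mu>"
      using \<tau> a by (intro column_perms_comp column_perms_transpose) auto
    ultimately show False using max by (metis comp_assoc leD)
  qed
qed

lemma ex_maximal_weight:
  assumes "finite (diagram \<mu>)"
  shows "\<exists>\<tau>\<in>column_perms \<mu>. \<forall>\<rho>\<in>column_perms \<mu>. cell_weight \<mu> (w \<circ> \<rho>) \<le> cell_weight \<mu> (w \<circ> \<tau>)"
proof -
  let ?A = "(\<lambda>\<rho>. cell_weight \<mu> (w \<circ> \<rho>)) ` column_perms \<mu>"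
  have A: "finite ?A" "?A \<noteq> {}" using finite_column_perms[OF assms] column_perms_id by auto
  obtain \<tau> where "\<tau> \<in> column_perms \<mu>" "Max ?A = cell_weight \<mu> (w \<circ> \<tau>)"
    using Max_in[OF A] by auto
  then show ?thesis using Max_ge[OF A(1)] by (metis imageI)
qed

lemma ex_column_sort:
  assumes "finite (diagram \<mu>)" "column_injective \<mu> w"
  shows "\<exists>\<tau>\<in>column_perms \<mu>. column_strict \<mu> (w \<circ> \<tau>)"
  using ex_maximal_weight[OF assms(1), of w] column_strict_of_maximal_weight[OF assms] by blast

text \<open>
  In a column strict filling the number of smaller entries in the column is the number of cells
  above, so \<open>\<sigma>\<close> preserves this number.
\<close>

lemma column_sort_unique:
  assumes fin: "finite (diagram \<mu>)" and S: "column_strict \<mu> S"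
    and \<sigma>: "\<sigma> \<in> column_perms \<mu>" and S\<sigma>: "column_strict \<mu> (S \<circ> \<sigma>)"
  shows "\<sigma> = id"
proof -
  note p = column_permsD[OF \<sigma>]
  let ?above = "\<lambda>x. {y\<in>diagram \<mu>. snd y = snd x \<and> fst y < fst x}"
  have strict: "T y < T x \<longleftrightarrow> fst y < fst x"
    if "column_strict \<mu> T" "x \<in> diagram \<mu>" "y \<in> diagram \<mu>" "snd y = snd x" for T x y
    using that unfolding column_strict_iff
    by (metis not_less_iff_gr_or_eq prod_eq_iff)
  have "\<sigma> x = x" if x: "x \<in> diagram \<mu>" for x
  proof -
    have \<sigma>x: "\<sigma> x \<in> diagram \<mu>" using permutes_in_image[OF p(1)] x by simp
    have same: "card (?above x) = card (?above (\<sigma> x))"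
    proof (rule bij_betw_same_card[of \<sigma>])
      have "\<sigma> ` ?above x = ?above (\<sigma> x)"
      proof (intro equalityI subsetI)
        fix z assume "z \<in> \<sigma> ` ?above x"
        then obtain y where y: "y \<in> diagram \<mu>" "snd y = snd x" "fst y < fst x" "z = \<sigma> y" by auto
        have "(S \<circ> \<sigma>) y < (S \<circ> \<sigma>) x" using strict[OF S\<sigma> x y(1,2)] y(3) by simp
        then have "fst (\<sigma> y) < fst (\<sigma> x)"
          using strict[OF S \<sigma>x, of "\<sigma> y"] permutes_in_image[OF p(1)] y(1,2) p(2) by simp
        then show "z \<in> ?above (\<sigma> x)" using y p permutes_in_image[OF p(1)] by simp
      next
        fix z assume z: "z \<in> ?above (\<sigma> x)"
        obtain y where y: "y \<in> diagram \<mu>" "z = \<sigma> y"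
          using z permutes_image[OF p(1)] by (metis (mono_tags, lifting) imageE mem_Collect_eq)
        have s: "snd y = snd x" using z y p(2) by simp
        have "S (\<sigma> y) < S (\<sigma> x)" using strict[OF S \<sigma>x, of z] z y by simp
        then have "fst y < fst x" using strict[OF S\<sigma> x y(1) s] by simp
        then show "z \<in> \<sigma> ` ?above x" using y s by blast
      qed
      then show "bij_betw \<sigma> (?above x) (?above (\<sigma> x))"
        using permutes_inj[OF p(1)] by (auto simp: bij_betw_def inj_on_def dest: injD)
    qed
    have less: "card (?above a) < card (?above b)"
      if "a \<in> diagram \<mu>" "fst a < fst b" "snd a = snd b" for a b
    proof (rule psubset_card_mono)
      show "finite (?above b)" using fin by simp
      have "a \<in> ?above b" "a \<notin> ?above a" "?above a \<subseteq> ?above b" using that by auto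
      then show "?above a \<subset> ?above b" by blast
    qed
    have "fst (\<sigma> x) = fst x"
    proof (rule linorder_cases[of "fst (\<sigma> x)" "fst x"])
      assume "fst (\<sigma> x) < fst x"
      then show ?thesis using less[OF \<sigma>x, of x] same p(2) by simp
    next
      assume "fst x < fst (\<sigma> x)"
      then show ?thesis using less[OF x, of "\<sigma> x"] same p(2) by simp
    qed
    then show ?thesis using p(2) by (simp add: prod_eq_iff)
  qed
  then show ?thesis using permutes_not_in[OF p(1)] by (metis eq_id_iff)
qed

lemma cell_weight_less_of_column_strict:
  assumes fin: "finite (diagram \<mu>)" and S: "column_strict \<mu> S"
    and \<sigma>: "\<sigma> \<in> column_perms \<mu>" "\<sigma> \<noteq> id"
  shows "cell_weight \<mu> (S \<circ> \<sigma>) < cell_weight \<mu> S"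
proof -
  obtain \<tau> where \<tau>: "\<tau> \<in> column_perms \<mu>"
      "\<And>\<rho>. \<rho> \<in> column_perms \<mu> \<Longrightarrow> cell_weight \<mu> (S \<circ> \<rho>) \<le> cell_weight \<mu> (S \<circ> \<tau>)"
    using ex_maximal_weight[OF fin, of S] by blast
  note max = column_strict_of_maximal_weight[OF fin column_strict_imp_injective[OF S]]
  have "\<tau> = id" by (rule column_sort_unique[OF fin S \<tau>(1) max[OF \<tau>]])
  then have le: "cell_weight \<mu> (S \<circ> \<rho>) \<le> cell_weight \<mu> S" if "\<rho> \<in> column_perms \<mu>" for \<rho>
    using \<tau>(2)[OF that] by simp
  show ?thesis
  proof (rule ccontr)
    assume "\<not> ?thesis"
    then have "cell_weight \<mu> (S \<circ> \<rho>) \<le> cell_weight \<mu> (S \<circ> \<sigma>)" if "\<rho> \<in> column_perms \<mu>" for \<rho>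
      using le[OF that] by simp
    then have "column_strict \<mu> (S \<circ> \<sigma>)" by (rule max[OF \<sigma>(1)])
    then have "\<sigma> = id" by (rule column_sort_unique[OF fin S \<sigma>(1)])
    then show False using \<sigma>(2) by simp
  qed
qed

section \<open>Divided power row operators on alternating sums\<close>

definition relabel :: "'x set \<Rightarrow> nat \<Rightarrow> ('x \<Rightarrow> nat) \<Rightarrow> 'x \<Rightarrow> nat" where
  "relabel Z s U = (\<lambda>x. if x \<in> Z then s else U x)"

lemma row_raise_sum:
  "row_raise n s t (\<lambda>B. \<Sum>i\<in>I. P i B) M = (\<Sum>i\<in>I. row_raise n s t (P i) M)"
  unfolding row_raise_def sum_distrib_left by (rule sum.swap)

lemma row_raise_mult_left:
  "row_raise n s t (\<lambda>B. c * P B) M = c * row_raise n s t P M"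
  unfolding row_raise_def sum_distrib_left by (intro sum.cong refl) (simp only: mult.left_commute)

lemma row_raise_diff:
  fixes P Q :: "(nat \<Rightarrow> nat \<Rightarrow> nat) \<Rightarrow> 'a::comm_ring_1"
  shows "row_raise n s t (\<lambda>B. P B - Q B) M = row_raise n s t P M - row_raise n s t Q M"
  unfolding row_raise_def by (simp only: sum_subtractf right_diff_distrib)

lemma row_raise_of_int:
  "row_raise n s t (\<lambda>B. of_int (P B)) M = (of_int (row_raise n s t P M) :: 'a::comm_ring_1)"
  unfolding row_raise_def by (simp only: of_int_sum of_int_mult of_int_of_nat_eq)

text \<open>
  On a monomial \<open>\<Prod>\<^sub>x X(U x, w x)\<close> the operator chooses \<open>t\<close> of the factors from row \<open>s + 1\<close> and moves
  them to row \<open>s\<close>.  The binomial coefficients count the choices \<open>Z\<close> of factors with content \<open>Y\<close>.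
\<close>

lemma row_raise_indicator:
  assumes fin: "finite X" and w: "\<And>x. x \<in> X \<Longrightarrow> w x \<in> {1..n}"
  shows "row_raise n s t (\<lambda>B. of_bool (pair_content X U w = B)) M
       = (of_nat (card {Z. Z \<subseteq> {x\<in>X. U x = Suc s} \<and> card Z = t \<and>
                            pair_content X (relabel Z s U) w = M}) :: int)"
proof -
  let ?C = "pair_content X U w"
  let ?X1 = "{x\<in>X. U x = Suc s}"
  let ?y = "\<lambda>Z k. card {x\<in>Z. w x = k}"
  let ?ZZ = "{Z. Z \<subseteq> ?X1 \<and> card Z = t \<and> pair_content X (relabel Z s U) w = M}"
  let ?M = "\<lambda>Y. M (s := \<lambda>k. M s k - Y k, Suc s := \<lambda>k. M (Suc s) k + Y k)"
  have finZ: "finite Z" if "Z \<subseteq> ?X1" for Z using that fin by (auto intro: finite_subset)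
  have rs: "pair_content X (relabel Z s U) w s k = ?C s k + ?y Z k" if "Z \<subseteq> ?X1" for Z k
  proof -
    have "{x\<in>X. relabel Z s U x = s \<and> w x = k} = {x\<in>X. U x = s \<and> w x = k} \<union> {x\<in>Z. w x = k}"
      using that by (auto simp: relabel_def)
    moreover have "{x\<in>X. U x = s \<and> w x = k} \<inter> {x\<in>Z. w x = k} = {}" using that by auto
    ultimately show ?thesis unfolding pair_content_def
      using fin finZ[OF that] by (simp add: card_Un_disjoint)
  qed
  have rS: "?C (Suc s) k = pair_content X (relabel Z s U) w (Suc s) k + ?y Z k"
    if "Z \<subseteq> ?X1" for Z k
  proof -
    have "{x\<in>X. U x = Suc s \<and> w x = k}
        = {x\<in>X. relabel Z s U x = Suc s \<and> w x = k} \<union> {x\<in>Z. w x = k}"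
      using that by (auto simp: relabel_def)
    moreover have "{x\<in>X. relabel Z s U x = Suc s \<and> w x = k} \<inter> {x\<in>Z. w x = k} = {}"
      by (auto simp: relabel_def)
    ultimately show ?thesis unfolding pair_content_def
      using fin finZ[OF that] by (simp add: card_Un_disjoint)
  qed
  have ro: "pair_content X (relabel Z s U) w j = ?C j" if "Z \<subseteq> ?X1" "j \<noteq> s" "j \<noteq> Suc s" for Z j
  proof -
    have "{x\<in>X. relabel Z s U x = j \<and> w x = k} = {x\<in>X. U x = j \<and> w x = k}" for k
      using that by (auto simp: relabel_def)
    then show ?thesis unfolding pair_content_def by simp
  qed
  have y0: "?y Z k = 0" if "Z \<subseteq> ?X1" "k \<notin> {1..n}" for Z k
  proof -
    have "{x\<in>Z. w x = k} = {}" using that w by auto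
    then show ?thesis by (simp only: card.empty)
  qed
  have ysum: "(\<Sum>k=1..n. ?y Z k) = card Z" if "Z \<subseteq> ?X1" for Z
  proof -
    have "(\<Sum>k=1..n. sum (\<lambda>_. 1) {x\<in>Z. w x = k}) = sum (\<lambda>_. 1::nat) Z"
      by (rule sum.group) (use finZ[OF that] that w in auto)
    then show ?thesis by simp
  qed
  have ysub: "?y Z \<in> sub_indices n (M s) t" if "Z \<in> ?ZZ" for Z
    using that rs[of Z] y0[of Z] ysum[of Z] by (auto simp: sub_indices_def)
  \<comment> \<open>the content \<open>Y\<close> of \<open>Z\<close> and the target \<open>M\<close> determine the content before relabelling\<close>
  have iff: "pair_content X (relabel Z s U) w = M \<longleftrightarrow> ?C = ?M Y"
    if Z: "Z \<subseteq> ?X1" and Y: "Y \<in> sub_indices n (M s) t" "?y Z = Y" for Z Y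
  proof
    assume e: "pair_content X (relabel Z s U) w = M"
    show "?C = ?M Y"
    proof
      fix j show "?C j = ?M Y j"
        using rs[OF Z] rS[OF Z] ro[OF Z, of j] e Y(2) by (auto simp: fun_eq_iff)
    qed
  next
    assume e: "?C = ?M Y"
    have Yle: "Y k \<le> M s k" for k using Y(1) by (simp add: sub_indices_def)
    show "pair_content X (relabel Z s U) w = M"
    proof
      fix j
      have Cj: "?C j = ?M Y j" for j using e by simp
      consider "j = s" | "j = Suc s" | "j \<noteq> s" "j \<noteq> Suc s" by blast
      then show "pair_content X (relabel Z s U) w j = M j"
      proof cases
        case 1
        then show ?thesis using rs[OF Z] Cj[of s] Y(2) Yle by (auto simp: fun_eq_iff)
      next
        case 2
        then show ?thesis using rS[OF Z] Cj[of "Suc s"] Y(2) by (auto simp: fun_eq_iff)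
      next
        case 3
        then show ?thesis using ro[OF Z 3] Cj[of j] by simp
      qed
    qed
  qed
  have fibre: "card {Z\<in>?ZZ. ?y Z = Y}
      = (\<Prod>k=1..n. (M (Suc s) k + Y k) choose Y k) * of_bool (?C = ?M Y)"
    if Y: "Y \<in> sub_indices n (M s) t" for Y
  proof (cases "?C = ?M Y")
    case True
    have Y0: "Y k = 0" if "k \<notin> {1..n}" for k using Y that by (auto simp: sub_indices_def)
    have "{Z\<in>?ZZ. ?y Z = Y} = {Z. Z \<subseteq> ?X1 \<and> (\<forall>k\<in>{1..n}. card {x\<in>Z. w x = k} = Y k)}"
    proof (intro equalityI subsetI)
      fix Z assume "Z \<in> {Z\<in>?ZZ. ?y Z = Y}"
      then show "Z \<in> {Z. Z \<subseteq> ?X1 \<and> (\<forall>k\<in>{1..n}. card {x\<in>Z. w x = k} = Y k)}" by auto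
    next
      fix Z assume Z: "Z \<in> {Z. Z \<subseteq> ?X1 \<and> (\<forall>k\<in>{1..n}. card {x\<in>Z. w x = k} = Y k)}"
      then have Z1: "Z \<subseteq> ?X1" by simp
      have yY: "?y Z = Y"
      proof
        fix k show "?y Z k = Y k" using Z y0[OF Z1, of k] Y0[of k] by (cases "k \<in> {1..n}") auto
      qed
      have "(\<Sum>k=1..n. ?y Z k) = (\<Sum>k=1..n. Y k)"
        using fun_cong[OF yY] by (intro sum.cong) auto
      then have "card Z = t" using ysum[OF Z1] Y by (simp add: sub_indices_def)
      then show "Z \<in> {Z\<in>?ZZ. ?y Z = Y}" using iff[OF Z1 Y yY] True yY Z1 by simp
    qed
    also have "card \<dots> = (\<Prod>k\<in>{1..n}. card {x\<in>?X1. w x = k} choose Y k)"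
      by (rule card_subsets_with_content) (use fin w in auto)
    also have "\<dots> = (\<Prod>k=1..n. (M (Suc s) k + Y k) choose Y k)"
    proof (rule prod.cong[OF refl])
      fix k
      have "card {x\<in>?X1. w x = k} = ?C (Suc s) k" by (simp add: pair_content_def conj_assoc)
      also have "\<dots> = ?M Y (Suc s) k" using True by simp
      finally show "(card {x\<in>?X1. w x = k} choose Y k) = ((M (Suc s) k + Y k) choose Y k)" by simp
    qed
    finally show ?thesis using True by (simp only: of_bool_eq_iff refl of_bool_eq simp_thms mult_1_right)
  next
    case False
    have "{Z\<in>?ZZ. ?y Z = Y} = {}" using iff[OF _ Y] False by blast
    then show ?thesis using False by (simp only: card.empty of_bool_eq mult_0_right)
  qed
  have "card ?ZZ = (\<Sum>Z\<in>?ZZ. 1)" by simp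
  also have "\<dots> = (\<Sum>Y\<in>sub_indices n (M s) t. \<Sum>Z\<in>{Z\<in>?ZZ. ?y Z = Y}. 1)"
    by (rule sum.group[symmetric]) (use fin finite_sub_indices ysub in auto)
  also have "\<dots> = (\<Sum>Y\<in>sub_indices n (M s) t. card {Z\<in>?ZZ. ?y Z = Y})" by simp
  also have "\<dots> = (\<Sum>Y\<in>sub_indices n (M s) t.
      (\<Prod>k=1..n. (M (Suc s) k + Y k) choose Y k) * of_bool (?C = ?M Y))"
    by (rule sum.cong[OF refl fibre])
  finally show ?thesis
    unfolding row_raise_def by (simp only: of_nat_sum of_nat_mult of_nat_of_bool)
qed

lemma tableaux_range: "S \<in> tableaux n \<mu> \<Longrightarrow> x \<in> diagram \<mu> \<Longrightarrow> S x \<in> {1..n}"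
  by (simp add: tableaux_def)

lemma row_raise_alternant:
  assumes fin: "finite (diagram \<mu>)" and S: "S \<in> tableaux n \<mu>"
  shows "row_raise n s t (\<lambda>B. alternant \<mu> S B U) M
       = (\<Sum>Z | Z \<subseteq> {x\<in>diagram \<mu>. U x = Suc s} \<and> card Z = t. alternant \<mu> S M (relabel Z s U))"
proof -
  let ?Z = "{Z. Z \<subseteq> {x\<in>diagram \<mu>. U x = Suc s} \<and> card Z = t}"
  have finZ: "finite ?Z" using fin by simp
  have "row_raise n s t (\<lambda>B. alternant \<mu> S B U) M
      = (\<Sum>\<sigma>\<in>column_perms \<mu>. sign \<sigma> *
          row_raise n s t (\<lambda>B. of_bool (pair_content (diagram \<mu>) U (S \<circ> \<sigma>) = B)) M)"
    unfolding alternant_def by (simp only: row_raise_sum row_raise_mult_left)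
  also have "\<dots> = (\<Sum>\<sigma>\<in>column_perms \<mu>. \<Sum>Z\<in>?Z.
      sign \<sigma> * of_bool (pair_content (diagram \<mu>) (relabel Z s U) (S \<circ> \<sigma>) = M))"
  proof (rule sum.cong[OF refl])
    fix \<sigma> assume \<sigma>: "\<sigma> \<in> column_perms \<mu>"
    have "row_raise n s t (\<lambda>B. of_bool (pair_content (diagram \<mu>) U (S \<circ> \<sigma>) = B)) M
        = int (card {Z. Z \<subseteq> {x\<in>diagram \<mu>. U x = Suc s} \<and> card Z = t \<and>
                            pair_content (diagram \<mu>) (relabel Z s U) (S \<circ> \<sigma>) = M})"
      by (rule row_raise_indicator[OF fin])
        (use tableaux_range[OF S] permutes_in_image[OF column_permsD(1)[OF \<sigma>]] in auto)
    also have "{Z. Z \<subseteq> {x\<in>diagram \<mu>. U x = Suc s} \<and> card Z = t \<and>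
                pair_content (diagram \<mu>) (relabel Z s U) (S \<circ> \<sigma>) = M}
        = ?Z \<inter> {Z. pair_content (diagram \<mu>) (relabel Z s U) (S \<circ> \<sigma>) = M}" by blast
    also have "int (card \<dots>)
        = (\<Sum>Z\<in>?Z. of_bool (pair_content (diagram \<mu>) (relabel Z s U) (S \<circ> \<sigma>) = M))"
      using finZ by (subst sum_of_bool_eq) simp_all
    finally show "sign \<sigma> *
          row_raise n s t (\<lambda>B. of_bool (pair_content (diagram \<mu>) U (S \<circ> \<sigma>) = B)) M
        = (\<Sum>Z\<in>?Z. sign \<sigma> * of_bool (pair_content (diagram \<mu>) (relabel Z s U) (S \<circ> \<sigma>) = M))"
      by (simp only: sum_distrib_left)
  qed
  also have "\<dots> = (\<Sum>Z\<in>?Z. alternant \<mu> S M (relabel Z s U))"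
    unfolding alternant_def by (rule sum.swap)
  finally show ?thesis .
qed

lemma partitions_antimono:
  assumes "lam \<in> partitions n r" "1 \<le> i" "i \<le> j"
  shows "lam j \<le> lam i"
proof (cases "j \<le> n")
  case True
  then show ?thesis using assms by (auto simp: partitions_def)
next
  case False
  then show ?thesis using assms by (auto simp: partitions_def compositions_def)
qed

lemma partitions_compositions: "lam \<in> partitions n r \<Longrightarrow> lam \<in> compositions n r"
  by (simp add: partitions_def)

text \<open>
  A cell \<open>(s + 1, c)\<close> that is relabelled gets the label \<open>s\<close> of the cell \<open>(s, c)\<close> above it, and
  a minor with two equal rows is 0.
\<close>

lemma row_raise_bideterminant:
  assumes lam: "lam \<in> partitions n r" and S: "S \<in> tableaux n lam" and s: "s \<ge> 1" and t: "t \<ge> 1"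
  shows "row_raise n s t (\<lambda>B. alternant lam S B fst) M = 0"
proof -
  have fin: "finite (diagram lam)" by (rule finite_diagram[OF partitions_compositions[OF lam]])
  show ?thesis
    unfolding row_raise_alternant[OF fin S]
  proof (rule sum.neutral, rule ballI)
    fix Z assume Z: "Z \<in> {Z. Z \<subseteq> {x\<in>diagram lam. fst x = Suc s} \<and> card Z = t}"
    then have "Z \<noteq> {}" using t by auto
    then obtain c where c: "(Suc s, c) \<in> Z" "(Suc s, c) \<in> diagram lam" using Z by force
    have "(s, c) \<in> diagram lam"
      using c(2) partitions_antimono[OF lam s, of "Suc s"] s by (auto simp: diagram_def)
    then show "alternant lam S M (relabel Z s fst) = 0"
      using c Z by (intro alternant_eq_0[OF fin, of "(s, c)" "(Suc s, c)"]) (auto simp: relabel_def)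
  qed
qed

section \<open>The span of the bideterminants\<close>

text \<open>
  The weight for which the diagonal term of every minor is the leading one.
\<close>

definition matrix_weight :: "nat \<Rightarrow> (nat \<Rightarrow> nat \<Rightarrow> nat) \<Rightarrow> nat" where
  "matrix_weight n B = (\<Sum>j=1..n. \<Sum>k=1..n. j * k * B j k)"

lemma matrix_weight_pair_content:
  assumes "finite X" "\<And>x. x \<in> X \<Longrightarrow> U x \<in> {1..n}" "\<And>x. x \<in> X \<Longrightarrow> w x \<in> {1..n}"
  shows "matrix_weight n (pair_content X U w) = (\<Sum>x\<in>X. U x * w x)"
proof -
  have "(\<Sum>x\<in>X. U x * w x)
      = (\<Sum>q\<in>{1..n}\<times>{1..n}. \<Sum>x\<in>{x\<in>X. (U x, w x) = q}. U x * w x)"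
    by (rule sum.group[symmetric]) (use assms in auto)
  also have "\<dots> = (\<Sum>(j, k)\<in>{1..n}\<times>{1..n}. j * k * pair_content X U w j k)"
  proof (rule sum.cong[OF refl], clarify)
    fix j k
    have "(\<Sum>x\<in>{x\<in>X. (U x, w x) = (j, k)}. U x * w x) = (\<Sum>x\<in>{x\<in>X. (U x, w x) = (j, k)}. j * k)"
      by (rule sum.cong) auto
    then show "(\<Sum>x\<in>{x\<in>X. (U x, w x) = (j, k)}. U x * w x) = j * k * pair_content X U w j k"
      by (simp add: pair_content_def)
  qed
  finally show ?thesis by (simp add: matrix_weight_def sum.cartesian_product)
qed

lemma pair_content_in_D_basis:
  assumes fin: "finite X" and U: "\<And>x. x \<in> X \<Longrightarrow> U x \<in> I" and w: "\<And>x. x \<in> X \<Longrightarrow> w x \<in> {1..n}"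
    and \<beta>: "\<And>i. i \<in> I \<Longrightarrow> card {x\<in>X. U x = i} = \<beta> i"
  shows "pair_content X U w \<in> D_basis n I \<beta>"
  unfolding D_basis_def
proof (rule CollectI, intro conjI allI impI ballI)
  fix j k assume "pair_content X U w j k \<noteq> 0"
  then have "card {x\<in>X. U x = j \<and> w x = k} \<noteq> 0" unfolding pair_content_def .
  then have "{x\<in>X. U x = j \<and> w x = k} \<noteq> {}" by (metis card.empty)
  then obtain x where "x \<in> X" "U x = j" "w x = k" by blast
  then show "j \<in> I" "k \<in> {1..n}" using U[of x] w[of x] by simp_all
next
  fix i assume i: "i \<in> I"
  have "(\<Sum>k=1..n. sum (\<lambda>_. 1) {x\<in>{x\<in>X. U x = i}. w x = k}) = sum (\<lambda>_. 1::nat) {x\<in>X. U x = i}"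
    by (rule sum.group) (use fin w in auto)
  then show "(\<Sum>k=1..n. pair_content X U w i k) = \<beta> i"
    using \<beta>[OF i] by (simp add: pair_content_def conj_assoc)
qed

lemma card_row: "card {x\<in>diagram \<mu>. fst x = i} = (if i \<ge> 1 then \<mu> i else 0)"
proof -
  have "{x\<in>diagram \<mu>. fst x = i} = (if i \<ge> 1 then (\<lambda>c. (i, c)) ` {1..\<mu> i} else {})"
    by (auto simp: diagram_def)
  then show ?thesis by (simp add: card_image inj_on_def)
qed

lemma row_content_in_D_basis:
  assumes \<mu>: "\<mu> \<in> compositions n r" and w: "\<And>x. x \<in> diagram \<mu> \<Longrightarrow> w x \<in> {1..n}"
  shows "row_content \<mu> w \<in> D_basis n {1..n} \<mu>"
  unfolding row_content_eq_pair_content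
  by (rule pair_content_in_D_basis) (use finite_diagram[OF \<mu>] fst_in_range[OF \<mu>] w card_row in auto)

lemma matrix_weight_row_content:
  assumes \<mu>: "\<mu> \<in> compositions n r" and w: "\<And>x. x \<in> diagram \<mu> \<Longrightarrow> w x \<in> {1..n}"
  shows "matrix_weight n (row_content \<mu> w) = cell_weight \<mu> w"
  unfolding row_content_eq_pair_content cell_weight_def
  by (rule matrix_weight_pair_content) (use finite_diagram[OF \<mu>] fst_in_range[OF \<mu>] w in auto)

text \<open>
  Every column permutation except the identity lowers the weight of the column strict \<open>S\<close>.
\<close>

lemma alternant_leading:
  assumes \<mu>: "\<mu> \<in> compositions n r" and S: "S \<in> col_tableaux n \<mu>"
    and B: "matrix_weight n (row_content \<mu> S) \<le> matrix_weight n B"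
  shows "alternant \<mu> S B fst = of_bool (B = row_content \<mu> S)"
proof -
  have fin: "finite (diagram \<mu>)" by (rule finite_diagram[OF \<mu>])
  have ST: "S \<in> tableaux n \<mu>" and Sc: "column_strict \<mu> S" using S by (auto simp: col_tableaux_def)
  have ne: "row_content \<mu> (S \<circ> \<sigma>) \<noteq> B" if \<sigma>: "\<sigma> \<in> column_perms \<mu>" "\<sigma> \<noteq> id" for \<sigma>
  proof
    assume e: "row_content \<mu> (S \<circ> \<sigma>) = B"
    have "(S \<circ> \<sigma>) x \<in> {1..n}" if "x \<in> diagram \<mu>" for x
      using tableaux_range[OF ST] permutes_in_image[OF column_permsD(1)[OF \<sigma>(1)]] that by auto
    then have "matrix_weight n B = cell_weight \<mu> (S \<circ> \<sigma>)"
      using matrix_weight_row_content[OF \<mu>, of "S \<circ> \<sigma>"] e by simp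
    moreover have "matrix_weight n (row_content \<mu> S) = cell_weight \<mu> S"
      using matrix_weight_row_content[OF \<mu>] tableaux_range[OF ST] by blast
    ultimately show False using cell_weight_less_of_column_strict[OF fin Sc \<sigma>] B by simp
  qed
  have "alternant \<mu> S B fst = (\<Sum>\<sigma>\<in>{id}. sign \<sigma> * of_bool (row_content \<mu> (S \<circ> \<sigma>) = B))"
    unfolding alternant_def row_content_eq_pair_content[symmetric]
    by (rule sum.mono_neutral_right)
      (use finite_column_perms[OF fin] column_perms_id ne in auto)
  then show ?thesis by (auto simp: eq_commute)
qed

lemma finite_tableaux: "\<mu> \<in> compositions n r \<Longrightarrow> finite (tableaux n \<mu>)"
proof (rule finite_subset)
  assume \<mu>: "\<mu> \<in> compositions n r"
  show "tableaux n \<mu> \<subseteq> {T. \<forall>x. (x \<in> diagram \<mu> \<longrightarrow> T x \<in> {1..n}) \<and> (x \<notin> diagram \<mu> \<longrightarrow> T x = 0)}"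
    by (auto simp: tableaux_def)
  show "finite {T. \<forall>x. (x \<in> diagram \<mu> \<longrightarrow> T x \<in> {1..n}) \<and> (x \<notin> diagram \<mu> \<longrightarrow> T x = 0)}"
    by (rule finite_set_of_finite_funs) (use finite_diagram[OF \<mu>] in auto)
qed

lemma finite_col_tableaux: "\<mu> \<in> compositions n r \<Longrightarrow> finite (col_tableaux n \<mu>)"
  by (rule finite_subset[OF _ finite_tableaux]) (auto simp: col_tableaux_def)

lemma finite_D_basis:
  fixes \<beta> :: "'i \<Rightarrow> nat"
  assumes I: "finite I"
  shows "finite (D_basis n I \<beta>)"
proof -
  let ?F = "\<lambda>i. {b. \<forall>k. (k \<in> {1..n} \<longrightarrow> b k \<in> {..\<beta> i}) \<and> (k \<notin> {1..n} \<longrightarrow> b k = 0)}"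
  have fin: "finite (\<Union>i\<in>I. ?F i)"
    by (intro finite_UN_I I finite_set_of_finite_funs) auto
  have "D_basis n I \<beta> \<subseteq> {B. \<forall>i. (i \<in> I \<longrightarrow> B i \<in> (\<Union>i\<in>I. ?F i)) \<and> (i \<notin> I \<longrightarrow> B i = (\<lambda>_. 0))}"
  proof
    fix B assume B: "B \<in> D_basis n I \<beta>"
    have "B i \<in> ?F i" if "i \<in> I" for i
    proof (rule CollectI, intro allI conjI impI)
      fix k assume "k \<in> {1..n}"
      then have "B i k \<le> (\<Sum>k=1..n. B i k)" by (intro member_le_sum) auto
      then show "B i k \<in> {..\<beta> i}" using B that by (auto simp: D_basis_def)
    next
      fix k assume "k \<notin> {1..n}"
      then show "B i k = 0" using B by (auto simp: D_basis_def)
    qed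
    moreover have "B i = (\<lambda>_. 0)" if "i \<notin> I" for i
      using B that by (auto simp: D_basis_def)
    ultimately show "B \<in> {B. \<forall>i. (i \<in> I \<longrightarrow> B i \<in> (\<Union>i\<in>I. ?F i)) \<and> (i \<notin> I \<longrightarrow> B i = (\<lambda>_. 0))}"
      by blast
  qed
  then show ?thesis by (rule finite_subset) (rule finite_set_of_finite_funs[OF I fin])
qed

definition content_list :: "nat \<Rightarrow> (nat \<Rightarrow> nat) \<Rightarrow> nat list" where
  "content_list n f = concat (map (\<lambda>k. replicate (f k) k) [1..<Suc n])"

lemma content_list_Suc:
  "content_list (Suc n) f = content_list n f @ replicate (f (Suc n)) (Suc n)"
  by (simp add: content_list_def)

lemma content_list_props:
  "set (content_list n f) \<subseteq> {1..n}"
  "sorted (content_list n f)"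
  "length (content_list n f) = (\<Sum>k=1..n. f k)"
  "length (filter (\<lambda>x. x = k) (content_list n f)) = (if k \<in> {1..n} then f k else 0)"
proof (induction n)
  case 0
  { case 1 show ?case by (simp add: content_list_def)
  next case 2 show ?case by (simp add: content_list_def)
  next case 3 show ?case by (simp add: content_list_def)
  next case 4 show ?case by (simp add: content_list_def) }
next
  case (Suc n)
  { case 1 show ?case using Suc(1) by (auto simp: content_list_Suc)
  next case 2 show ?case using Suc(1,2) by (fastforce simp: content_list_Suc sorted_append)
  next case 3 show ?case using Suc(3) by (simp add: content_list_Suc)
  next case 4 show ?case using Suc(4) by (auto simp: content_list_Suc filter_replicate) }
qed

lemma ex_row_sorted_tableau:
  assumes \<mu>: "\<mu> \<in> compositions n r" and B: "B \<in> D_basis n {1..n} \<mu>"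
  shows "\<exists>T\<in>tableaux n \<mu>. row_weakly_increasing \<mu> T \<and> row_content \<mu> T = B"
proof -
  let ?L = "\<lambda>i. content_list n (B i)"
  define T where "T = (\<lambda>(i, c). if (i, c) \<in> diagram \<mu> then ?L i ! (c - 1) else 0)"
  have i: "i \<in> {1..n}" if "(i, c) \<in> diagram \<mu>" for i c
    using fst_in_range[OF \<mu> that] by simp
  have len: "length (?L i) = \<mu> i" if "i \<in> {1..n}" for i
    using B that by (simp add: content_list_props(3) D_basis_def)
  have T: "T \<in> tableaux n \<mu>"
    unfolding tableaux_def
  proof (rule CollectI, intro conjI ballI allI impI)
    fix x assume x: "x \<in> diagram \<mu>"
    obtain j c where jc: "x = (j, c)" by force
    have "?L j ! (c - 1) \<in> set (?L j)"
      by (rule nth_mem) (use x len[of j] i[of j c] in \<open>auto simp: jc diagram_def\<close>)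
    then show "T x \<in> {1..n}" using content_list_props(1)[of n "B j"] x by (auto simp: T_def jc)
  qed (auto simp: T_def)
  moreover have "row_weakly_increasing \<mu> T"
    unfolding row_weakly_increasing_def
  proof (intro allI impI)
    fix j c d assume a: "(j, c) \<in> diagram \<mu> \<and> (j, d) \<in> diagram \<mu> \<and> c < d"
    have "?L j ! (c - 1) \<le> ?L j ! (d - 1)"
      by (rule sorted_nth_mono[OF content_list_props(2)])
        (use a len[of j] i[of j c] in \<open>auto simp: diagram_def\<close>)
    then show "T (j, c) \<le> T (j, d)" using a by (simp add: T_def)
  qed
  moreover have "row_content \<mu> T = B"
  proof (intro ext)
    fix j k
    show "row_content \<mu> T j k = B j k"
    proof (cases "j \<in> {1..n}")
      case True
      have "row_content \<mu> T j k = card {d. d < length (?L j) \<and> ?L j ! d = k}"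
        unfolding row_content_def
      proof (rule bij_betw_same_card[where f = "\<lambda>c. c - 1"],
          rule bij_betw_byWitness[where f' = Suc])
        show "\<forall>c\<in>{c. (j, c) \<in> diagram \<mu> \<and> T (j, c) = k}. Suc (c - 1) = c"
          by (auto simp: diagram_def)
        show "(\<lambda>c. c - 1) ` {c. (j, c) \<in> diagram \<mu> \<and> T (j, c) = k}
            \<subseteq> {d. d < length (?L j) \<and> ?L j ! d = k}"
          using len[OF True] by (auto simp: diagram_def T_def)
        show "Suc ` {d. d < length (?L j) \<and> ?L j ! d = k}
            \<subseteq> {c. (j, c) \<in> diagram \<mu> \<and> T (j, c) = k}"
          using len[OF True] True by (auto simp: diagram_def T_def)
      qed auto
      also have "\<dots> = length (filter (\<lambda>x. x = k) (?L j))"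
        by (simp add: length_filter_conv_card)
      also have "\<dots> = B j k"
        using B by (auto simp: content_list_props(4) D_basis_def)
      finally show ?thesis .
    next
      case False
      then have "{c. (j, c) \<in> diagram \<mu> \<and> T (j, c) = k} = {}" using i by blast
      moreover have "B j k = 0" using B False by (auto simp: D_basis_def)
      ultimately show ?thesis unfolding row_content_def by (simp only: card.empty)
    qed
  qed
  ultimately show ?thesis by blast
qed

lemma card_row_entries_in:
  assumes fin: "finite (diagram \<mu>)" and A: "finite A"
  shows "card {c. (i, c) \<in> diagram \<mu> \<and> T (i, c) \<in> A} = (\<Sum>k\<in>A. row_content \<mu> T i k)"
proof -
  let ?X = "{c. (i, c) \<in> diagram \<mu> \<and> T (i, c) \<in> A}"
  have "finite ?X"
    by (rule finite_subset[of _ "snd ` diagram \<mu>"]) (use fin in force)+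
  then have "(\<Sum>k\<in>A. sum (\<lambda>_. 1) {c\<in>?X. T (i, c) = k}) = sum (\<lambda>_. 1::nat) ?X"
    by (intro sum.group) (use A in auto)
  moreover have "{c\<in>?X. T (i, c) = k} = {c. (i, c) \<in> diagram \<mu> \<and> T (i, c) = k}" if "k \<in> A" for k
    using that by auto
  ultimately show ?thesis by (simp add: row_content_def)
qed

lemma tableaux_outside: "T \<in> tableaux n \<mu> \<Longrightarrow> x \<notin> diagram \<mu> \<Longrightarrow> T x = 0"
  unfolding tableaux_def by blast

text \<open>
  The entries up to \<open>k\<close> fill an initial segment of a sorted row.
\<close>

lemma row_sorted_le_iff:
  assumes fin: "finite (diagram \<mu>)" and T: "T \<in> tableaux n \<mu>" "row_weakly_increasing \<mu> T"
    and c: "(i, c) \<in> diagram \<mu>"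
  shows "T (i, c) \<le> k \<longleftrightarrow> c \<le> (\<Sum>l=1..k. row_content \<mu> T i l)"
proof -
  let ?N = "{d. (i, d) \<in> diagram \<mu> \<and> T (i, d) \<in> {1..k}}"
  have N: "card ?N = (\<Sum>l=1..k. row_content \<mu> T i l)"
    by (rule card_row_entries_in[OF fin]) simp
  have mono: "T (i, d) \<le> T (i, e)" if "(i, d) \<in> diagram \<mu>" "(i, e) \<in> diagram \<mu>" "d \<le> e" for d e
    using T(2) that unfolding row_weakly_increasing_def by (cases "d = e") auto
  have finN: "finite ?N"
    by (rule finite_subset[of _ "snd ` diagram \<mu>"]) (use fin in force)+
  show ?thesis
  proof
    assume le: "T (i, c) \<le> k"
    have "{1..c} \<subseteq> ?N"
    proof
      fix d assume d: "d \<in> {1..c}"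
      then have dd: "(i, d) \<in> diagram \<mu>" using c by (auto simp: diagram_def)
      have "T (i, d) \<le> k" using mono[OF dd c] d le by simp
      then show "d \<in> ?N" using dd tableaux_range[OF T(1) dd] by simp
    qed
    then have "card {1..c} \<le> card ?N" by (rule card_mono[OF finN])
    then show "c \<le> (\<Sum>l=1..k. row_content \<mu> T i l)" using N by simp
  next
    assume le: "c \<le> (\<Sum>l=1..k. row_content \<mu> T i l)"
    show "T (i, c) \<le> k"
    proof (rule ccontr)
      assume n: "\<not> T (i, c) \<le> k"
      have "?N \<subseteq> {1..<c}"
      proof
        fix d assume d: "d \<in> ?N"
        then have "\<not> c \<le> d" using mono[OF c, of d] n by auto
        then show "d \<in> {1..<c}" using d by (auto simp: diagram_def)
      qed
      then have "card ?N \<le> card {1..<c}" by (intro card_mono) auto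
      then show False using N le c by (auto simp: diagram_def)
    qed
  qed
qed

lemma row_sorted_unique:
  assumes fin: "finite (diagram \<mu>)" and T: "T \<in> tableaux n \<mu>" "row_weakly_increasing \<mu> T"
    and T': "T' \<in> tableaux n \<mu>" "row_weakly_increasing \<mu> T'"
    and eq: "row_content \<mu> T = row_content \<mu> T'"
  shows "T = T'"
proof
  fix x :: "nat \<times> nat"
  obtain i c where x: "x = (i, c)" by force
  show "T x = T' x"
  proof (cases "x \<in> diagram \<mu>")
    case True
    then have "T (i, c) \<le> k \<longleftrightarrow> T' (i, c) \<le> k" for k
      using row_sorted_le_iff[OF fin T, of i c k] row_sorted_le_iff[OF fin T', of i c k] x eq by simp
    then show ?thesis unfolding x by (meson order_antisym order_refl)
  next
    case False
    then show ?thesis using tableaux_outside[OF T(1) False] tableaux_outside[OF T'(1) False] by simp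
  qed
qed

lemma column_strict_of_row_counts:
  assumes \<mu>: "\<mu> \<in> partitions n r" and T: "T \<in> tableaux n \<mu>" "row_weakly_increasing \<mu> T"
    and counts: "\<And>s k. \<lbrakk>s \<in> {1..<n}; k \<in> {1..n}\<rbrakk> \<Longrightarrow>
       (\<Sum>l=1..k. row_content \<mu> T (Suc s) l) \<le> (\<Sum>l=1..<k. row_content \<mu> T s l)"
  shows "column_strict \<mu> T"
proof -
  note \<mu>c = partitions_compositions[OF \<mu>]
  have fin: "finite (diagram \<mu>)" by (rule finite_diagram[OF \<mu>c])
  have above: "(i, c) \<in> diagram \<mu>" if "(j, c) \<in> diagram \<mu>" "1 \<le> i" "i \<le> j" for i j c
    using that partitions_antimono[OF \<mu> that(2,3)] by (auto simp: diagram_def)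
  have step: "T (s, c) < T (Suc s, c)" if c: "(Suc s, c) \<in> diagram \<mu>" and s: "1 \<le> s" for s c
  proof -
    let ?k = "T (Suc s, c)"
    have k: "?k \<in> {1..n}" using tableaux_range[OF T(1) c] .
    have sn: "s \<in> {1..<n}" using fst_in_range[OF \<mu>c c] s by auto
    have "c \<le> (\<Sum>l=1..?k. row_content \<mu> T (Suc s) l)"
      using row_sorted_le_iff[OF fin T c, of ?k] by simp
    also have "\<dots> \<le> (\<Sum>l=1..<?k. row_content \<mu> T s l)" by (rule counts[OF sn k])
    also have "{1..<?k} = {1..?k - 1}" using k by auto
    finally have "T (s, c) \<le> ?k - 1"
      using row_sorted_le_iff[OF fin T above[OF c s], of "?k - 1"] by simp
    then show ?thesis using k by auto
  qed
  have less: "T (i, c) < T (i + Suc d, c)" if "(i + Suc d, c) \<in> diagram \<mu>" "1 \<le> i" for i d c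
    using that
  proof (induction d)
    case 0
    then show ?case using step[of i c] by simp
  next
    case (Suc d)
    have "(i + Suc d, c) \<in> diagram \<mu>" by (rule above[OF Suc.prems(1)]) auto
    then have "T (i, c) < T (i + Suc d, c)" using Suc by simp
    also have "\<dots> < T (i + Suc (Suc d), c)" using step[of "i + Suc d" c] Suc.prems by simp
    finally show ?case .
  qed
  show ?thesis
    unfolding column_strict_def
  proof (intro allI impI)
    fix i j c assume a: "(i, c) \<in> diagram \<mu> \<and> (j, c) \<in> diagram \<mu> \<and> i < j"
    then obtain d where "j = Suc (i + d)" using less_imp_Suc_add by blast
    then show "T (i, c) < T (j, c)" using less[where i = i and d = d and c = c] a by (simp add: diagram_def)
  qed
qed

definition row_weight :: "nat \<Rightarrow> (nat \<Rightarrow> nat) \<Rightarrow> nat" where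
  "row_weight n \<alpha> = (\<Sum>k=1..n. k * \<alpha> k)"

lemma matrix_weight_upd:
  assumes s: "s \<in> {1..<n}"
  shows "matrix_weight n (B(s := \<alpha>, Suc s := \<beta>))
       = s * row_weight n \<alpha> + Suc s * row_weight n \<beta>
         + (\<Sum>j\<in>{1..n} - {s} - {Suc s}. j * row_weight n (B j))"
proof -
  have *: "matrix_weight n C = (\<Sum>j\<in>{1..n}. j * row_weight n (C j))" for C
    by (simp add: matrix_weight_def row_weight_def sum_distrib_left mult.assoc)
  let ?C = "B(s := \<alpha>, Suc s := \<beta>)"
  have "(\<Sum>j\<in>{1..n}. j * row_weight n (?C j)) = s * row_weight n (?C s) +
      (Suc s * row_weight n (?C (Suc s)) + (\<Sum>j\<in>{1..n} - {s} - {Suc s}. j * row_weight n (?C j)))"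
    using s by (subst sum.remove[of _ s], simp, simp, subst sum.remove[of _ "Suc s"]) auto
  moreover have "(\<Sum>j\<in>{1..n} - {s} - {Suc s}. j * row_weight n (?C j))
      = (\<Sum>j\<in>{1..n} - {s} - {Suc s}. j * row_weight n (B j))"
    by (rule sum.cong) auto
  ultimately show ?thesis unfolding * by simp
qed

text \<open>
  Suppose that row \<open>s + 1\<close> has more entries \<open>\<le> k0\<close> than row \<open>s\<close> has entries \<open>< k0\<close>.  Take the Garnir
  relation in which the entries \<open>< k0\<close> of row \<open>s\<close> and those \<open>> k0\<close> of row \<open>s + 1\<close> stay where they are.
  The other entries, of content \<open>x\<close>, are distributed to the two rows; \<open>B\<close> itself is the term \<open>Y0\<close>,
  which sends the smallest of them to row \<open>s + 1\<close>, and it has coefficient 1.  All other terms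
  have larger weight.
\<close>

lemma maximal_support_row_counts:
  fixes P :: "(nat \<Rightarrow> nat \<Rightarrow> nat) \<Rightarrow> 'a::comm_ring_1"
  assumes s: "s \<in> {1..<n}"
    and inv: "\<And>t M. t \<ge> 1 \<Longrightarrow> row_raise n s t P M = 0"
    and B: "P B \<noteq> 0" "\<And>j k. k \<notin> {1..n} \<Longrightarrow> B j k = 0"
    and max: "\<And>B'. matrix_weight n B' > matrix_weight n B \<Longrightarrow> P B' = 0"
    and k0: "k0 \<in> {1..n}"
  shows "(\<Sum>l=1..k0. B (Suc s) l) \<le> (\<Sum>l=1..<k0. B s l)"
proof (rule ccontr)
  assume viol: "\<not> ?thesis"
  define u where "u = (\<lambda>k. if k < k0 then B s k else 0)"
  define v where "v = (\<lambda>k. if k > k0 then B (Suc s) k else 0)"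
  define Y0 where "Y0 = (\<lambda>k. if k \<le> k0 then B (Suc s) k else 0)"
  define x where "x = (\<lambda>k. (if k \<ge> k0 then B s k else 0) + Y0 k)"
  define t where "t = (\<Sum>k=1..n. Y0 k)"
  let ?coef = "\<lambda>Y. \<Prod>k=1..n. ((u k + (x k - Y k)) choose u k) * ((v k + Y k) choose v k)"
  let ?BY = "\<lambda>Y. B (s := \<lambda>k. u k + (x k - Y k), Suc s := \<lambda>k. v k + Y k)"
  have su: "(\<Sum>k=1..n. u k) = (\<Sum>l=1..<k0. B s l)"
    unfolding u_def by (rule sum.mono_neutral_cong_right) (use k0 in auto)
  have st: "t = (\<Sum>l=1..k0. B (Suc s) l)"
    unfolding t_def Y0_def by (rule sum.mono_neutral_cong_right) (use k0 in auto)
  have ut: "(\<Sum>k=1..n. u k) < t" using viol su st by simp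
  have rel: "(\<Sum>Y\<in>sub_indices n x t. of_nat (?coef Y) * P (?BY Y)) = 0"
  proof (rule garnir_relation[of n "\<lambda>\<alpha> \<beta>. P (B(s := \<alpha>, Suc s := \<beta>))"])
    fix \<alpha> \<beta> :: "nat \<Rightarrow> nat" and t :: nat assume "t \<ge> 1"
    from inv[OF this, of "B(s := \<alpha>, Suc s := \<beta>)"]
    show "(\<Sum>Y\<in>sub_indices n \<alpha> t. of_nat (\<Prod>k = 1..n. \<beta> k + Y k choose Y k) *
             P (B(s := \<lambda>k. \<alpha> k - Y k, Suc s := \<lambda>k. \<beta> k + Y k))) = 0"
      by (simp add: row_raise_def fun_upd_twist)
  qed (use ut B(2) in \<open>auto simp: u_def\<close>)
  have Y0: "Y0 \<in> sub_indices n x t"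
    using B(2) by (auto simp: sub_indices_def t_def x_def Y0_def)
  have BY0: "?BY Y0 = B"
    by (auto simp: fun_eq_iff u_def v_def x_def Y0_def)
  have coef0: "?coef Y0 = 1"
    by (rule prod.neutral) (auto simp: u_def v_def x_def Y0_def)
  have other: "P (?BY Y) = 0" if Y: "Y \<in> sub_indices n x t" "Y \<noteq> Y0" for Y
  proof (rule max)
    have Yx: "Y k \<le> x k" for k using Y by (simp add: sub_indices_def)
    have sY: "(\<Sum>k=1..n. Y k) = t" using Y by (simp add: sub_indices_def)
    have z: "Y k = 0" "Y0 k = 0" if "k \<notin> {1..n}" for k
      using Y that B(2)[of k] by (auto simp: sub_indices_def Y0_def)
    have nonneg: "(int k - int k0) * (int (Y k) - int (Y0 k)) \<ge> 0" for k
    proof (rule linorder_cases[of k k0])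
      assume "k < k0"
      then show ?thesis using Yx[of k] by (intro mult_nonpos_nonpos) (auto simp: x_def)
    next
      assume "k > k0"
      then show ?thesis by (auto simp: Y0_def)
    qed simp
    \<comment> \<open>the total sizes agree, so \<open>Y\<close> and \<open>Y0\<close> cannot differ at \<open>k0\<close> only\<close>
    have "\<exists>k1\<in>{1..n}. k1 \<noteq> k0 \<and> Y k1 \<noteq> Y0 k1"
    proof (rule ccontr)
      assume n: "\<not> ?thesis"
      have eq: "Y k = Y0 k" if "k \<noteq> k0" for k
        using n that z[of k] by (cases "k \<in> {1..n}") auto
      have "(\<Sum>k\<in>{1..n} - {k0}. Y k) = (\<Sum>k\<in>{1..n} - {k0}. Y0 k)"
        by (rule sum.cong) (use eq in auto)
      then have "Y k0 = Y0 k0"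
        using sY k0 sum.remove[of "{1..n}" k0 Y] sum.remove[of "{1..n}" k0 Y0]
        by (simp add: t_def)
      then have "Y = Y0" using eq by (intro ext) metis
      then show False using Y(2) by simp
    qed
    then obtain k1 where k1: "k1 \<in> {1..n}" "k1 \<noteq> k0" "Y k1 \<noteq> Y0 k1" by blast
    have "(\<Sum>k=1..n. (int k - int k0) * (int (Y k) - int (Y0 k))) > 0"
    proof (rule sum_pos2[of _ k1])
      show "0 < (int k1 - int k0) * (int (Y k1) - int (Y0 k1))"
      proof -
        have "(int k1 - int k0) * (int (Y k1) - int (Y0 k1)) \<noteq> 0" using k1 by simp
        then show ?thesis using nonneg[of k1] by linarith
      qed
    qed (use k1 nonneg in auto)
    moreover have "(\<Sum>k=1..n. (int k - int k0) * (int (Y k) - int (Y0 k)))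
        = (\<Sum>k=1..n. int k * int (Y k)) - (\<Sum>k=1..n. int k * int (Y0 k))
          - int k0 * ((\<Sum>k=1..n. int (Y k)) - (\<Sum>k=1..n. int (Y0 k)))"
      by (simp add: algebra_simps sum.distrib sum_subtractf sum_distrib_left)
    moreover have "(\<Sum>k=1..n. int (Y k)) = (\<Sum>k=1..n. int (Y0 k))"
      using sY unfolding t_def by (simp flip: of_nat_sum)
    ultimately have "int (row_weight n Y0) < int (row_weight n Y)"
      by (simp add: row_weight_def)
    then have less: "row_weight n Y0 < row_weight n Y" by simp
    have add: "row_weight n (\<lambda>k. a k + b k) = row_weight n a + row_weight n b" for a b
      by (simp add: row_weight_def sum.distrib algebra_simps)
    have "row_weight n (\<lambda>k. x k - Y k) + row_weight n Y = row_weight n x"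
      unfolding add[symmetric] using Yx by simp
    moreover have "row_weight n (\<lambda>k. x k - Y0 k) + row_weight n Y0 = row_weight n x"
      unfolding add[symmetric] by (simp add: x_def)
    ultimately have tot: "row_weight n (\<lambda>k. x k - Y k) + row_weight n Y
        = row_weight n (\<lambda>k. x k - Y0 k) + row_weight n Y0" by simp
    have "s * row_weight n (\<lambda>k. x k - Y k) + s * row_weight n Y
        = s * row_weight n (\<lambda>k. x k - Y0 k) + s * row_weight n Y0"
      unfolding distrib_left[symmetric] tot ..
    then have "matrix_weight n (?BY Y0) < matrix_weight n (?BY Y)"
      unfolding matrix_weight_upd[OF s] add using less by (simp add: algebra_simps)
    then show "matrix_weight n B < matrix_weight n (?BY Y)" unfolding BY0 .
  qed
  have "(\<Sum>Y\<in>sub_indices n x t. of_nat (?coef Y) * P (?BY Y))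
      = (\<Sum>Y\<in>{Y0}. of_nat (?coef Y) * P (?BY Y))"
    by (rule sum.mono_neutral_right) (use finite_sub_indices Y0 other in auto)
  also have "\<dots> = P B" using coef0 BY0 by simp
  finally show False using rel B(1) by simp
qed

lemma alternant_support:
  assumes \<mu>: "\<mu> \<in> compositions n r" and S: "S \<in> tableaux n \<mu>" and "alternant \<mu> S B fst \<noteq> 0"
  shows "B \<in> D_basis n {1..n} \<mu>"
proof -
  obtain \<sigma> where \<sigma>: "\<sigma> \<in> column_perms \<mu>"
      "sign \<sigma> * of_bool (pair_content (diagram \<mu>) fst (S \<circ> \<sigma>) = B) \<noteq> 0"
    using assms(3) unfolding alternant_def by (rule sum.not_neutral_contains_not_neutral)
  then have "row_content \<mu> (S \<circ> \<sigma>) = B" by (auto simp: row_content_eq_pair_content)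
  moreover have "row_content \<mu> (S \<circ> \<sigma>) \<in> D_basis n {1..n} \<mu>"
    by (rule row_content_in_D_basis[OF \<mu>])
      (use tableaux_range[OF S] permutes_in_image[OF column_permsD(1)[OF \<sigma>(1)]] in auto)
  ultimately show ?thesis by simp
qed

text \<open>
  Induction on a bound for the weight of the monomials that occur.  Those of maximal weight are row
  contents of semistandard tableaux, and subtracting the matching multiples of the bideterminants,
  which are invariant as well, removes them.
\<close>

lemma invariants_spanned_by_bideterminants:
  fixes P :: "(nat \<Rightarrow> nat \<Rightarrow> nat) \<Rightarrow> 'a::comm_ring_1"
  assumes lam: "lam \<in> partitions n r"
    and supp: "\<And>B. P B \<noteq> 0 \<Longrightarrow> B \<in> D_basis n {1..n} lam"
    and inv: "\<And>s t M. \<lbrakk>s \<in> {1..<n}; t \<ge> 1\<rbrakk> \<Longrightarrow> row_raise n s t P M = 0"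
  shows "\<exists>c. \<forall>B. P B = (\<Sum>S\<in>col_tableaux n lam. c S * of_int (alternant lam S B fst))"
proof -
  note lamc = partitions_compositions[OF lam]
  have "\<exists>c. \<forall>B. P B = (\<Sum>S\<in>col_tableaux n lam. c S * of_int (alternant lam S B fst))"
    if "\<And>B. P B \<noteq> 0 \<Longrightarrow> B \<in> D_basis n {1..n} lam \<and> matrix_weight n B < d"
      "\<And>s t M. \<lbrakk>s \<in> {1..<n}; t \<ge> 1\<rbrakk> \<Longrightarrow> row_raise n s t P M = 0"
    for d and P :: "(nat \<Rightarrow> nat \<Rightarrow> nat) \<Rightarrow> 'a"
    using that
  proof (induction d arbitrary: P)
    case 0
    then have "P B = 0" for B by blast
    then show ?case by (intro exI[of _ "\<lambda>_. 0"]) simp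
  next
    case (Suc d)
    let ?T = "{B. P B \<noteq> 0 \<and> matrix_weight n B = d}"
    have finT: "finite ?T"
      by (rule finite_subset[OF _ finite_D_basis[of "{1..n}" n lam]]) (use Suc.prems(1) in auto)
    have "\<exists>S\<in>col_tableaux n lam. row_content lam S = B" if B: "B \<in> ?T" for B
    proof -
      have Bb: "B \<in> D_basis n {1..n} lam" using Suc.prems(1) B by blast
      obtain S where S: "S \<in> tableaux n lam" "row_weakly_increasing lam S" "row_content lam S = B"
        using ex_row_sorted_tableau[OF lamc Bb] by blast
      have "column_strict lam S"
      proof (rule column_strict_of_row_counts[OF lam S(1,2)])
        fix s k assume s: "s \<in> {1..<n}" and k: "k \<in> {1..n}"
        show "(\<Sum>l=1..k. row_content lam S (Suc s) l) \<le> (\<Sum>l=1..<k. row_content lam S s l)"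
          unfolding S(3)
        proof (rule maximal_support_row_counts[OF s])
          show "row_raise n s t P M = 0" if "t \<ge> 1" for t M using Suc.prems(2)[OF s that] .
          show "P B \<noteq> 0" using B by simp
          show "B j k = 0" if "k \<notin> {1..n}" for j k using Bb that by (auto simp: D_basis_def)
          show "P B' = 0" if "matrix_weight n B < matrix_weight n B'" for B'
          proof (rule ccontr)
            assume "P B' \<noteq> 0"
            then have "matrix_weight n B' < Suc d" using Suc.prems(1) by blast
            moreover have "matrix_weight n B = d" using B by simp
            ultimately show False using that by simp
          qed
        qed (rule k)
      qed
      then show ?thesis using S by (auto simp: col_tableaux_def)
    qed
    then have "\<exists>S. \<forall>B\<in>?T. S B \<in> col_tableaux n lam \<and> row_content lam (S B) = B"
      by (intro bchoice ballI) blast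
    then obtain S where S: "\<And>B. B \<in> ?T \<Longrightarrow> S B \<in> col_tableaux n lam \<and> row_content lam (S B) = B"
      by blast
    have ST: "S B \<in> tableaux n lam" if "B \<in> ?T" for B using S[OF that] by (simp add: col_tableaux_def)
    let ?Q = "\<lambda>B'. P B' - (\<Sum>B\<in>?T. P B * of_int (alternant lam (S B) B' fst))"
    have "\<exists>c. \<forall>B. ?Q B = (\<Sum>S\<in>col_tableaux n lam. c S * of_int (alternant lam S B fst))"
    proof (rule Suc.IH)
      fix s t :: nat and M assume st: "s \<in> {1..<n}" "t \<ge> 1"
      have "row_raise n s t (\<lambda>B'. P B * of_int (alternant lam (S B) B' fst)) M = 0" if "B \<in> ?T" for B
        unfolding row_raise_mult_left row_raise_of_int
        using row_raise_bideterminant[OF lam ST[OF that], of s t M] st by simp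
      then have "row_raise n s t (\<lambda>B'. \<Sum>B\<in>?T. P B * of_int (alternant lam (S B) B' fst)) M = 0"
        unfolding row_raise_sum by (rule sum.neutral[OF ballI])
      then show "row_raise n s t ?Q M = 0"
        unfolding row_raise_diff using Suc.prems(2)[OF st] by simp
    next
      fix B' assume Q: "?Q B' \<noteq> 0"
      have "B' \<in> D_basis n {1..n} lam"
      proof (rule ccontr)
        assume n: "B' \<notin> D_basis n {1..n} lam"
        then have "alternant lam (S B) B' fst = 0" if "B \<in> ?T" for B
          using alternant_support[OF lamc ST[OF that]] by blast
        then have "(\<Sum>B\<in>?T. P B * of_int (alternant lam (S B) B' fst)) = 0"
          by (intro sum.neutral ballI) simp
        moreover have "P B' = 0" using n Suc.prems(1) by blast
        ultimately show False using Q by simp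
      qed
      moreover have "matrix_weight n B' < d"
      proof (rule ccontr)
        assume n: "\<not> ?thesis"
        have "(\<Sum>B\<in>?T. P B * of_int (alternant lam (S B) B' fst))
            = (\<Sum>B\<in>?T. if B = B' then P B else 0)"
        proof (rule sum.cong[OF refl])
          fix B assume B: "B \<in> ?T"
          have "alternant lam (S B) B' fst = of_bool (B' = B)"
            using alternant_leading[OF lamc, of "S B" B'] S[OF B] B n by simp
          then show "P B * of_int (alternant lam (S B) B' fst) = (if B = B' then P B else 0)"
            by auto
        qed
        also have "\<dots> = (if B' \<in> ?T then P B' else 0)" using finT by (simp only: sum.delta)
        also have "\<dots> = P B'"
        proof (cases "P B' = 0")
          case False
          then have "matrix_weight n B' = d" using Suc.prems(1)[of B'] n by simp
          then show ?thesis using False by simp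
        qed simp
        finally show False using Q by simp
      qed
      ultimately show "B' \<in> D_basis n {1..n} lam \<and> matrix_weight n B' < d" ..
    qed
    then obtain c where c: "\<And>B. ?Q B = (\<Sum>S\<in>col_tableaux n lam. c S * of_int (alternant lam S B fst))"
      by blast
    have expand: "P B' = (\<Sum>U\<in>col_tableaux n lam.
        (c U + (\<Sum>B | B \<in> ?T \<and> S B = U. P B)) * of_int (alternant lam U B' fst))" for B'
    proof -
      have "(\<Sum>B\<in>?T. P B * of_int (alternant lam (S B) B' fst))
          = (\<Sum>U\<in>col_tableaux n lam. \<Sum>B | B \<in> ?T \<and> S B = U. P B * of_int (alternant lam (S B) B' fst))"
        by (rule sum.group[symmetric]) (use finT finite_col_tableaux[OF lamc] S in auto)
      also have "\<dots> = (\<Sum>U\<in>col_tableaux n lam.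
          (\<Sum>B | B \<in> ?T \<and> S B = U. P B) * of_int (alternant lam U B' fst))"
        unfolding sum_distrib_right by (intro sum.cong refl) auto
      finally have "P B' = (\<Sum>S\<in>col_tableaux n lam. c S * of_int (alternant lam S B' fst)) +
          (\<Sum>U\<in>col_tableaux n lam. (\<Sum>B | B \<in> ?T \<and> S B = U. P B) * of_int (alternant lam U B' fst))"
        using c[of B'] by (simp only: diff_eq_eq)
      then show ?thesis by (simp only: distrib_right sum.distrib)
    qed
    show ?case by (rule exI, rule allI, rule expand)
  qed
  note main = this
  let ?D = "D_basis n {1..n} lam"
  obtain d where "\<forall>B\<in>?D. matrix_weight n B < d"
    using finite_nat_set_iff_bounded[of "matrix_weight n ` ?D"] finite_D_basis[of "{1..n}" n lam] by auto
  then show ?thesis using main[of P d] supp inv by blast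
qed

section \<open>Invariance of the alternating sum over triangular fillings\<close>

definition triangular :: "nat \<Rightarrow> (nat \<Rightarrow> nat) \<Rightarrow> (nat \<Rightarrow> nat) \<Rightarrow> (nat \<times> nat \<Rightarrow> nat) set" where
  "triangular n \<mu> \<kappa> = {U\<in>tableaux n \<mu>. (\<forall>x\<in>diagram \<mu>. fst x \<le> U x) \<and>
                        (\<forall>k\<in>{1..n}. card {x\<in>diagram \<mu>. U x = k} = \<kappa> k)}"

definition row_fixed :: "(nat \<Rightarrow> nat) \<Rightarrow> nat \<Rightarrow> (nat \<times> nat \<Rightarrow> nat) \<Rightarrow> bool" where
  "row_fixed \<mu> s U \<longleftrightarrow> (\<forall>c\<in>{1..\<mu> (Suc s)}. U (s, c) = s)"

lemma finite_triangular: "\<mu> \<in> compositions n r \<Longrightarrow> finite (triangular n \<mu> \<kappa>)"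
  by (rule finite_subset[OF _ finite_tableaux]) (auto simp: triangular_def)

text \<open>
  If \<open>U\<close> is not fixed in row \<open>s\<close>, let \<open>c\<close> be the first of the columns concerned with
  \<open>U (s, c) \<noteq> s\<close>.  Both entries of this column in rows \<open>s\<close> and \<open>s + 1\<close> are then larger than \<open>s\<close>.
  Exchanging them is an involution on these fillings that reverses the sign.
\<close>

lemma sum_alternant_triangular_row_fixed:
  assumes \<mu>: "\<mu> \<in> partitions n r" and s: "s \<ge> 1"
  shows "(\<Sum>U\<in>triangular n \<mu> \<kappa>. alternant \<mu> S B U)
       = (\<Sum>U | U \<in> triangular n \<mu> \<kappa> \<and> row_fixed \<mu> s U. alternant \<mu> S B U)"
proof -
  note \<mu>c = partitions_compositions[OF \<mu>]
  have fin: "finite (diagram \<mu>)" by (rule finite_diagram[OF \<mu>c])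
  let ?N = "{U\<in>triangular n \<mu> \<kappa>. \<not> row_fixed \<mu> s U}"
  let ?c = "\<lambda>U. LEAST c. c \<in> {1..\<mu> (Suc s)} \<and> U (s, c) \<noteq> s"
  let ?tr = "\<lambda>c. transpose (s, c) (Suc s, c)"
  let ?\<iota> = "\<lambda>U. U \<circ> ?tr (?c U)"
  have cells: "(s, c) \<in> diagram \<mu>" "(Suc s, c) \<in> diagram \<mu>" if "c \<in> {1..\<mu> (Suc s)}" for c
    using that s partitions_antimono[OF \<mu> s, of "Suc s"] by (auto simp: diagram_def)
  have c: "?c U \<in> {1..\<mu> (Suc s)} \<and> U (s, ?c U) \<noteq> s" if "U \<in> ?N" for U
  proof -
    have "\<exists>c. c \<in> {1..\<mu> (Suc s)} \<and> U (s, c) \<noteq> s" using that by (auto simp: row_fixed_def)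
    then show ?thesis by (rule LeastI_ex)
  qed
  have below: "U (s, d) = s" if "d \<in> {1..\<mu> (Suc s)}" "d < ?c U" for U d
    using not_less_Least[OF that(2)] that(1) by blast
  have \<iota>: "?\<iota> U \<in> ?N \<and> ?c (?\<iota> U) = ?c U" if U: "U \<in> ?N" for U
  proof -
    let ?d = "?c U"
    note d = c[OF U]
    have p: "?tr ?d permutes diagram \<mu>" using cells[of ?d] d by (intro permutes_swap_id) auto
    have UT: "U \<in> tableaux n \<mu>" and Ule: "\<And>x. x \<in> diagram \<mu> \<Longrightarrow> fst x \<le> U x"
      using U by (auto simp: triangular_def)
    have "?\<iota> U \<in> tableaux n \<mu>"
      using UT permutes_in_image[OF p] permutes_not_in[OF p] by (auto simp: tableaux_def)
    moreover have "fst x \<le> ?\<iota> U x" if "x \<in> diagram \<mu>" for x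
    proof -
      have "s \<le> U (s, ?d)" "Suc s \<le> U (Suc s, ?d)" using Ule cells[of ?d] d by force+
      then have "Suc s \<le> U (s, ?d)" "s \<le> U (Suc s, ?d)" using d by auto
      then show ?thesis using Ule[OF that] \<open>Suc s \<le> U (Suc s, ?d)\<close> by (auto simp: transpose_def)
    qed
    moreover have "card {x\<in>diagram \<mu>. (U \<circ> ?tr d) x = k} = card {x\<in>diagram \<mu>. U x = k}"
      if "?tr d permutes diagram \<mu>" for d k
    proof (rule bij_betw_same_card[where f = "?tr d"])
      show "bij_betw (?tr d) {x\<in>diagram \<mu>. (U \<circ> ?tr d) x = k} {x\<in>diagram \<mu>. U x = k}"
        by (rule bij_betw_byWitness[where f' = "?tr d"]) (use permutes_in_image[OF that] in auto)
    qed
    note this[OF p]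
    ultimately have tri: "?\<iota> U \<in> triangular n \<mu> \<kappa>" using U by (simp add: triangular_def)
    have "Suc s \<le> U (Suc s, ?d)" using Ule cells[of ?d] d by force
    then have i1: "?\<iota> U (s, ?d) \<noteq> s" by (simp add: transpose_def)
    have i2: "?\<iota> U (s, e) = U (s, e)" if "e \<noteq> ?d" for e using that by (simp add: transpose_def)
    have "?c (?\<iota> U) = ?d"
    proof (rule Least_equality)
      show "?d \<in> {1..\<mu> (Suc s)} \<and> ?\<iota> U (s, ?d) \<noteq> s" using d i1 by blast
      fix e assume e: "e \<in> {1..\<mu> (Suc s)} \<and> ?\<iota> U (s, e) \<noteq> s"
      show "?d \<le> e"
      proof (rule ccontr)
        assume n: "\<not> ?d \<le> e"
        have us: "U (s, e) = s" using e n by (intro below) (simp_all only: not_le)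
        have ne: "e \<noteq> ?d" using n by (simp only: not_le less_imp_neq not_False_eq_True)
        show False using conjunct2[OF e] i2[OF ne] us by (simp only: refl not_True_eq_False)
      qed
    qed
    moreover have "\<not> row_fixed \<mu> s (?\<iota> U)" using d i1 unfolding row_fixed_def by blast
    ultimately show ?thesis using tri by simp
  qed
  have "(\<Sum>U\<in>?N. alternant \<mu> S B U) = (\<Sum>U\<in>?N. - alternant \<mu> S B U)"
  proof (rule sum.reindex_bij_witness[where i = ?\<iota> and j = ?\<iota>])
    fix U assume U: "U \<in> ?N"
    show "?\<iota> U \<in> ?N" "?\<iota> U \<in> ?N" using \<iota>[OF U] by blast+
    have "?c (?\<iota> U) = ?c U" using \<iota>[OF U] by blast
    then show "?\<iota> (?\<iota> U) = U" "?\<iota> (?\<iota> U) = U" by (simp_all only:) (simp_all add: fun_eq_iff)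
    have "alternant \<mu> S B (?\<iota> U) = - alternant \<mu> S B U"
      by (rule alternant_swap[OF fin]) (use cells[of "?c U"] c[OF U] in auto)
    then show "- alternant \<mu> S B (?\<iota> U) = alternant \<mu> S B U" by simp
  qed
  then have "(\<Sum>U\<in>?N. alternant \<mu> S B U) = 0" by (simp add: sum_negf)
  moreover have "triangular n \<mu> \<kappa> = ?N \<union> {U\<in>triangular n \<mu> \<kappa>. row_fixed \<mu> s U}" by blast
  then have "(\<Sum>U\<in>triangular n \<mu> \<kappa>. alternant \<mu> S B U) = (\<Sum>U\<in>?N. alternant \<mu> S B U)
      + (\<Sum>U | U \<in> triangular n \<mu> \<kappa> \<and> row_fixed \<mu> s U. alternant \<mu> S B U)"
    using finite_triangular[OF \<mu>c, of \<kappa>]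
    by (subst \<open>triangular n \<mu> \<kappa> = _\<close>) (intro sum.union_disjoint; auto)
  ultimately show ?thesis by simp
qed

lemma triangularD:
  assumes "U \<in> triangular n \<mu> \<kappa>"
  shows "U \<in> tableaux n \<mu>" "\<And>x. x \<in> diagram \<mu> \<Longrightarrow> fst x \<le> U x"
    "\<And>k. k \<in> {1..n} \<Longrightarrow> card {x\<in>diagram \<mu>. U x = k} = \<kappa> k"
  using assms by (auto simp: triangular_def)

lemma triangularI:
  assumes "\<And>x. x \<in> diagram \<mu> \<Longrightarrow> U x \<in> {1..n}" "\<And>x. x \<notin> diagram \<mu> \<Longrightarrow> U x = 0"
    "\<And>x. x \<in> diagram \<mu> \<Longrightarrow> fst x \<le> U x"
    "\<And>k. k \<in> {1..n} \<Longrightarrow> card {x\<in>diagram \<mu>. U x = k} = \<kappa> k"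
  shows "U \<in> triangular n \<mu> \<kappa>"
  using assms by (simp add: triangular_def tableaux_def)

lemma relabel_tableau:
  assumes fin: "finite (diagram \<mu>)" and U: "U \<in> tableaux n \<mu>"
    and Z: "Z \<subseteq> {x\<in>diagram \<mu>. U x = a}" and b: "b \<noteq> a" "b \<in> {1..n}"
  shows "relabel Z b U \<in> tableaux n \<mu>"
    and "card {x\<in>diagram \<mu>. relabel Z b U x = k}
       = (if k = a then card {x\<in>diagram \<mu>. U x = a} - card Z
          else if k = b then card {x\<in>diagram \<mu>. U x = b} + card Z
          else card {x\<in>diagram \<mu>. U x = k})"
proof -
  have Zd: "Z \<subseteq> diagram \<mu>" using Z by blast
  have finZ: "finite Z" using Zd fin by (rule finite_subset)
  show "relabel Z b U \<in> tableaux n \<mu>"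
    unfolding tableaux_def
  proof (rule CollectI, intro conjI ballI allI impI)
    fix x
    show "relabel Z b U x \<in> {1..n}" if "x \<in> diagram \<mu>"
      using tableaux_range[OF U that] b by (auto simp: relabel_def)
    show "relabel Z b U x = 0" if "x \<notin> diagram \<mu>"
      using tableaux_outside[OF U that] Zd that by (auto simp: relabel_def)
  qed
  have "{x\<in>diagram \<mu>. relabel Z b U x = a} = {x\<in>diagram \<mu>. U x = a} - Z"
    using b by (auto simp: relabel_def)
  moreover have "{x\<in>diagram \<mu>. relabel Z b U x = b} = {x\<in>diagram \<mu>. U x = b} \<union> Z"
    using Zd by (auto simp: relabel_def)
  moreover have "{x\<in>diagram \<mu>. U x = b} \<inter> Z = {}" using Z b by auto
  moreover have "{x\<in>diagram \<mu>. relabel Z b U x = k} = {x\<in>diagram \<mu>. U x = k}"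
    if "k \<noteq> a" "k \<noteq> b"
    using that Z by (auto simp: relabel_def)
  ultimately show "card {x\<in>diagram \<mu>. relabel Z b U x = k}
       = (if k = a then card {x\<in>diagram \<mu>. U x = a} - card Z
          else if k = b then card {x\<in>diagram \<mu>. U x = b} + card Z
          else card {x\<in>diagram \<mu>. U x = k})"
    using Z fin finZ by (simp add: card_Diff_subset card_Un_disjoint)
qed

text \<open>
  A filling \<open>W\<close> in the sum on the right comes from as many fillings as there are sets \<open>Z\<close> of \<open>t\<close>
  cells with entry \<open>s\<close> outside the first \<open>\<mu> (s + 1)\<close> cells of row \<open>s\<close>.
\<close>

lemma row_raise_triangular:
  assumes \<mu>: "\<mu> \<in> partitions n r" and S: "S \<in> tableaux n \<mu>" and s: "s \<in> {1..<n}"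
    and \<kappa>: "\<mu> (Suc s) \<le> \<kappa> s" and t: "t \<le> \<kappa> (Suc s)"
  shows "row_raise n s t (\<lambda>B. \<Sum>U\<in>triangular n \<mu> \<kappa>. alternant \<mu> S B U) M
       = int ((\<kappa> s - \<mu> (Suc s) + t) choose t) *
         (\<Sum>W | W \<in> triangular n \<mu> (\<kappa>(s := \<kappa> s + t, Suc s := \<kappa> (Suc s) - t)) \<and> row_fixed \<mu> s W.
             alternant \<mu> S M W)"
proof -
  note \<mu>c = partitions_compositions[OF \<mu>]
  have fin: "finite (diagram \<mu>)" by (rule finite_diagram[OF \<mu>c])
  have s1: "1 \<le> s" and sn: "s \<in> {1..n}" "Suc s \<in> {1..n}" using s by auto
  define \<kappa>' where "\<kappa>' = \<kappa>(s := \<kappa> s + t, Suc s := \<kappa> (Suc s) - t)"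
  let ?A = "{U. U \<in> triangular n \<mu> \<kappa> \<and> row_fixed \<mu> s U}"
  let ?A' = "{W. W \<in> triangular n \<mu> \<kappa>' \<and> row_fixed \<mu> s W}"
  let ?Z = "\<lambda>U. {Z. Z \<subseteq> {x\<in>diagram \<mu>. U x = Suc s} \<and> card Z = t}"
  let ?Z1 = "\<lambda>U. {Z. Z \<subseteq> {x\<in>diagram \<mu>. U x = Suc s \<and> fst x \<noteq> Suc s} \<and> card Z = t}"
  let ?Z2 = "\<lambda>W. {Z. Z \<subseteq> {x\<in>diagram \<mu>. W x = s \<and> \<not> (fst x = s \<and> snd x \<le> \<mu> (Suc s))} \<and> card Z = t}"
  have finA: "finite ?A" "finite ?A'" using finite_triangular[OF \<mu>c] by auto
  have finZ: "finite (?Z U)" "finite (?Z1 U)" "finite (?Z2 U)" for U using fin by auto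
  have above: "(s, c) \<in> diagram \<mu> \<and> c \<in> {1..\<mu> (Suc s)}" if "(Suc s, c) \<in> diagram \<mu>" for c
    using that s1 partitions_antimono[OF \<mu> s1, of "Suc s"] by (auto simp: diagram_def)
  have finsub: "finite Z" if "Z \<subseteq> diagram \<mu>" for Z using that fin by (rule finite_subset)
  have "row_raise n s t (\<lambda>B. \<Sum>U\<in>triangular n \<mu> \<kappa>. alternant \<mu> S B U) M
      = (\<Sum>U\<in>?A. \<Sum>Z\<in>?Z U. alternant \<mu> S M (relabel Z s U))"
    unfolding sum_alternant_triangular_row_fixed[OF \<mu> s1] row_raise_sum
      row_raise_alternant[OF fin S] ..
  \<comment> \<open>a relabelled cell of row \<open>s + 1\<close> would lie below an entry \<open>s\<close>\<close>
  also have "\<dots> = (\<Sum>U\<in>?A. \<Sum>Z\<in>?Z1 U. alternant \<mu> S M (relabel Z s U))"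
  proof (rule sum.cong[OF refl], rule sum.mono_neutral_right[OF finZ(1)])
    fix U assume U: "U \<in> ?A"
    show "?Z1 U \<subseteq> ?Z U" by blast
    show "\<forall>Z\<in>?Z U - ?Z1 U. alternant \<mu> S M (relabel Z s U) = 0"
    proof
      fix Z assume Z: "Z \<in> ?Z U - ?Z1 U"
      then obtain c where c: "(Suc s, c) \<in> Z" "(Suc s, c) \<in> diagram \<mu>" by force
      have "U (s, c) = s" using U above[OF c(2)] unfolding row_fixed_def by blast
      then show "alternant \<mu> S M (relabel Z s U) = 0"
        using c above[OF c(2)] by (intro alternant_eq_0[OF fin, of "(s, c)" "(Suc s, c)"])
          (auto simp: relabel_def)
    qed
  qed
  also have "\<dots> = (\<Sum>(U, Z)\<in>Sigma ?A ?Z1. alternant \<mu> S M (relabel Z s U))"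
    by (rule sum.Sigma) (use finA finZ in auto)
  also have "\<dots> = (\<Sum>(W, Z)\<in>Sigma ?A' ?Z2. alternant \<mu> S M W)"
  proof (rule sum.reindex_bij_witness[where i = "\<lambda>(W, Z). (relabel Z (Suc s) W, Z)"
        and j = "\<lambda>(U, Z). (relabel Z s U, Z)"])
    fix UZ assume "UZ \<in> Sigma ?A ?Z1"
    then obtain U Z where UZ: "UZ = (U, Z)" and U: "U \<in> triangular n \<mu> \<kappa>" "row_fixed \<mu> s U"
      and Z: "Z \<subseteq> {x\<in>diagram \<mu>. U x = Suc s \<and> fst x \<noteq> Suc s}" "card Z = t" by blast
    note tr = triangularD[OF U(1)]
    have Zd: "Z \<subseteq> diagram \<mu>" using Z(1) by blast
    let ?W = "relabel Z s U"
    have "relabel Z (Suc s) ?W = U" using Z(1) by (auto simp: relabel_def fun_eq_iff)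
    then show "(\<lambda>(W, Z). (relabel Z (Suc s) W, Z)) ((\<lambda>(U, Z). (relabel Z s U, Z)) UZ) = UZ"
      by (simp add: UZ)
    have ZU: "Z \<subseteq> {x\<in>diagram \<mu>. U x = Suc s}" using Z(1) by blast
    have "fst x \<le> ?W x" if "x \<in> diagram \<mu>" for x
      using tr(2)[OF that] Z(1) by (force simp: relabel_def)
    then have "?W \<in> triangular n \<mu> \<kappa>'"
      using relabel_tableau[OF fin tr(1) ZU, of s] tr(3) sn Z(2)
      by (auto simp: triangular_def \<kappa>'_def)
    moreover have "row_fixed \<mu> s ?W" using U(2) by (auto simp: row_fixed_def relabel_def)
    moreover have "Z \<in> ?Z2 ?W"
    proof -
      have "\<not> (fst x = s \<and> snd x \<le> \<mu> (Suc s))" if "x \<in> Z" for x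
      proof
        assume a: "fst x = s \<and> snd x \<le> \<mu> (Suc s)"
        obtain c where x: "x = (s, c)" "c \<le> \<mu> (Suc s)" using a by (metis prod.collapse)
        have "c \<in> {1..\<mu> (Suc s)}" using x Zd that by (auto simp: diagram_def)
        then have "U x = s" using U(2) x by (simp add: row_fixed_def)
        then show False using Z(1) that by auto
      qed
      then show ?thesis using Z(2) Zd by (auto simp: relabel_def)
    qed
    ultimately show "(\<lambda>(U, Z). (relabel Z s U, Z)) UZ \<in> Sigma ?A' ?Z2" by (simp add: UZ)
    show "(case (\<lambda>(U, Z). (relabel Z s U, Z)) UZ of (W, Z) \<Rightarrow> alternant \<mu> S M W)
        = (case UZ of (U, Z) \<Rightarrow> alternant \<mu> S M (relabel Z s U))" by (simp add: UZ)
  next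
    fix WZ assume "WZ \<in> Sigma ?A' ?Z2"
    then obtain W Z where WZ: "WZ = (W, Z)" and W: "W \<in> triangular n \<mu> \<kappa>'" "row_fixed \<mu> s W"
      and Z: "Z \<subseteq> {x\<in>diagram \<mu>. W x = s \<and> \<not> (fst x = s \<and> snd x \<le> \<mu> (Suc s))}" "card Z = t"
      by blast
    note tr = triangularD[OF W(1)]
    have Zd: "Z \<subseteq> diagram \<mu>" using Z(1) by blast
    let ?U = "relabel Z (Suc s) W"
    have "relabel Z s ?U = W" using Z(1) by (auto simp: relabel_def fun_eq_iff)
    then show "(\<lambda>(U, Z). (relabel Z s U, Z)) ((\<lambda>(W, Z). (relabel Z (Suc s) W, Z)) WZ) = WZ"
      by (simp add: WZ)
    have ZW: "Z \<subseteq> {x\<in>diagram \<mu>. W x = s}" using Z(1) by blast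
    have "fst x \<le> ?U x" if "x \<in> diagram \<mu>" for x
      using tr(2)[OF that] Z(1) by (force simp: relabel_def)
    then have "?U \<in> triangular n \<mu> \<kappa>"
      using relabel_tableau[OF fin tr(1) ZW, of "Suc s"] tr(3) sn Z(2) t
      by (auto simp: triangular_def \<kappa>'_def)
    moreover have "row_fixed \<mu> s ?U"
      unfolding row_fixed_def
    proof
      fix c assume c: "c \<in> {1..\<mu> (Suc s)}"
      then have "(s, c) \<notin> Z" using Z(1) by auto
      then show "?U (s, c) = s" using W(2) c by (simp add: row_fixed_def relabel_def)
    qed
    moreover have "Z \<in> ?Z1 ?U"
    proof -
      have "fst x \<noteq> Suc s" if "x \<in> Z" for x
      proof -
        have "fst x \<le> W x" "W x = s" using tr(2)[of x] Z(1) that by auto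
        then show ?thesis by simp
      qed
      then show ?thesis using Z(2) Zd by (auto simp: relabel_def)
    qed
    ultimately show "(\<lambda>(W, Z). (relabel Z (Suc s) W, Z)) WZ \<in> Sigma ?A ?Z1" by (simp add: WZ)
  qed
  also have "\<dots> = (\<Sum>W\<in>?A'. \<Sum>Z\<in>?Z2 W. alternant \<mu> S M W)"
    by (rule sum.Sigma[symmetric]) (use finA finZ in auto)
  also have "\<dots> = (\<Sum>W\<in>?A'. int ((\<kappa> s - \<mu> (Suc s) + t) choose t) * alternant \<mu> S M W)"
  proof (rule sum.cong[OF refl])
    fix W assume W: "W \<in> ?A'"
    let ?F = "(\<lambda>c. (s, c)) ` {1..\<mu> (Suc s)}"
    let ?C = "{x\<in>diagram \<mu>. W x = s \<and> \<not> (fst x = s \<and> snd x \<le> \<mu> (Suc s))}"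
    have F: "?F \<subseteq> {x\<in>diagram \<mu>. W x = s}"
    proof
      fix x assume "x \<in> ?F"
      then obtain c where c: "x = (s, c)" "c \<in> {1..\<mu> (Suc s)}" by blast
      then have "(Suc s, c) \<in> diagram \<mu>" by (simp add: diagram_def)
      then show "x \<in> {x\<in>diagram \<mu>. W x = s}"
        using above[of c] W c unfolding row_fixed_def by auto
    qed
    have "?C = {x\<in>diagram \<mu>. W x = s} - ?F" by (auto simp: diagram_def)
    then have "card ?C = card {x\<in>diagram \<mu>. W x = s} - card ?F"
      using card_Diff_subset[OF _ F] by simp
    also have "card {x\<in>diagram \<mu>. W x = s} = \<kappa> s + t"
      using W triangularD(3)[of W n \<mu> \<kappa>' s] sn by (simp add: \<kappa>'_def)
    also have "card ?F = \<mu> (Suc s)" by (simp add: card_image inj_on_def)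
    finally have "card ?C = \<kappa> s - \<mu> (Suc s) + t" using \<kappa> by simp
    then have "card (?Z2 W) = (\<kappa> s - \<mu> (Suc s) + t) choose t"
      using n_subsets[of ?C t] fin by simp
    then show "(\<Sum>Z\<in>?Z2 W. alternant \<mu> S M W)
        = int ((\<kappa> s - \<mu> (Suc s) + t) choose t) * alternant \<mu> S M W"
      by (simp only: sum_constant)
  qed
  finally show ?thesis unfolding \<kappa>'_def by (simp only: sum_distrib_left)
qed

lemma card_cells_with_value_in:
  fixes U :: "nat \<times> nat \<Rightarrow> nat"
  assumes "finite X"
  shows "card {x\<in>X. U x \<in> {1..s}} = (\<Sum>k=1..s. card {x\<in>X. U x = k})"
proof -
  have "(\<Sum>k=1..s. sum (\<lambda>_. 1) {x\<in>{x\<in>X. U x \<in> {1..s}}. U x = k})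
      = sum (\<lambda>_. 1::nat) {x\<in>X. U x \<in> {1..s}}"
    by (rule sum.group) (use assms in auto)
  moreover have "{x\<in>{x\<in>X. U x \<in> {1..s}}. U x = k} = {x\<in>X. U x = k}" if "k \<in> {1..s}" for k
    using that by auto
  ultimately show ?thesis by simp
qed

lemma card_upper_rows:
  assumes "finite (diagram \<mu>)"
  shows "card {x\<in>diagram \<mu>. fst x \<in> {1..s}} = (\<Sum>i=1..s. \<mu> i)"
  unfolding card_cells_with_value_in[OF assms] by (rule sum.cong) (auto simp: card_row)

text \<open>
  The entries up to \<open>s\<close> lie in the first \<open>s\<close> rows.
\<close>

lemma triangular_dominance:
  assumes \<mu>: "\<mu> \<in> compositions n r" and U: "U \<in> triangular n \<mu> \<kappa>" and s: "s \<le> n"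
  shows "(\<Sum>k=1..s. \<kappa> k) \<le> (\<Sum>i=1..s. \<mu> i)"
proof -
  have fin: "finite (diagram \<mu>)" by (rule finite_diagram[OF \<mu>])
  have "(\<Sum>k=1..s. \<kappa> k) = (\<Sum>k=1..s. card {x\<in>diagram \<mu>. U x = k})"
    by (rule sum.cong) (use triangularD(3)[OF U] s in auto)
  also have "\<dots> = card {x\<in>diagram \<mu>. U x \<in> {1..s}}"
    by (rule card_cells_with_value_in[OF fin, symmetric])
  also have "\<dots> \<le> card {x\<in>diagram \<mu>. fst x \<in> {1..s}}"
    by (rule card_mono) (use fin triangularD(2)[OF U] fst_in_range[OF \<mu>] in force)+
  also have "\<dots> = (\<Sum>i=1..s. \<mu> i)" by (rule card_upper_rows[OF fin])
  finally show ?thesis .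
qed

text \<open>\<open>t \<cdot> binom(L + t, t) = (L + 1) \<cdot> binom(L + t, t - 1)\<close>, and \<open>p\<^sup>l\<close> does not divide \<open>t\<close>.\<close>

lemma prime_dvd_shifted_binomial:
  fixes p :: nat
  assumes p: "prime p" and L: "p ^ l dvd L + 1" and t: "1 \<le> t" "t < p ^ l"
  shows "p dvd ((L + t) choose t)"
proof (rule ccontr)
  assume n: "\<not> p dvd ((L + t) choose t)"
  have "t * ((L + t) choose t) = (L + 1) * ((L + t) choose (t - 1))"
    using binomial_absorb_comp[of "L + t" "t - 1"] binomial_absorption[of "t - 1" "L + t"] t(1)
    by (simp add: algebra_simps)
  then have "p ^ l dvd t * ((L + t) choose t)" using L by (metis dvd_mult2)
  moreover have "coprime (p ^ l) ((L + t) choose t)"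
    using p n by (simp add: prime_imp_coprime)
  ultimately have "p ^ l dvd t" by (simp add: coprime_dvd_mult_left_iff)
  then show False using t by (auto dest: dvd_imp_le)
qed

lemma less_power_lp:
  assumes "p \<ge> 2" "1 \<le> t" "t \<le> a"
  shows "t < p ^ lp p a"
proof -
  have "a < 2 ^ a" by (rule less_exp)
  also have "\<dots> \<le> p ^ a" using assms(1) by (rule power_mono) simp
  finally have "\<exists>i. a < p ^ i" by blast
  then have "a < p ^ (LEAST i. a < p ^ i)" by (rule LeastI_ex)
  then show ?thesis using assms by (simp add: lp_def)
qed

text \<open>
  The two premises of \<open>dvd\<close> are necessary for triangular fillings of the new weight to arise:
  the first lets \<open>t\<close> entries \<open>s + 1\<close> be changed, the second is dominance for the new weight.
\<close>

lemma triangular_sum_invariant: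
  fixes p :: nat
  assumes char: "CHAR('a::comm_ring_1) = p"
    and \<mu>: "\<mu> \<in> partitions n r" and S: "S \<in> tableaux n \<mu>" and s: "s \<in> {1..<n}" and t: "t \<ge> 1"
    and le: "\<mu> (Suc s) \<le> lam s"
    and dvd: "\<lbrakk>t \<le> lam (Suc s); (\<Sum>i=1..s. lam i) + t \<le> (\<Sum>i=1..s. \<mu> i)\<rbrakk> \<Longrightarrow>
               p dvd ((lam s - \<mu> (Suc s) + t) choose t)"
  shows "row_raise n s t
           (\<lambda>B. of_int (\<Sum>U\<in>triangular n \<mu> lam. alternant \<mu> S B U) :: 'a) M = 0"
proof -
  note \<mu>c = partitions_compositions[OF \<mu>]
  have fin: "finite (diagram \<mu>)" by (rule finite_diagram[OF \<mu>c])
  have "(of_int (row_raise n s t (\<lambda>B. \<Sum>U\<in>triangular n \<mu> lam. alternant \<mu> S B U) M) :: 'a) = 0"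
  proof (cases "t \<le> lam (Suc s)")
    case False
    have none: "{Z. Z \<subseteq> {x\<in>diagram \<mu>. U x = Suc s} \<and> card Z = t} = {}"
      if U: "U \<in> triangular n \<mu> lam" for U
    proof -
      have "card Z \<le> lam (Suc s)" if "Z \<subseteq> {x\<in>diagram \<mu>. U x = Suc s}" for Z
        using card_mono[OF _ that] triangularD(3)[OF U, of "Suc s"] fin s by simp
      then show ?thesis using False by blast
    qed
    have "(\<Sum>Z | Z \<subseteq> {x\<in>diagram \<mu>. U x = Suc s} \<and> card Z = t.
        alternant \<mu> S M (relabel Z s U)) = 0" if "U \<in> triangular n \<mu> lam" for U
      by (simp only: none[OF that] sum.empty)
    then have "row_raise n s t (\<lambda>B. \<Sum>U\<in>triangular n \<mu> lam. alternant \<mu> S B U) M = 0"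
      unfolding row_raise_sum row_raise_alternant[OF fin S] by (rule sum.neutral[OF ballI])
    then show ?thesis by simp
  next
    case True
    define \<kappa>' where "\<kappa>' = lam(s := lam s + t, Suc s := lam (Suc s) - t)"
    let ?A = "{W. W \<in> triangular n \<mu> \<kappa>' \<and> row_fixed \<mu> s W}"
    have raise: "row_raise n s t (\<lambda>B. \<Sum>U\<in>triangular n \<mu> lam. alternant \<mu> S B U) M
        = int ((lam s - \<mu> (Suc s) + t) choose t) * (\<Sum>W\<in>?A. alternant \<mu> S M W)"
      unfolding \<kappa>'_def by (rule row_raise_triangular[where \<kappa> = lam, OF \<mu> S s le True])
    show ?thesis
    proof (cases "?A = {}")
      case True
      show ?thesis unfolding raise True by simp
    next
      case False
      then obtain W where "W \<in> triangular n \<mu> \<kappa>'" by blast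
      then have "(\<Sum>k=1..s. \<kappa>' k) \<le> (\<Sum>i=1..s. \<mu> i)"
        using s by (intro triangular_dominance[OF \<mu>c]) auto
      moreover have "(\<Sum>k=1..s. \<kappa>' k) = (\<Sum>k=1..s. lam k) + t"
      proof -
        obtain q where q: "s = Suc q" using s by (cases s) auto
        have "(\<Sum>k=1..q. \<kappa>' k) = (\<Sum>k=1..q. lam k)"
          by (rule sum.cong) (auto simp: \<kappa>'_def q)
        then show ?thesis by (simp add: q \<kappa>'_def)
      qed
      ultimately have "p dvd ((lam s - \<mu> (Suc s) + t) choose t)" using dvd[OF True] by simp
      then have "of_nat ((lam s - \<mu> (Suc s) + t) choose t) = (0::'a)"
        using char of_nat_eq_0_iff_char_dvd by blast
      then show ?thesis unfolding raise by (simp only: of_int_mult of_int_of_nat_eq mult_zero_left)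
    qed
  qed
  then show ?thesis by (simp only: row_raise_of_int)
qed

section \<open>The maps attached to tableaux on words\<close>

text \<open>
  The multinomial coefficient of a tensor \<open>B\<close> in the middle term is the number of fillings \<open>U\<close>
  that put into row \<open>i\<close>, under the letters \<open>k\<close> of \<open>w\<close>, exactly \<open>B (i, j) k\<close> entries \<open>j\<close>.
\<close>

lemma D_mult_D_comult_row_content:
  fixes f :: "(nat \<Rightarrow> nat \<Rightarrow> nat) \<Rightarrow> 'a::field"
  assumes \<mu>: "\<mu> \<in> compositions n r" and T: "T \<in> tableaux n \<mu>"
    and w: "\<And>x. x \<in> diagram \<mu> \<Longrightarrow> w x \<in> {1..n}"
  shows "D_mult n {1..n} {1..n}
           (D_comult n {1..n} {1..n} (\<lambda>(i, j). row_content \<mu> T i j) f) (row_content \<mu> w)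
       = (\<Sum>U | U \<in> tableaux n \<mu> \<and> row_content \<mu> U = row_content \<mu> T.
            f (pair_content (diagram \<mu>) U w))"
proof -
  let ?X = "diagram \<mu>" and ?J = "{1..n}" and ?C = "row_content \<mu> w"
  let ?h = "D_comult n ?J ?J (\<lambda>(i, j). row_content \<mu> T i j) f"
  let ?BU = "\<lambda>U. \<lambda>(i, j) k. card {x\<in>?X. (fst x, w x) = (i, k) \<and> U x = j}"
  let ?BB = "{B. (\<forall>x k. B x k \<noteq> 0 \<longrightarrow> x \<in> ?J \<times> ?J \<and> k \<in> ?J) \<and>
                 (\<forall>i k. ?C i k = (\<Sum>j\<in>?J. B (i, j) k))}"
  have fin: "finite ?X" by (rule finite_diagram[OF \<mu>])
  have finT: "finite (tableaux n \<mu>)" by (rule finite_tableaux[OF \<mu>])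
  have C: "?C i k = card {x\<in>?X. (fst x, w x) = (i, k)}" for i k
    by (simp add: row_content_eq_pair_content pair_content_def)
  have finB: "finite ?BB"
  proof (rule finite_subset)
    let ?b = "{b. \<forall>k. (k \<in> ?J \<longrightarrow> b k \<in> {..card ?X}) \<and> (k \<notin> ?J \<longrightarrow> b k = 0)}"
    show "?BB \<subseteq> {B. \<forall>q. (q \<in> ?J \<times> ?J \<longrightarrow> B q \<in> ?b) \<and> (q \<notin> ?J \<times> ?J \<longrightarrow> B q = (\<lambda>_. 0))}"
    proof
      fix B assume B: "B \<in> ?BB"
      have le: "B q k \<le> card ?X" if q: "q \<in> ?J \<times> ?J" for q k
      proof -
        obtain i j where ij: "q = (i, j)" "j \<in> ?J" using q by auto
        have "B (i, j) k \<le> (\<Sum>j\<in>?J. B (i, j) k)" using ij by (intro member_le_sum) auto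
        also have "\<dots> = ?C i k" using B by simp
        also have "\<dots> \<le> card ?X" unfolding C using fin by (intro card_mono) auto
        finally show ?thesis using ij by simp
      qed
      have z: "B q k = 0" if "q \<notin> ?J \<times> ?J \<or> k \<notin> ?J" for q k
        using B that by blast
      show "B \<in> {B. \<forall>q. (q \<in> ?J \<times> ?J \<longrightarrow> B q \<in> ?b) \<and> (q \<notin> ?J \<times> ?J \<longrightarrow> B q = (\<lambda>_. 0))}"
      proof (rule CollectI, intro allI conjI impI)
        fix q
        show "B q \<in> ?b" if "q \<in> ?J \<times> ?J" using le[OF that] z[of q] by blast
        show "B q = (\<lambda>_. 0)" if "q \<notin> ?J \<times> ?J" using z[of q] that by blast
      qed
    qed
    show "finite {B. \<forall>q. (q \<in> ?J \<times> ?J \<longrightarrow> B q \<in> ?b) \<and> (q \<notin> ?J \<times> ?J \<longrightarrow> B q = (\<lambda>_. 0))}"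
      by (intro finite_set_of_finite_funs) auto
  qed
  have BU: "?BU U \<in> ?BB" if U: "U \<in> tableaux n \<mu>" for U
  proof (rule CollectI, intro conjI allI impI)
    fix q k assume nz: "?BU U q k \<noteq> 0"
    obtain i j where ij: "q = (i, j)" by force
    have "{x\<in>?X. (fst x, w x) = (i, k) \<and> U x = j} \<noteq> {}"
      using nz unfolding ij by (metis (no_types, lifting) card.empty prod.case)
    then obtain x where "x \<in> ?X" "fst x = i" "w x = k" "U x = j" by auto
    then show "q \<in> ?J \<times> ?J" "k \<in> ?J"
      using fst_in_range[OF \<mu>, of x] w[of x] tableaux_range[OF U, of x] ij by simp_all
  next
    fix i k
    have "(\<Sum>j\<in>?J. sum (\<lambda>_. 1) {x\<in>{x\<in>?X. (fst x, w x) = (i, k)}. U x = j})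
        = sum (\<lambda>_. 1::nat) {x\<in>?X. (fst x, w x) = (i, k)}"
      by (rule sum.group) (use fin tableaux_range[OF U] in auto)
    then show "?C i k = (\<Sum>j\<in>?J. ?BU U (i, j) k)" by (simp add: C conj_assoc)
  qed
  have fibre: "card {U\<in>tableaux n \<mu>. ?BU U = B}
      = (\<Prod>i\<in>?J. \<Prod>k=1..n. fact (?C i k) div (\<Prod>j\<in>?J. fact (B (i, j) k)))"
    if B: "B \<in> ?BB" for B
  proof -
    have eq: "{U\<in>tableaux n \<mu>. ?BU U = B} = {U. (\<forall>x\<in>?X. U x \<in> ?J) \<and> (\<forall>x. x \<notin> ?X \<longrightarrow> U x = 0) \<and>
        (\<forall>q\<in>?J \<times> ?J. \<forall>j\<in>?J. card {x\<in>?X. (fst x, w x) = q \<and> U x = j} = B (fst q, j) (snd q))}"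
      (is "?L = ?R")
    proof (intro equalityI subsetI)
      fix U assume U: "U \<in> ?L"
      then have UT: "U \<in> tableaux n \<mu>" and e: "?BU U = B" by blast+
      show "U \<in> ?R"
      proof (rule CollectI, intro conjI ballI allI impI)
        show "U x \<in> ?J" if "x \<in> ?X" for x using tableaux_range[OF UT that] .
        show "U x = 0" if "x \<notin> ?X" for x using tableaux_outside[OF UT that] .
        show "card {x\<in>?X. (fst x, w x) = q \<and> U x = j} = B (fst q, j) (snd q)" for q j
          unfolding e[symmetric] prod.case_eq_if fst_conv snd_conv prod.collapse ..
      qed
    next
      fix U assume U: "U \<in> ?R"
      then have UT: "U \<in> tableaux n \<mu>" unfolding tableaux_def by blast
      have "?BU U q k = B q k" for q k
      proof (cases "q \<in> ?J \<times> ?J \<and> k \<in> ?J")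
        case True
        then have "card {x\<in>?X. (fst x, w x) = (fst q, k) \<and> U x = snd q} = B (fst q, snd q) k"
          using U by (cases q) force
        then show ?thesis by (simp only: case_prod_beta prod.collapse)
      next
        case False
        have "?BU U q k = 0" "B q k = 0" using BU[OF UT] B False by blast+
        then show ?thesis by simp
      qed
      then have "?BU U = B" by (intro ext)
      then show "U \<in> ?L" using UT by simp
    qed
    have "card ?L = card ?R" by (rule arg_cong[OF eq])
    also have "\<dots> = (\<Prod>q\<in>?J \<times> ?J. fact (card {x\<in>?X. (fst x, w x) = q}) div
        (\<Prod>j\<in>?J. fact (B (fst q, j) (snd q))))"
    proof (rule card_fillings_with_content)
      show "(\<lambda>x. (fst x, w x)) ` ?X \<subseteq> ?J \<times> ?J" using fst_in_range[OF \<mu>] w by auto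
      fix q assume "q \<in> ?J \<times> ?J"
      show "(\<Sum>j\<in>?J. B (fst q, j) (snd q)) = card {x\<in>?X. (fst x, w x) = q}"
      proof -
        have "?C (fst q) (snd q) = (\<Sum>j\<in>?J. B (fst q, j) (snd q))" using B by blast
        then show ?thesis using C[of "fst q" "snd q"] by (simp only: prod.collapse)
      qed
    qed (rule finite_atLeastAtMost fin finite_cartesian_product)+
    also have "\<dots> = (\<Prod>i\<in>?J. \<Prod>k=1..n. fact (?C i k) div (\<Prod>j\<in>?J. fact (B (i, j) k)))"
      unfolding prod.cartesian_product by (rule prod.cong) (auto simp: C)
    finally show ?thesis .
  qed
  have "D_mult n ?J ?J ?h ?C = (\<Sum>B\<in>?BB. of_nat (card {U\<in>tableaux n \<mu>. ?BU U = B}) * ?h B)"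
    unfolding D_mult_def by (rule sum.cong[OF refl]) (simp only: fibre)
  also have "\<dots> = (\<Sum>B\<in>?BB. \<Sum>U\<in>{U\<in>tableaux n \<mu>. ?BU U = B}. ?h (?BU U))"
  proof (rule sum.cong[OF refl])
    fix B
    have "(\<Sum>U\<in>{U\<in>tableaux n \<mu>. ?BU U = B}. ?h (?BU U)) = (\<Sum>U\<in>{U\<in>tableaux n \<mu>. ?BU U = B}. ?h B)"
      by (rule sum.cong[OF refl]) blast
    then show "of_nat (card {U\<in>tableaux n \<mu>. ?BU U = B}) * ?h B
        = (\<Sum>U\<in>{U\<in>tableaux n \<mu>. ?BU U = B}. ?h (?BU U))" by (simp only: sum_constant)
  qed
  also have "\<dots> = (\<Sum>U\<in>tableaux n \<mu>. ?h (?BU U))"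
    by (rule sum.group) (use finT finB BU in auto)
  also have "\<dots> = (\<Sum>U\<in>tableaux n \<mu>. if row_content \<mu> U = row_content \<mu> T
      then f (pair_content ?X U w) else 0)"
  proof (rule sum.cong[OF refl])
    fix U assume U: "U \<in> tableaux n \<mu>"
    have row: "(\<Sum>k=1..n. ?BU U (i, j) k) = row_content \<mu> U i j" for i j
    proof -
      have "(\<Sum>k=1..n. sum (\<lambda>_. 1) {x\<in>{x\<in>?X. fst x = i \<and> U x = j}. w x = k})
          = sum (\<lambda>_. 1::nat) {x\<in>?X. fst x = i \<and> U x = j}"
        by (rule sum.group) (use fin w in auto)
      moreover have "{x\<in>{x\<in>?X. fst x = i \<and> U x = j}. w x = k}
          = {x\<in>?X. (fst x, w x) = (i, k) \<and> U x = j}" for k by auto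
      ultimately show ?thesis by (simp add: row_content_eq_pair_content pair_content_def)
    qed
    have col: "(\<Sum>i\<in>?J. ?BU U (i, j) k) = pair_content ?X U w j k" for j k
    proof -
      have "(\<Sum>i\<in>?J. sum (\<lambda>_. 1) {x\<in>{x\<in>?X. U x = j \<and> w x = k}. fst x = i})
          = sum (\<lambda>_. 1::nat) {x\<in>?X. U x = j \<and> w x = k}"
        by (rule sum.group) (use fin fst_in_range[OF \<mu>] in auto)
      moreover have "{x\<in>{x\<in>?X. U x = j \<and> w x = k}. fst x = i}
          = {x\<in>?X. (fst x, w x) = (i, k) \<and> U x = j}" for i by auto
      ultimately show ?thesis by (simp add: pair_content_def)
    qed
    have out: "row_content \<mu> V i j = 0" if V: "V \<in> tableaux n \<mu>" and "(i, j) \<notin> ?J \<times> ?J" for V i j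
    proof -
      have "{x\<in>?X. fst x = i \<and> V x = j} = {}"
        using that(2) fst_in_range[OF \<mu>] tableaux_range[OF V] by blast
      then show ?thesis unfolding row_content_eq_pair_content pair_content_def by (simp only: card.empty)
    qed
    have "?BU U \<in> D_basis n (?J \<times> ?J) (\<lambda>(i, j). row_content \<mu> T i j)
        \<longleftrightarrow> (\<forall>q\<in>?J \<times> ?J. (\<Sum>k=1..n. ?BU U q k) = (case q of (i, j) \<Rightarrow> row_content \<mu> T i j))"
      using BU[OF U] unfolding D_basis_def by blast
    also have "\<dots> \<longleftrightarrow> (\<forall>(i, j)\<in>?J \<times> ?J. row_content \<mu> U i j = row_content \<mu> T i j)"
      using row by (simp add: case_prod_beta)
    also have "\<dots> \<longleftrightarrow> row_content \<mu> U = row_content \<mu> T"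
    proof
      assume a: "\<forall>(i, j)\<in>?J \<times> ?J. row_content \<mu> U i j = row_content \<mu> T i j"
      show "row_content \<mu> U = row_content \<mu> T"
      proof (intro ext)
        fix i j
        show "row_content \<mu> U i j = row_content \<mu> T i j"
          using a out[OF U, of i j] out[OF T, of i j] by (cases "(i, j) \<in> ?J \<times> ?J") fastforce+
      qed
    qed auto
    finally show "?h (?BU U) = (if row_content \<mu> U = row_content \<mu> T
        then f (pair_content ?X U w) else 0)"
      unfolding D_comult_def by (simp only: col)
  qed
  also have "\<dots> = (\<Sum>U | U \<in> tableaux n \<mu> \<and> row_content \<mu> U = row_content \<mu> T.
            f (pair_content ?X U w))"
    using sum.inter_filter[OF finT, of "\<lambda>U. f (pair_content ?X U w)"
        "\<lambda>U. row_content \<mu> U = row_content \<mu> T"] by simp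
  finally show ?thesis .
qed

lemma tableaux_comp:
  assumes T: "T \<in> tableaux n \<mu>" and \<sigma>: "\<sigma> \<in> column_perms \<mu>"
  shows "T \<circ> \<sigma> \<in> tableaux n \<mu>"
  unfolding tableaux_def
proof (rule CollectI, intro conjI ballI allI impI)
  note p = column_permsD(1)[OF \<sigma>]
  fix x
  show "(T \<circ> \<sigma>) x \<in> {1..n}" if "x \<in> diagram \<mu>"
    using tableaux_range[OF T, of "\<sigma> x"] permutes_in_image[OF p, of x] that by simp
  show "(T \<circ> \<sigma>) x = 0" if "x \<notin> diagram \<mu>"
    using tableaux_outside[OF T that] permutes_not_in[OF p that] by simp
qed

lemma col_tableaux_tableaux: "S \<in> col_tableaux n \<mu> \<Longrightarrow> S \<in> tableaux n \<mu>"
  by (simp add: col_tableaux_def)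

lemma wedge_cong:
  assumes "\<And>w. w \<in> tableaux n \<mu> \<Longrightarrow> h w = h' w"
  shows "wedge n \<mu> h = wedge n \<mu> h'"
proof
  fix S
  show "wedge n \<mu> h S = wedge n \<mu> h' S"
  proof (cases "S \<in> col_tableaux n \<mu>")
    case True
    have "h (S \<circ> \<sigma>) = h' (S \<circ> \<sigma>)" if "\<sigma> \<in> column_perms \<mu>" for \<sigma>
      by (rule assms, rule tableaux_comp[OF col_tableaux_tableaux[OF True] that])
    then show ?thesis unfolding wedge_def by (simp cong: sum.cong)
  qed (simp add: wedge_def)
qed

lemma wedge_sum:
  "wedge n \<mu> (\<lambda>w. \<Sum>i\<in>I. h i w) S = (\<Sum>i\<in>I. wedge n \<mu> (h i) S)"
  unfolding wedge_def by (simp add: sum_distrib_left) (intro impI, rule sum.swap)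

lemma phi_eq_wedge:
  fixes f :: "(nat \<Rightarrow> nat \<Rightarrow> nat) \<Rightarrow> 'a::field"
  assumes \<mu>: "\<mu> \<in> compositions n r" and T: "T \<in> tableaux n \<mu>"
  shows "phi n \<mu> T f = wedge n \<mu> (\<lambda>w. \<Sum>U | U \<in> tableaux n \<mu> \<and> row_content \<mu> U = row_content \<mu> T.
            f (pair_content (diagram \<mu>) U w))"
  unfolding phi_def weyl_proj_def polarize_def
  by (rule wedge_cong, rule D_mult_D_comult_row_content[OF \<mu> T], rule tableaux_range)

section \<open>Semistandard tableaux as sorted triangular fillings\<close>

lemma card_value_eq_sum_row_content:
  assumes "\<mu> \<in> compositions n r"
  shows "card {x\<in>diagram \<mu>. T x = k} = (\<Sum>i=1..n. row_content \<mu> T i k)"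
proof -
  have "(\<Sum>i=1..n. sum (\<lambda>_. 1) {x\<in>{x\<in>diagram \<mu>. T x = k}. fst x = i})
      = sum (\<lambda>_. 1::nat) {x\<in>diagram \<mu>. T x = k}"
    by (rule sum.group) (use finite_diagram[OF assms] fst_in_range[OF assms] in auto)
  moreover have "{x\<in>{x\<in>diagram \<mu>. T x = k}. fst x = i} = {x\<in>diagram \<mu>. fst x = i \<and> T x = k}"
    for i by auto
  ultimately show ?thesis by (simp add: row_content_eq_pair_content pair_content_def)
qed

lemma card_neq_0I: "finite A \<Longrightarrow> x \<in> A \<Longrightarrow> card A \<noteq> 0"
  by (metis card_eq_0_iff empty_iff)

lemma triangular_of_row_content_eq:
  assumes \<mu>: "\<mu> \<in> compositions n r" and T: "T \<in> triangular n \<mu> \<kappa>" and U: "U \<in> tableaux n \<mu>"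
    and eq: "row_content \<mu> U = row_content \<mu> T"
  shows "U \<in> triangular n \<mu> \<kappa>"
  unfolding triangular_def
proof (rule CollectI, intro conjI ballI)
  show "U \<in> tableaux n \<mu>" by (rule U)
  show "card {x\<in>diagram \<mu>. U x = k} = \<kappa> k" if "k \<in> {1..n}" for k
    using triangularD(3)[OF T that] eq by (simp add: card_value_eq_sum_row_content[OF \<mu>])
  fix x assume x: "x \<in> diagram \<mu>"
  have "x \<in> {y\<in>diagram \<mu>. fst y = fst x \<and> U y = U x}" using x by simp
  then have "card {y\<in>diagram \<mu>. fst y = fst x \<and> U y = U x} \<noteq> 0"
    using finite_diagram[OF \<mu>] by (intro card_neq_0I) simp_all
  then have "row_content \<mu> T (fst x) (U x) \<noteq> 0"
    unfolding eq[symmetric] unfolding row_content_eq_pair_content pair_content_def .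
  then have "{y\<in>diagram \<mu>. fst y = fst x \<and> T y = U x} \<noteq> {}"
    unfolding row_content_eq_pair_content pair_content_def by (metis card.empty)
  then obtain y where y: "y \<in> diagram \<mu>" "fst y = fst x" "T y = U x" by blast
  show "fst x \<le> U x" using triangularD(2)[OF T y(1)] y(2,3) by simp
qed

lemma SST_triangular:
  assumes \<mu>: "\<mu> \<in> partitions n r" and T: "T \<in> SST n lam \<mu>"
  shows "T \<in> triangular n \<mu> lam"
proof -
  have TT: "T \<in> tableaux n \<mu>" and c: "column_strict \<mu> T"
    and wt: "\<And>k. k \<in> {1..n} \<Longrightarrow> card {x\<in>diagram \<mu>. T x = k} = lam k"
    using T by (auto simp: SST_def RSST_def)
  have "i \<le> T (i, c)" if "(i, c) \<in> diagram \<mu>" for i c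
    using that
  proof (induction i)
    case (Suc i)
    show ?case
    proof (cases "i = 0")
      case True
      then show ?thesis using tableaux_range[OF TT Suc.prems] by simp
    next
      case False
      then have "(i, c) \<in> diagram \<mu>"
        using Suc.prems partitions_antimono[OF \<mu>, of i "Suc i"] by (auto simp: diagram_def)
      then have "i \<le> T (i, c)" "T (i, c) < T (Suc i, c)"
        using Suc c unfolding column_strict_def by blast+
      then show ?thesis by simp
    qed
  qed simp
  then show ?thesis using TT wt by (auto simp: triangular_def)
qed

text \<open>
  This is what membership of \<open>lam\<close> in \<open>P(\<mu>)\<close> says about consecutive rows.
\<close>

definition row_gap :: "nat \<Rightarrow> (nat \<Rightarrow> nat) \<Rightarrow> (nat \<Rightarrow> nat) \<Rightarrow> bool" where
  "row_gap n lam \<mu> \<longleftrightarrow> (\<forall>s\<in>{1..<n}. \<mu> (Suc s) \<noteq> 0 \<longrightarrow>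
     (\<Sum>j=1..s-1. \<mu> j) + \<mu> (Suc s) \<le> (\<Sum>j=1..s. lam j))"

text \<open>
  If the entry at \<open>(s, c)\<close> were larger than \<open>s\<close>, so would be the entries of row \<open>s\<close> from column
  \<open>c\<close> on, and the first \<open>s\<close> rows would have too few cells for the entries up to \<open>s\<close>, all of which
  lie there.
\<close>

lemma sorted_triangular_fixed:
  assumes \<mu>: "\<mu> \<in> partitions n r"
    and gap: "row_gap n lam \<mu>"
    and T: "T \<in> triangular n \<mu> lam" "row_weakly_increasing \<mu> T"
    and s: "s \<ge> 1" and c: "(Suc s, c) \<in> diagram \<mu>"
  shows "T (s, c) = s"
proof (rule ccontr)
  assume ne: "T (s, c) \<noteq> s"
  note \<mu>c = partitions_compositions[OF \<mu>]
  have fin: "finite (diagram \<mu>)" by (rule finite_diagram[OF \<mu>c])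
  have sn: "s \<in> {1..<n}" using fst_in_range[OF \<mu>c c] s by auto
  have sc: "(s, c) \<in> diagram \<mu>" and c1: "1 \<le> c" "c \<le> \<mu> (Suc s)" "c \<le> \<mu> s"
    using c s partitions_antimono[OF \<mu> s, of "Suc s"] by (auto simp: diagram_def)
  have big: "s < T (s, c)" using ne triangularD(2)[OF T(1) sc] by simp
  let ?F = "(\<lambda>d. (s, d)) ` {c..\<mu> s}"
  let ?R = "{x\<in>diagram \<mu>. fst x \<in> {1..s}}"
  have F: "?F \<subseteq> ?R" using s c1 by (auto simp: diagram_def)
  have "{x\<in>diagram \<mu>. T x \<in> {1..s}} \<subseteq> ?R - ?F"
  proof
    fix x assume "x \<in> {x\<in>diagram \<mu>. T x \<in> {1..s}}"
    then have x: "x \<in> diagram \<mu>" "T x \<le> s" by auto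
    have "x \<notin> ?F"
    proof
      assume "x \<in> ?F"
      then obtain d where d: "x = (s, d)" "c \<le> d" by auto
      then have "T (s, c) \<le> T (s, d)"
        using T(2) sc x(1) unfolding row_weakly_increasing_def by (cases "c = d") auto
      then show False using big x(2) d by simp
    qed
    moreover have "fst x \<le> s" using triangularD(2)[OF T(1) x(1)] x(2) by simp
    ultimately show "x \<in> ?R - ?F" using x fst_in_range[OF \<mu>c x(1)] by simp
  qed
  then have "card {x\<in>diagram \<mu>. T x \<in> {1..s}} \<le> card (?R - ?F)"
    by (intro card_mono) (use fin in auto)
  also have "\<dots> = card ?R - card ?F" using F by (intro card_Diff_subset) auto
  also have "card ?F = \<mu> s + 1 - c" by (simp add: card_image inj_on_def)
  also have "card ?R = (\<Sum>i=1..s. \<mu> i)" by (rule card_upper_rows[OF fin])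
  also have "card {x\<in>diagram \<mu>. T x \<in> {1..s}} = (\<Sum>k=1..s. lam k)"
    unfolding card_cells_with_value_in[OF fin]
    by (rule sum.cong) (use triangularD(3)[OF T(1)] sn in auto)
  also have "(\<Sum>i=1..s. \<mu> i) = (\<Sum>i=1..s-1. \<mu> i) + \<mu> s" using s by (cases s) auto
  finally have "(\<Sum>k=1..s. lam k) \<le> (\<Sum>i=1..s-1. \<mu> i) + \<mu> s - (\<mu> s + 1 - c)" .
  moreover have "(\<Sum>j=1..s-1. \<mu> j) + \<mu> (Suc s) \<le> (\<Sum>j=1..s. lam j)"
    using gap sn c1 by (simp add: row_gap_def)
  ultimately show False using c1 by simp
qed

lemma sorted_triangular_SST:
  assumes \<mu>: "\<mu> \<in> partitions n r"
    and gap: "row_gap n lam \<mu>"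
    and T: "T \<in> triangular n \<mu> lam" "row_weakly_increasing \<mu> T"
  shows "T \<in> SST n lam \<mu>"
proof -
  have "column_strict \<mu> T"
    unfolding column_strict_def
  proof (intro allI impI)
    fix i j c assume a: "(i, c) \<in> diagram \<mu> \<and> (j, c) \<in> diagram \<mu> \<and> i < j"
    then have i: "i \<ge> 1" by (auto simp: diagram_def)
    have "(Suc i, c) \<in> diagram \<mu>"
      using a partitions_antimono[OF \<mu>, of "Suc i" j] by (auto simp: diagram_def)
    then have "T (i, c) = i" using sorted_triangular_fixed[OF \<mu> gap T i] by blast
    moreover have "j \<le> T (j, c)" using triangularD(2)[OF T(1), of "(j, c)"] a by simp
    ultimately show "T (i, c) < T (j, c)" using a by simp
  qed
  then show ?thesis using T triangularD[OF T(1)] by (auto simp: SST_def RSST_def)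
qed

text \<open>
  Sorting rows maps the triangular fillings onto the semistandard tableaux, with the row classes as
  fibres.
\<close>

lemma sum_SST_row_classes:
  fixes h :: "(nat \<times> nat \<Rightarrow> nat) \<Rightarrow> 'a::comm_monoid_add"
  assumes \<mu>: "\<mu> \<in> partitions n r"
    and gap: "row_gap n lam \<mu>"
  shows "(\<Sum>T\<in>SST n lam \<mu>. \<Sum>U | U \<in> tableaux n \<mu> \<and> row_content \<mu> U = row_content \<mu> T. h U)
       = (\<Sum>U\<in>triangular n \<mu> lam. h U)"
proof -
  note \<mu>c = partitions_compositions[OF \<mu>]
  have fin: "finite (diagram \<mu>)" by (rule finite_diagram[OF \<mu>c])
  let ?R = "\<lambda>T. {U. U \<in> tableaux n \<mu> \<and> row_content \<mu> U = row_content \<mu> T}"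
  have sst: "T \<in> tableaux n \<mu> \<and> row_weakly_increasing \<mu> T" if "T \<in> SST n lam \<mu>" for T
    using that by (simp add: SST_def RSST_def)
  have "triangular n \<mu> lam = (\<Union>T\<in>SST n lam \<mu>. ?R T)"
  proof (intro equalityI subsetI)
    fix U assume U: "U \<in> triangular n \<mu> lam"
    note UT = triangularD(1)[OF U]
    have "row_content \<mu> U \<in> D_basis n {1..n} \<mu>"
      by (rule row_content_in_D_basis[OF \<mu>c tableaux_range[OF UT]])
    then obtain T where T: "T \<in> tableaux n \<mu>" "row_weakly_increasing \<mu> T"
        "row_content \<mu> T = row_content \<mu> U"
      using ex_row_sorted_tableau[OF \<mu>c] by blast
    have "T \<in> triangular n \<mu> lam" by (rule triangular_of_row_content_eq[OF \<mu>c U T(1,3)])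
    then have "T \<in> SST n lam \<mu>" using sorted_triangular_SST[OF \<mu> gap _ T(2)] by blast
    moreover have "U \<in> ?R T" using UT T(3) by simp
    ultimately show "U \<in> (\<Union>T\<in>SST n lam \<mu>. ?R T)" by blast
  next
    fix U assume "U \<in> (\<Union>T\<in>SST n lam \<mu>. ?R T)"
    then obtain T where T: "T \<in> SST n lam \<mu>" "U \<in> tableaux n \<mu>" "row_content \<mu> U = row_content \<mu> T"
      by blast
    show "U \<in> triangular n \<mu> lam"
      by (rule triangular_of_row_content_eq[OF \<mu>c SST_triangular[OF \<mu> T(1)] T(2,3)])
  qed
  moreover have "(\<Sum>U\<in>(\<Union>T\<in>SST n lam \<mu>. ?R T). h U) = (\<Sum>T\<in>SST n lam \<mu>. \<Sum>U\<in>?R T. h U)"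
  proof (rule sum.UNION_disjoint)
    show "finite (SST n lam \<mu>)"
      by (rule finite_subset[OF _ finite_tableaux[OF \<mu>c]]) (auto simp: SST_def RSST_def)
    show "\<forall>T\<in>SST n lam \<mu>. finite (?R T)" using finite_tableaux[OF \<mu>c] by simp
    show "\<forall>T\<in>SST n lam \<mu>. \<forall>T'\<in>SST n lam \<mu>. T \<noteq> T' \<longrightarrow> ?R T \<inter> ?R T' = {}"
    proof (intro ballI impI)
      fix T T' assume TT: "T \<in> SST n lam \<mu>" "T' \<in> SST n lam \<mu>" "T \<noteq> T'"
      then have "row_content \<mu> T \<noteq> row_content \<mu> T'"
        using row_sorted_unique[OF fin] sst by blast
      then show "?R T \<inter> ?R T' = {}" by auto
    qed
  qed
  ultimately show ?thesis by simp
qed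

lemma psi_eq_wedge:
  fixes f :: "(nat \<Rightarrow> nat \<Rightarrow> nat) \<Rightarrow> 'a::field"
  assumes \<mu>: "\<mu> \<in> partitions n r"
    and gap: "row_gap n lam \<mu>"
  shows "psi n lam \<mu> f
       = wedge n \<mu> (\<lambda>w. \<Sum>U\<in>triangular n \<mu> lam. f (pair_content (diagram \<mu>) U w))"
proof -
  note \<mu>c = partitions_compositions[OF \<mu>]
  let ?h = "\<lambda>T w. \<Sum>U | U \<in> tableaux n \<mu> \<and> row_content \<mu> U = row_content \<mu> T.
        f (pair_content (diagram \<mu>) U w)"
  have "psi n lam \<mu> f S = wedge n \<mu> (\<lambda>w. \<Sum>T\<in>SST n lam \<mu>. ?h T w) S" for S
  proof -
    have "psi n lam \<mu> f S = (\<Sum>T\<in>SST n lam \<mu>. wedge n \<mu> (?h T) S)"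
      unfolding psi_def
    proof (rule sum.cong[OF refl])
      fix T assume "T \<in> SST n lam \<mu>"
      then have "T \<in> tableaux n \<mu>" by (simp add: SST_def RSST_def)
      then show "phi n \<mu> T f S = wedge n \<mu> (?h T) S" by (simp only: phi_eq_wedge[OF \<mu>c])
    qed
    also have "\<dots> = wedge n \<mu> (\<lambda>w. \<Sum>T\<in>SST n lam \<mu>. ?h T w) S" by (rule wedge_sum[symmetric])
    finally show ?thesis .
  qed
  moreover have "(\<Sum>T\<in>SST n lam \<mu>. ?h T w)
      = (\<Sum>U\<in>triangular n \<mu> lam. f (pair_content (diagram \<mu>) U w))" for w
    by (rule sum_SST_row_classes[OF \<mu> gap])
  ultimately show ?thesis by (intro ext) (simp only:)
qed

section \<open>Nonvanishing\<close>

text \<open>The cells in reading order receive the word \<open>1 \<dots> 1 2 \<dots> 2 \<dots>\<close> of weight \<open>lam\<close>;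
  dominance keeps the entries of row \<open>i\<close> at least \<open>i\<close>.\<close>

lemma ex_triangular:
  assumes \<mu>: "\<mu> \<in> compositions n r" and lam: "lam \<in> compositions n r" and dom: "dominated n lam \<mu>"
  shows "triangular n \<mu> lam \<noteq> {}"
proof -
  let ?X = "diagram \<mu>"
  have fin: "finite ?X" by (rule finite_diagram[OF \<mu>])
  define pos where "pos = (\<lambda>x. snd x + (\<Sum>j=1..fst x - 1. \<mu> j))"
  define \<Lambda> where "\<Lambda> k = (\<Sum>j=1..k. lam j)" for k
  define T where "T x = (if x \<in> ?X then LEAST k. pos x \<le> \<Lambda> k else 0)" for x
  have \<mu>r: "(\<Sum>i=1..n. \<mu> i) = r" and \<Lambda>n: "\<Lambda> n = r"
    using \<mu> lam by (auto simp: compositions_def \<Lambda>_def)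
  have mono: "\<Lambda> k \<le> \<Lambda> l" if "k \<le> l" for k l
    unfolding \<Lambda>_def by (rule sum_mono2) (use that in auto)
  have pos_lower: "(\<Sum>j=1..i-1. \<mu> j) < pos (i, c)" and pos_upper: "pos (i, c) \<le> (\<Sum>j=1..i. \<mu> j)"
    if "(i, c) \<in> ?X" for i c
    using that by (cases i; auto simp: pos_def diagram_def)+
  have pos_range: "pos x \<in> {1..r}" if x: "x \<in> ?X" for x
  proof -
    obtain i c where ic: "x = (i, c)" by force
    have "(\<Sum>j=1..i. \<mu> j) \<le> (\<Sum>j=1..n. \<mu> j)"
      by (rule sum_mono2) (use fst_in_range[OF \<mu> x] ic in auto)
    then show ?thesis using pos_lower[of i c] pos_upper[of i c] x ic \<mu>r by simp
  qed
  have row_less: "pos (i, c) < pos (j, d)" if "(i, c) \<in> ?X" "(j, d) \<in> ?X" "i < j" for i c j d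
  proof -
    have "(\<Sum>j=1..i. \<mu> j) \<le> (\<Sum>j=1..j-1. \<mu> j)"
      by (rule sum_mono2) (use that(3) in auto)
    then show ?thesis using pos_upper[OF that(1)] pos_lower[OF that(2)] by simp
  qed
  have inj: "inj_on pos ?X"
  proof (rule inj_onI)
    fix x y assume xy: "x \<in> ?X" "y \<in> ?X" "pos x = pos y"
    obtain i c where x: "x = (i, c)" by force
    obtain j d where y: "y = (j, d)" by force
    have "i = j" using row_less[of i c j d] row_less[of j d i c] xy x y
      by (metis less_irrefl linorder_neqE_nat)
    then show "x = y" using xy x y by (simp add: pos_def)
  qed
  have "card ?X = r"
  proof -
    have "?X = {x\<in>?X. fst x \<in> {1..n}}" using fst_in_range[OF \<mu>] by blast
    then show ?thesis using card_upper_rows[OF fin, of n] \<mu>r by simp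
  qed
  then have surj: "pos ` ?X = {1..r}"
    using card_image[OF inj] pos_range by (intro card_subset_eq) auto
  have ex: "\<exists>k. pos x \<le> \<Lambda> k" if "x \<in> ?X" for x
    using pos_range[OF that] \<Lambda>n by (intro exI[of _ n]) simp
  have le_iff: "T x \<le> k \<longleftrightarrow> pos x \<le> \<Lambda> k" if x: "x \<in> ?X" for x k
  proof
    assume "T x \<le> k"
    moreover have "pos x \<le> \<Lambda> (T x)" unfolding T_def using x LeastI_ex[OF ex[OF x]] by simp
    ultimately show "pos x \<le> \<Lambda> k" using mono[of "T x" k] by simp
  next
    assume "pos x \<le> \<Lambda> k"
    then show "T x \<le> k" unfolding T_def using x by (simp add: Least_le)
  qed
  have count: "card {x\<in>?X. T x \<le> k} = \<Lambda> k" if "k \<le> n" for k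
  proof -
    have "pos ` {x\<in>?X. T x \<le> k} = {1..\<Lambda> k}"
    proof (intro equalityI subsetI)
      fix q assume "q \<in> pos ` {x\<in>?X. T x \<le> k}"
      then show "q \<in> {1..\<Lambda> k}" using le_iff pos_range by auto
    next
      fix q assume q: "q \<in> {1..\<Lambda> k}"
      then have "q \<in> pos ` ?X" using mono[OF that] \<Lambda>n surj by simp
      then show "q \<in> pos ` {x\<in>?X. T x \<le> k}" using le_iff q by auto
    qed
    moreover have "inj_on pos {x\<in>?X. T x \<le> k}" using inj by (rule inj_on_subset) auto
    ultimately show ?thesis by (metis card_atLeastAtMost card_image diff_Suc_1)
  qed
  have row_le: "fst x \<le> T x" if x: "x \<in> ?X" for x
  proof (rule ccontr)
    assume n: "\<not> ?thesis"
    obtain i c where ic: "x = (i, c)" by force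
    have i: "i \<in> {1..n}" using fst_in_range[OF \<mu> x] ic by simp
    have "T x \<le> i - 1" using n ic i by simp
    then have "pos x \<le> \<Lambda> (i - 1)" using le_iff[OF x] by blast
    also have "\<dots> \<le> (\<Sum>j=1..i-1. \<mu> j)"
    proof (cases "i = 1")
      case False
      then have "i - 1 \<in> {1..n}" using i by auto
      then show ?thesis using dom unfolding dominated_def \<Lambda>_def by blast
    qed (simp add: \<Lambda>_def)
    finally show False using pos_lower[of i c] x ic by simp
  qed
  have "T \<in> triangular n \<mu> lam"
  proof (rule triangularI)
    show "T x \<in> {1..n}" if "x \<in> ?X" for x
      using row_le[OF that] fst_in_range[OF \<mu> that] le_iff[OF that, of n] pos_range[OF that] \<Lambda>n by simp
    show "T x = 0" if "x \<notin> ?X" for x using that by (simp add: T_def)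
    show "fst x \<le> T x" if "x \<in> ?X" for x using row_le[OF that] .
    fix k assume k: "k \<in> {1..n}"
    have "T x = k \<longleftrightarrow> T x \<le> k \<and> \<not> T x \<le> k - 1" for x using k by auto
    then have eq: "{x\<in>?X. T x = k} = {x\<in>?X. T x \<le> k} - {x\<in>?X. T x \<le> k - 1}" by blast
    have sub: "{x\<in>?X. T x \<le> k - 1} \<subseteq> {x\<in>?X. T x \<le> k}" by auto
    have "card {x\<in>?X. T x = k} = card {x\<in>?X. T x \<le> k} - card {x\<in>?X. T x \<le> k - 1}"
      unfolding eq by (rule card_Diff_subset[OF finite_subset[OF _ fin] sub]) blast
    also have "\<dots> = \<Lambda> k - \<Lambda> (k - 1)"
    proof -
      have "k \<le> n" "k - 1 \<le> n" using k by auto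
      then show ?thesis using count by (simp only:)
    qed
    also have "\<dots> = lam k" using k unfolding \<Lambda>_def by (cases k) auto
    finally show "card {x\<in>?X. T x = k} = lam k" .
  qed
  then show ?thesis by blast
qed

text \<open>
  The exponents of the basis tensor \<open>e\<^sub>1\<^sup>(\<^sup>\<lambda>\<^sup>1\<^sup>) \<otimes> \<cdots> \<otimes> e\<^sub>n\<^sup>(\<^sup>\<lambda>\<^sup>n\<^sup>)\<close> that generates \<open>D(\<lambda>)\<close>.
\<close>

definition diagonal_content :: "nat \<Rightarrow> (nat \<Rightarrow> nat) \<Rightarrow> nat \<Rightarrow> nat \<Rightarrow> nat" where
  "diagonal_content n lam = (\<lambda>j k. if j = k \<and> j \<in> {1..n} then lam j else 0)"

lemma diagonal_content_in_D_basis: "diagonal_content n lam \<in> D_basis n {1..n} lam"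
  by (auto simp: D_basis_def diagonal_content_def split: if_splits)

lemma pair_content_eq_diagonal_iff:
  assumes \<mu>: "\<mu> \<in> compositions n r" and U: "U \<in> triangular n \<mu> lam" and w: "w \<in> tableaux n \<mu>"
  shows "pair_content (diagram \<mu>) U w = diagonal_content n lam \<longleftrightarrow> U = w"
proof
  note tr = triangularD[OF U]
  assume e: "pair_content (diagram \<mu>) U w = diagonal_content n lam"
  show "U = w"
  proof
    fix x show "U x = w x"
    proof (cases "x \<in> diagram \<mu>")
      case True
      have "x \<in> {y\<in>diagram \<mu>. U y = U x \<and> w y = w x}" using True by simp
      then have "card {y\<in>diagram \<mu>. U y = U x \<and> w y = w x} \<noteq> 0"
        using finite_diagram[OF \<mu>] by (intro card_neq_0I) simp_all
      then have "diagonal_content n lam (U x) (w x) \<noteq> 0"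
        unfolding e[symmetric] pair_content_def .
      then show ?thesis by (auto simp: diagonal_content_def split: if_splits)
    next
      case False
      then show ?thesis using tableaux_outside[OF tr(1) False] tableaux_outside[OF w False] by simp
    qed
  qed
next
  note tr = triangularD[OF U]
  assume e: "U = w"
  have "card {x\<in>diagram \<mu>. U x = j \<and> U x = k} = diagonal_content n lam j k" for j k
  proof (cases "j = k \<and> j \<in> {1..n}")
    case True
    then show ?thesis using tr(3)[of j] by (simp add: diagonal_content_def)
  next
    case False
    then have "{x\<in>diagram \<mu>. U x = j \<and> U x = k} = {}" using tableaux_range[OF tr(1)] by auto
    then show ?thesis using False by (auto simp only: card.empty diagonal_content_def if_False)
  qed
  then show "pair_content (diagram \<mu>) U w = diagonal_content n lam"
    unfolding e[symmetric] pair_content_def by (intro ext)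
qed

text \<open>
  The coefficient is the signed number of column permutations \<open>\<sigma>\<close> for which \<open>S \<circ> \<sigma>\<close> is triangular.
  All entries of \<open>S\<close> except the last of each column equal their row number, so such a \<open>\<sigma>\<close> moves
  no cell up and is the identity.
\<close>

lemma psi_diagonal:
  assumes \<mu>: "\<mu> \<in> partitions n r"
    and gap: "row_gap n lam \<mu>"
    and S: "S \<in> SST n lam \<mu>"
  shows "psi n lam \<mu> (\<lambda>B. of_bool (B = diagonal_content n lam)) S = (1::'a::field)"
proof -
  note \<mu>c = partitions_compositions[OF \<mu>]
  have fin: "finite (diagram \<mu>)" by (rule finite_diagram[OF \<mu>c])
  have tri: "S \<in> triangular n \<mu> lam" by (rule SST_triangular[OF \<mu> S])
  have rs: "row_weakly_increasing \<mu> S" and cs: "S \<in> col_tableaux n \<mu>"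
    using S by (auto simp: SST_def RSST_def col_tableaux_def)
  let ?h = "\<lambda>w. \<Sum>U\<in>triangular n \<mu> lam.
      of_bool (pair_content (diagram \<mu>) U w = diagonal_content n lam) :: 'a"
  have h: "?h w = of_bool (w \<in> triangular n \<mu> lam)" if "w \<in> tableaux n \<mu>" for w
  proof -
    have "?h w = (\<Sum>U\<in>triangular n \<mu> lam. if U = w then 1 else 0)"
      using pair_content_eq_diagonal_iff[OF \<mu>c _ that] by (intro sum.cong) auto
    then show ?thesis using finite_triangular[OF \<mu>c] by simp
  qed
  have only_id: "S \<circ> \<sigma> \<notin> triangular n \<mu> lam" if \<sigma>: "\<sigma> \<in> column_perms \<mu>" "\<sigma> \<noteq> id" for \<sigma>
  proof
    assume U: "S \<circ> \<sigma> \<in> triangular n \<mu> lam"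
    note p = column_permsD[OF \<sigma>(1)]
    have down: "fst x \<le> fst (\<sigma> x)" if x: "x \<in> diagram \<mu>" for x
    proof -
      obtain i c where ic: "x = (i, c)" by force
      obtain j where j: "\<sigma> x = (j, c)" using p(2)[of x] ic by (metis prod.collapse snd_conv)
      have jc: "(j, c) \<in> diagram \<mu>" using permutes_in_image[OF p(1), of x] x j by simp
      have le: "i \<le> S (j, c)" using triangularD(2)[OF U x] ic j by simp
      show ?thesis
      proof (cases "(Suc j, c) \<in> diagram \<mu>")
        case True
        have "j \<ge> 1" using jc by (simp add: diagram_def)
        then have "S (j, c) = j" using sorted_triangular_fixed[OF \<mu> gap tri rs _ True] by blast
        then show ?thesis using le ic j by simp
      next
        case False
        have "\<not> Suc j \<le> i"
        proof
          assume "Suc j \<le> i"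
          then have "\<mu> i \<le> \<mu> (Suc j)" by (intro partitions_antimono[OF \<mu>]) auto
          then show False using False x ic by (auto simp: diagram_def)
        qed
        then show ?thesis using ic j by simp
      qed
    qed
    have "\<sigma> x = x" for x
    proof (cases "x \<in> diagram \<mu>")
      case True
      have "fst (\<sigma> x) = fst x"
        by (rule permutes_nondecreasing_imp_invariant[where f = fst, OF p(1) fin _ True]) (rule down)
      then show ?thesis using p(2) by (simp add: prod_eq_iff)
    next
      case False
      then show ?thesis by (rule permutes_not_in[OF p(1)])
    qed
    then have "\<sigma> = id" by (intro ext) simp
    then show False using \<sigma>(2) by simp
  qed
  have "psi n lam \<mu> (\<lambda>B. of_bool (B = diagonal_content n lam)) = wedge n \<mu> ?h"
    by (rule psi_eq_wedge[OF \<mu> gap])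
  then have "psi n lam \<mu> (\<lambda>B. of_bool (B = diagonal_content n lam)) S
      = (\<Sum>\<sigma>\<in>column_perms \<mu>. of_int (sign \<sigma>) * ?h (S \<circ> \<sigma>))"
    using cs by (simp only: wedge_def if_True)
  also have "\<dots> = (\<Sum>\<sigma>\<in>{id}. of_int (sign \<sigma>) * ?h (S \<circ> \<sigma>))"
  proof (rule sum.mono_neutral_right)
    show "\<forall>\<sigma>\<in>column_perms \<mu> - {id}. of_int (sign \<sigma>) * ?h (S \<circ> \<sigma>) = 0"
    proof
      fix \<sigma> assume "\<sigma> \<in> column_perms \<mu> - {id}"
      then have "?h (S \<circ> \<sigma>) = 0"
        using h[OF tableaux_comp[OF col_tableaux_tableaux[OF cs]], of \<sigma>] only_id[of \<sigma>] by simp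
      then show "of_int (sign \<sigma>) * ?h (S \<circ> \<sigma>) = 0" by (simp only: mult_zero_right)
    qed
  qed (use finite_column_perms[OF fin] column_perms_id in auto)
  also have "\<dots> = 1" using h[OF col_tableaux_tableaux[OF cs]] tri by simp
  finally show ?thesis .
qed

section \<open>Equivariance\<close>

definition tensor_act ::
  "nat \<Rightarrow> (nat \<Rightarrow> nat) \<Rightarrow> 'a::field mat \<Rightarrow> ((nat \<times> nat \<Rightarrow> nat) \<Rightarrow> 'a) \<Rightarrow> (nat \<times> nat \<Rightarrow> nat) \<Rightarrow> 'a"
  where
  "tensor_act n \<mu> g h =
     (\<lambda>w. \<Sum>v\<in>tableaux n \<mu>. (\<Prod>x\<in>diagram \<mu>. entry g (w x) (v x)) * h v)"

text \<open>
  Used with signs as weights: the contributions to one value of \<open>f \<circ> h\<close> can be added as integers.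
\<close>

lemma sum_weighted_by_value:
  fixes f :: "'b \<Rightarrow> 'a::comm_ring_1"
  assumes "finite A" and "\<And>\<sigma>. \<sigma> \<in> I \<Longrightarrow> h \<sigma> \<in> A"
  shows "(\<Sum>\<sigma>\<in>I. of_int (e \<sigma>) * f (h \<sigma>)) = (\<Sum>B\<in>A. f B * of_int (\<Sum>\<sigma>\<in>I. e \<sigma> * of_bool (h \<sigma> = B)))"
proof -
  have "(\<Sum>B\<in>A. f B * of_int (\<Sum>\<sigma>\<in>I. e \<sigma> * of_bool (h \<sigma> = B)))
      = (\<Sum>B\<in>A. \<Sum>\<sigma>\<in>I. if h \<sigma> = B then of_int (e \<sigma>) * f B else 0)"
    unfolding of_int_sum sum_distrib_left by (intro sum.cong refl) auto
  also have "\<dots> = (\<Sum>\<sigma>\<in>I. \<Sum>B\<in>A. if h \<sigma> = B then of_int (e \<sigma>) * f B else 0)" by (rule sum.swap)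
  also have "\<dots> = (\<Sum>\<sigma>\<in>I. of_int (e \<sigma>) * f (h \<sigma>))"
  proof (rule sum.cong[OF refl])
    fix \<sigma> assume "\<sigma> \<in> I"
    then show "(\<Sum>B\<in>A. if h \<sigma> = B then of_int (e \<sigma>) * f B else 0) = of_int (e \<sigma>) * f (h \<sigma>)"
      using assms by (simp add: sum.delta')
  qed
  finally show ?thesis ..
qed

text \<open>
  The sum equals its negative, which in characteristic 2 proves nothing; so for each value of \<open>F\<close>
  the signs are summed in the integers.
\<close>

lemma sum_sign_invariant_eq_0:
  fixes F :: "(nat \<times> nat \<Rightarrow> nat \<times> nat) \<Rightarrow> 'a::comm_ring_1"
  assumes fin: "finite (diagram \<mu>)" and xy: "x \<in> diagram \<mu>" "y \<in> diagram \<mu>" "snd x = snd y" "x \<noteq> y"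
    and F: "\<And>\<rho>. \<rho> \<in> column_perms \<mu> \<Longrightarrow> F (\<rho> \<circ> transpose x y) = F \<rho>"
  shows "(\<Sum>\<rho>\<in>column_perms \<mu>. of_int (sign \<rho>) * F \<rho>) = 0"
proof -
  let ?CP = "column_perms \<mu>" and ?\<tau> = "transpose x y"
  have \<tau>: "?\<tau> \<in> ?CP" by (rule column_perms_transpose[OF xy(1-3)])
  have "(\<Sum>\<rho>\<in>?CP. sign \<rho> * of_bool (F \<rho> = B)) = 0" for B
  proof -
    have "(\<Sum>\<rho>\<in>?CP. sign \<rho> * of_bool (F \<rho> = B))
        = (\<Sum>\<rho>\<in>?CP. sign (\<rho> \<circ> ?\<tau>) * of_bool (F (\<rho> \<circ> ?\<tau>) = B))"
      by (rule sum_column_perms_comp[OF \<tau>, symmetric])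
    also have "\<dots> = (\<Sum>\<rho>\<in>?CP. - (sign \<rho> * of_bool (F \<rho> = B)))"
      by (rule sum.cong[OF refl])
        (simp add: sign_column_perms_comp[OF fin _ \<tau>] F sign_swap_id xy(4))
    finally show ?thesis by (simp add: sum_negf)
  qed
  then show ?thesis
    using sum_weighted_by_value[of "F ` ?CP" ?CP F sign "\<lambda>a. a"] finite_column_perms[OF fin] by simp
qed

lemma bij_betw_column_sorting:
  assumes \<mu>: "\<mu> \<in> compositions n r"
  shows "bij_betw (\<lambda>(T, \<sigma>). T \<circ> \<sigma>) (col_tableaux n \<mu> \<times> column_perms \<mu>)
           {w\<in>tableaux n \<mu>. column_injective \<mu> w}"
proof -
  have fin: "finite (diagram \<mu>)" by (rule finite_diagram[OF \<mu>])
  have cs: "column_strict \<mu> T" if "T \<in> col_tableaux n \<mu>" for T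
    using that by (simp add: col_tableaux_def)
  have inv_o: "\<sigma> \<circ> Hilbert_Choice.inv \<sigma> = id" "Hilbert_Choice.inv \<sigma> \<circ> \<sigma> = id"
    if "\<sigma> \<in> column_perms \<mu>" for \<sigma>
    using permutes_inv_o[OF column_permsD(1)[OF that]] by auto
  show ?thesis
    unfolding bij_betw_def
  proof
    show "inj_on (\<lambda>(T, \<sigma>). T \<circ> \<sigma>) (col_tableaux n \<mu> \<times> column_perms \<mu>)"
    proof (rule inj_onI, clarify)
      fix T \<sigma> T' \<sigma>'
      assume a: "T \<in> col_tableaux n \<mu>" "\<sigma> \<in> column_perms \<mu>" "T' \<in> col_tableaux n \<mu>"
        "\<sigma>' \<in> column_perms \<mu>" "T \<circ> \<sigma> = T' \<circ> \<sigma>'"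
      let ?\<rho> = "\<sigma>' \<circ> Hilbert_Choice.inv \<sigma>"
      have \<rho>: "?\<rho> \<in> column_perms \<mu>" by (rule column_perms_comp[OF a(4) column_perms_inv[OF a(2)]])
      have "T' \<circ> ?\<rho> = T \<circ> \<sigma> \<circ> Hilbert_Choice.inv \<sigma>" by (simp only: a(5) comp_assoc)
      also have "\<dots> = T" using inv_o[OF a(2)] by (simp only: comp_assoc comp_id)
      finally have T: "T' \<circ> ?\<rho> = T" .
      have "?\<rho> = id"
        by (rule column_sort_unique[OF fin cs[OF a(3)] \<rho>]) (simp only: T cs[OF a(1)])
      then have "?\<rho> \<circ> \<sigma> = \<sigma>" by simp
      then have "\<sigma>' = \<sigma>" using inv_o[OF a(2)] by (simp only: comp_assoc comp_id)
      moreover have "T = T'" using T \<open>?\<rho> = id\<close> by simp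
      ultimately show "T = T' \<and> \<sigma> = \<sigma>'" by simp
    qed
    show "(\<lambda>(T, \<sigma>). T \<circ> \<sigma>) ` (col_tableaux n \<mu> \<times> column_perms \<mu>)
        = {w\<in>tableaux n \<mu>. column_injective \<mu> w}"
    proof (intro equalityI subsetI)
      fix w assume "w \<in> (\<lambda>(T, \<sigma>). T \<circ> \<sigma>) ` (col_tableaux n \<mu> \<times> column_perms \<mu>)"
      then obtain T \<sigma> where w: "T \<in> col_tableaux n \<mu>" "\<sigma> \<in> column_perms \<mu>" "w = T \<circ> \<sigma>" by auto
      show "w \<in> {w\<in>tableaux n \<mu>. column_injective \<mu> w}"
        using tableaux_comp[OF col_tableaux_tableaux[OF w(1)] w(2)]
          column_injective_comp[OF column_strict_imp_injective[OF cs[OF w(1)]] w(2)] w(3) by simp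
    next
      fix w assume w: "w \<in> {w\<in>tableaux n \<mu>. column_injective \<mu> w}"
      then obtain \<tau> where \<tau>: "\<tau> \<in> column_perms \<mu>" "column_strict \<mu> (w \<circ> \<tau>)"
        using ex_column_sort[OF fin] by blast
      have "w \<circ> \<tau> \<in> col_tableaux n \<mu>"
        using tableaux_comp[OF _ \<tau>(1), of w] w \<tau>(2) by (simp add: col_tableaux_def)
      moreover have "w = w \<circ> \<tau> \<circ> Hilbert_Choice.inv \<tau>"
        using inv_o[OF \<tau>(1)] by (simp only: comp_assoc comp_id)
      ultimately show "w \<in> (\<lambda>(T, \<sigma>). T \<circ> \<sigma>) ` (col_tableaux n \<mu> \<times> column_perms \<mu>)"
        using column_perms_inv[OF \<tau>(1)]
        by (intro image_eqI[of _ _ "(w \<circ> \<tau>, Hilbert_Choice.inv \<tau>)"]) auto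
    qed
  qed
qed

text \<open>
  Expand the right hand side over words.  Words with a repeated entry in a column contribute minors
  with two equal columns, and each other word is \<open>T \<circ> \<sigma>\<close> for a unique column strict \<open>T\<close> and a unique
  column permutation \<open>\<sigma>\<close>.
\<close>

lemma weyl_act_wedge:
  fixes g :: "'a::field mat"
  assumes \<mu>: "\<mu> \<in> compositions n r"
  shows "weyl_act n \<mu> g (wedge n \<mu> h) = wedge n \<mu> (tensor_act n \<mu> g h)"
proof
  fix S
  have fin: "finite (diagram \<mu>)" by (rule finite_diagram[OF \<mu>])
  let ?CP = "column_perms \<mu>" and ?CT = "col_tableaux n \<mu>"
  let ?G = "\<lambda>w v. \<Prod>x\<in>diagram \<mu>. entry g (w x) (v x)"
  let ?K = "\<lambda>v. \<Sum>\<rho>\<in>?CP. of_int (sign \<rho>) * ?G (S \<circ> \<rho>) v"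
  have G: "?G (w \<circ> \<sigma>) (v \<circ> \<sigma>) = ?G w v" if "\<sigma> \<in> ?CP" for w v \<sigma>
    using prod.permute[OF column_permsD(1)[OF that], of "\<lambda>x. entry g (w x) (v x)"]
    by (simp add: comp_def)
  have K_comp: "?K (v \<circ> \<sigma>) = of_int (sign \<sigma>) * ?K v" if \<sigma>: "\<sigma> \<in> ?CP" for v \<sigma>
  proof -
    have "?K (v \<circ> \<sigma>) = (\<Sum>\<rho>\<in>?CP. of_int (sign (\<rho> \<circ> \<sigma>)) * ?G (S \<circ> (\<rho> \<circ> \<sigma>)) (v \<circ> \<sigma>))"
      by (rule sum_column_perms_comp[OF \<sigma>, symmetric])
    also have "\<dots> = (\<Sum>\<rho>\<in>?CP. of_int (sign \<sigma>) * (of_int (sign \<rho>) * ?G (S \<circ> \<rho>) v))"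
    proof (rule sum.cong[OF refl])
      fix \<rho> assume \<rho>: "\<rho> \<in> ?CP"
      have "?G (S \<circ> (\<rho> \<circ> \<sigma>)) (v \<circ> \<sigma>) = ?G (S \<circ> \<rho>) v"
        using G[OF \<sigma>, of "S \<circ> \<rho>" v] by (simp only: comp_assoc)
      then show "of_int (sign (\<rho> \<circ> \<sigma>)) * ?G (S \<circ> (\<rho> \<circ> \<sigma>)) (v \<circ> \<sigma>)
          = of_int (sign \<sigma>) * (of_int (sign \<rho>) * ?G (S \<circ> \<rho>) v)"
        by (simp only: sign_column_perms_comp[OF fin \<rho> \<sigma>] of_int_mult mult_ac)
    qed
    finally show ?thesis by (simp only: sum_distrib_left)
  qed
  have K_0: "?K v = 0" if ninj: "\<not> column_injective \<mu> v" for v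
  proof -
    obtain x y where xy: "x \<in> diagram \<mu>" "y \<in> diagram \<mu>" "snd x = snd y" "v x = v y" "x \<noteq> y"
      using ninj unfolding column_injective_def by blast
    have \<tau>: "transpose x y \<in> ?CP" by (rule column_perms_transpose[OF xy(1-3)])
    have v: "v \<circ> transpose x y = v" using xy(4) by (auto simp: transpose_def)
    show ?thesis
    proof (rule sum_sign_invariant_eq_0[OF fin xy(1-3,5)])
      fix \<rho> assume "\<rho> \<in> ?CP"
      show "?G (S \<circ> (\<rho> \<circ> transpose x y)) v = ?G (S \<circ> \<rho>) v"
        using G[OF \<tau>, of "S \<circ> \<rho>" v] unfolding v by (simp only: comp_assoc)
    qed
  qed
  show "weyl_act n \<mu> g (wedge n \<mu> h) S = wedge n \<mu> (tensor_act n \<mu> g h) S"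
  proof (cases "S \<in> ?CT")
    case False
    then show ?thesis by (simp add: weyl_act_def wedge_def)
  next
    case True
    have "wedge n \<mu> (tensor_act n \<mu> g h) S
        = (\<Sum>\<rho>\<in>?CP. \<Sum>v\<in>tableaux n \<mu>. of_int (sign \<rho>) * (?G (S \<circ> \<rho>) v * h v))"
      using True by (simp only: wedge_def tensor_act_def if_True sum_distrib_left)
    also have "\<dots> = (\<Sum>v\<in>tableaux n \<mu>. \<Sum>\<rho>\<in>?CP. of_int (sign \<rho>) * (?G (S \<circ> \<rho>) v * h v))"
      by (rule sum.swap)
    also have "\<dots> = (\<Sum>v\<in>tableaux n \<mu>. h v * ?K v)"
      unfolding sum_distrib_left by (intro sum.cong refl) (simp only: mult_ac)
    also have "\<dots> = (\<Sum>v\<in>{v\<in>tableaux n \<mu>. column_injective \<mu> v}. h v * ?K v)"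
      by (rule sum.mono_neutral_right) (use finite_tableaux[OF \<mu>] K_0 in auto)
    also have "\<dots> = (\<Sum>q\<in>?CT \<times> ?CP. h (case q of (T, \<sigma>) \<Rightarrow> T \<circ> \<sigma>) * ?K (case q of (T, \<sigma>) \<Rightarrow> T \<circ> \<sigma>))"
      by (rule sum.reindex_bij_betw[OF bij_betw_column_sorting[OF \<mu>], symmetric])
    also have "\<dots> = (\<Sum>T\<in>?CT. \<Sum>\<sigma>\<in>?CP. h (T \<circ> \<sigma>) * ?K (T \<circ> \<sigma>))"
      unfolding sum.cartesian_product by (rule sum.cong) auto
    also have "\<dots> = (\<Sum>T\<in>?CT. \<Sum>\<sigma>\<in>?CP. (of_int (sign \<sigma>) * h (T \<circ> \<sigma>)) * ?K T)"
      by (intro sum.cong refl) (simp only: K_comp mult_ac)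
    also have "\<dots> = (\<Sum>T\<in>?CT. wedge n \<mu> h T * ?K T)"
      unfolding sum_distrib_right[symmetric] by (rule sum.cong) (simp_all only: wedge_def if_True)
    also have "\<dots> = weyl_act n \<mu> g (wedge n \<mu> h) S"
      unfolding weyl_act_def
      by (rule sum.cong) (use True in \<open>simp_all only: wedge_def if_True\<close>)
    finally show ?thesis ..
  qed
qed

text \<open>
  \<open>D(\<lambda>)\<close> is identified with the tensors that are symmetric in each row by \<open>polarize\<close>, so the value at
  \<open>B\<close> is the value of the transformed tensor at any word with row contents \<open>B\<close>.
\<close>

definition D_act ::
  "nat \<Rightarrow> (nat \<Rightarrow> nat) \<Rightarrow> 'a::field mat \<Rightarrow> ((nat \<Rightarrow> nat \<Rightarrow> nat) \<Rightarrow> 'a) \<Rightarrow> (nat \<Rightarrow> nat \<Rightarrow> nat) \<Rightarrow> 'a"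
  where
  "D_act n lam g f = (\<lambda>B. if B \<in> D_basis n {1..n} lam
     then tensor_act n lam g (polarize lam f) (SOME w. w \<in> tableaux n lam \<and> row_content lam w = B)
     else 0)"

text \<open>
  A bijection from the diagram of \<open>lam\<close> to that of \<open>\<mu>\<close> that matches rows with the values of \<open>U\<close>, and
  the chosen word with \<open>w\<close>, turns one sum over words into the other.
\<close>

lemma D_act_pair_content:
  fixes g :: "'a::field mat"
  assumes lam: "lam \<in> compositions n r" and fin: "finite (diagram \<mu>)"
    and U: "\<And>x. x \<in> diagram \<mu> \<Longrightarrow> U x \<in> {1..n}"
      "\<And>k. k \<in> {1..n} \<Longrightarrow> card {x\<in>diagram \<mu>. U x = k} = lam k"
    and w: "w \<in> tableaux n \<mu>"
  shows "D_act n lam g f (pair_content (diagram \<mu>) U w)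
       = tensor_act n \<mu> g (\<lambda>v. f (pair_content (diagram \<mu>) U v)) w"
proof -
  let ?Y = "diagram \<mu>" and ?X = "diagram lam"
  let ?B = "pair_content ?Y U w"
  have B: "?B \<in> D_basis n {1..n} lam"
    by (rule pair_content_in_D_basis) (use fin U tableaux_range[OF w] in auto)
  define wB where "wB = (SOME w. w \<in> tableaux n lam \<and> row_content lam w = ?B)"
  have "\<exists>w. w \<in> tableaux n lam \<and> row_content lam w = ?B"
    using ex_row_sorted_tableau[OF lam B] by blast
  then have wB: "wB \<in> tableaux n lam" "row_content lam wB = ?B"
    unfolding wB_def by (metis (mono_tags, lifting) someI_ex)+
  have "card {x\<in>?X. (fst x, wB x) = a} = card {y\<in>?Y. (U y, w y) = a}" for a
  proof (cases a)
    case (Pair j k)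
    then show ?thesis
      using fun_cong[OF fun_cong[OF wB(2), of j], of k]
      by (simp add: row_content_eq_pair_content pair_content_def)
  qed
  then obtain \<beta> where \<beta>: "bij_betw \<beta> ?X ?Y" "\<And>x. x \<in> ?X \<Longrightarrow> (U (\<beta> x), w (\<beta> x)) = (fst x, wB x)"
    using bij_betw_of_equal_fibres[OF finite_diagram[OF lam] fin,
        of "\<lambda>x. (fst x, wB x)" "\<lambda>y. (U y, w y)"] by blast
  let ?\<beta>' = "inv_into ?X \<beta>"
  have \<beta>': "\<And>y. y \<in> ?Y \<Longrightarrow> ?\<beta>' y \<in> ?X \<and> \<beta> (?\<beta>' y) = y" "\<And>x. x \<in> ?X \<Longrightarrow> \<beta> x \<in> ?Y \<and> ?\<beta>' (\<beta> x) = x"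
    using \<beta>(1) bij_betw_inv_into_right[OF \<beta>(1)] bij_betw_inv_into_left[OF \<beta>(1)]
      bij_betwE[OF bij_betw_inv_into[OF \<beta>(1)]] bij_betwE[OF \<beta>(1)] by auto
  have "D_act n lam g f ?B = (\<Sum>v\<in>tableaux n lam. (\<Prod>x\<in>?X. entry g (wB x) (v x)) * f (row_content lam v))"
    using B by (simp only: D_act_def if_True wB_def[symmetric] tensor_act_def polarize_def)
  also have "\<dots> = (\<Sum>v\<in>tableaux n \<mu>. (\<Prod>y\<in>?Y. entry g (w y) (v y)) * f (pair_content ?Y U v))"
  proof (rule sum.reindex_bij_witness[where i = "\<lambda>v x. if x \<in> ?X then v (\<beta> x) else 0"
        and j = "\<lambda>v y. if y \<in> ?Y then v (?\<beta>' y) else 0"])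
    fix v assume v: "v \<in> tableaux n lam"
    let ?v = "\<lambda>y. if y \<in> ?Y then v (?\<beta>' y) else 0"
    show "(\<lambda>x. if x \<in> ?X then ?v (\<beta> x) else 0) = v"
      using \<beta>'(2) tableaux_outside[OF v] by (intro ext) simp
    show "?v \<in> tableaux n \<mu>"
      unfolding tableaux_def
    proof (rule CollectI, intro conjI ballI allI impI)
      show "?v y \<in> {1..n}" if "y \<in> ?Y" for y
        using \<beta>'(1)[OF that] tableaux_range[OF v, of "?\<beta>' y"] that by simp
    qed simp
    have "(\<Prod>y\<in>?Y. entry g (w y) (?v y)) = (\<Prod>x\<in>?X. entry g (w (\<beta> x)) (?v (\<beta> x)))"
      by (rule prod.reindex_bij_betw[OF \<beta>(1), symmetric])
    also have "\<dots> = (\<Prod>x\<in>?X. entry g (wB x) (v x))"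
      by (rule prod.cong) (use \<beta>(2) \<beta>'(2) in auto)
    finally have "(\<Prod>y\<in>?Y. entry g (w y) (?v y)) = (\<Prod>x\<in>?X. entry g (wB x) (v x))" .
    moreover have "pair_content ?Y U ?v = row_content lam v"
      unfolding pair_content_bij[OF \<beta>(1), symmetric] row_content_eq_pair_content
      by (rule pair_content_cong) (use \<beta>(2) \<beta>'(2) in auto)
    ultimately show "(\<Prod>y\<in>?Y. entry g (w y) (?v y)) * f (pair_content ?Y U ?v)
        = (\<Prod>x\<in>?X. entry g (wB x) (v x)) * f (row_content lam v)" by simp
  next
    fix v assume v: "v \<in> tableaux n \<mu>"
    let ?v = "\<lambda>x. if x \<in> ?X then v (\<beta> x) else 0"
    show "(\<lambda>y. if y \<in> ?Y then ?v (?\<beta>' y) else 0) = v"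
      using \<beta>'(1) tableaux_outside[OF v] by (intro ext) simp
    show "?v \<in> tableaux n lam"
      unfolding tableaux_def
    proof (rule CollectI, intro conjI ballI allI impI)
      show "?v x \<in> {1..n}" if "x \<in> ?X" for x
        using \<beta>'(2)[OF that] tableaux_range[OF v, of "\<beta> x"] that by simp
    qed simp
  qed
  finally show ?thesis by (simp only: tensor_act_def)
qed

lemma tensor_act_sum:
  "tensor_act n \<mu> g (\<lambda>v. \<Sum>i\<in>I. h i v) w = (\<Sum>i\<in>I. tensor_act n \<mu> g (h i) w)"
  unfolding tensor_act_def sum_distrib_left by (rule sum.swap)

lemma weyl_act_weyl_proj:
  assumes lam: "lam \<in> compositions n r"
  shows "weyl_act n lam g (weyl_proj n lam f) = weyl_proj n lam (D_act n lam g f)"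
  unfolding weyl_proj_def weyl_act_wedge[OF lam]
proof (rule wedge_cong)
  fix w assume w: "w \<in> tableaux n lam"
  have "D_act n lam g f (pair_content (diagram lam) fst w)
      = tensor_act n lam g (\<lambda>v. f (pair_content (diagram lam) fst v)) w"
    by (rule D_act_pair_content[OF lam finite_diagram[OF lam] fst_in_range[OF lam] _ w])
      (auto simp: card_row)
  then show "tensor_act n lam g (polarize lam f) w = polarize lam (D_act n lam g f) w"
    by (simp only: polarize_def row_content_eq_pair_content)
qed

lemma weyl_act_triangular_wedge:
  assumes lam: "lam \<in> compositions n r" and \<mu>: "\<mu> \<in> compositions n r"
  shows "weyl_act n \<mu> g (wedge n \<mu> (\<lambda>w. \<Sum>U\<in>triangular n \<mu> lam. f (pair_content (diagram \<mu>) U w)))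
       = wedge n \<mu> (\<lambda>w. \<Sum>U\<in>triangular n \<mu> lam. D_act n lam g f (pair_content (diagram \<mu>) U w))"
  unfolding weyl_act_wedge[OF \<mu>]
proof (rule wedge_cong)
  fix w assume w: "w \<in> tableaux n \<mu>"
  show "tensor_act n \<mu> g (\<lambda>w. \<Sum>U\<in>triangular n \<mu> lam. f (pair_content (diagram \<mu>) U w)) w
      = (\<Sum>U\<in>triangular n \<mu> lam. D_act n lam g f (pair_content (diagram \<mu>) U w))"
    unfolding tensor_act_sum
  proof (rule sum.cong[OF refl])
    fix U assume U: "U \<in> triangular n \<mu> lam"
    show "tensor_act n \<mu> g (\<lambda>w. f (pair_content (diagram \<mu>) U w)) w
        = D_act n lam g f (pair_content (diagram \<mu>) U w)"
      by (rule D_act_pair_content[OF lam finite_diagram[OF \<mu>] tableaux_range[OF triangularD(1)[OF U]]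
            triangularD(3)[OF U] w, symmetric])
  qed
qed

section \<open>The homomorphism\<close>

lemma wedge_pair_content_eq_sum_alternant:
  fixes f :: "(nat \<Rightarrow> nat \<Rightarrow> nat) \<Rightarrow> 'a::field"
  assumes S: "S \<in> col_tableaux n \<mu>" and fin: "finite (diagram \<mu>)"
    and U: "\<And>x. x \<in> diagram \<mu> \<Longrightarrow> U x \<in> {1..n}"
      "\<And>k. k \<in> {1..n} \<Longrightarrow> card {x\<in>diagram \<mu>. U x = k} = lam k"
  shows "wedge n \<mu> (\<lambda>w. f (pair_content (diagram \<mu>) U w)) S
       = (\<Sum>B\<in>D_basis n {1..n} lam. f B * of_int (alternant \<mu> S B U))"
proof -
  have "pair_content (diagram \<mu>) U (S \<circ> \<sigma>) \<in> D_basis n {1..n} lam" if "\<sigma> \<in> column_perms \<mu>" for \<sigma>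
    by (rule pair_content_in_D_basis)
      (use fin U tableaux_range[OF tableaux_comp[OF col_tableaux_tableaux[OF S] that]] in auto)
  then show ?thesis
    using S unfolding wedge_def alternant_def
    by (simp only: if_True) (rule sum_weighted_by_value, simp_all add: finite_D_basis)
qed

text \<open>
  The coefficients \<open>c S\<close> express \<open>P\<^sub>S\<close> by bideterminants.
\<close>

lemma psi_factors_through_weyl_proj:
  fixes p :: nat
  assumes char: "CHAR('a::field) = p"
    and lam: "lam \<in> partitions n r" and \<mu>: "\<mu> \<in> partitions n r"
    and gap: "row_gap n lam \<mu>"
    and le: "\<And>s. s \<in> {1..<n} \<Longrightarrow> \<mu> (Suc s) \<le> lam s"
    and dvd: "\<And>s t. \<lbrakk>s \<in> {1..<n}; 1 \<le> t; t \<le> lam (Suc s);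
               (\<Sum>i=1..s. lam i) + t \<le> (\<Sum>i=1..s. \<mu> i)\<rbrakk> \<Longrightarrow>
               p dvd ((lam s - \<mu> (Suc s) + t) choose t)"
  shows "\<exists>c. \<forall>f :: (nat \<Rightarrow> nat \<Rightarrow> nat) \<Rightarrow> 'a. \<forall>S.
           psi n lam \<mu> f S = (\<Sum>S'\<in>col_tableaux n lam. c S S' * weyl_proj n lam f S')"
proof -
  note lamc = partitions_compositions[OF lam] and \<mu>c = partitions_compositions[OF \<mu>]
  have fin: "finite (diagram \<mu>)" "finite (diagram lam)"
    by (rule finite_diagram[OF \<mu>c], rule finite_diagram[OF lamc])
  let ?D = "D_basis n {1..n} lam"
  let ?P = "\<lambda>S B. of_int (\<Sum>U\<in>triangular n \<mu> lam. alternant \<mu> S B U) :: 'a"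
  have psi: "psi n lam \<mu> f S = (\<Sum>B\<in>?D. f B * ?P S B)"
    if S: "S \<in> col_tableaux n \<mu>" for f S
  proof -
    have "psi n lam \<mu> f
        = wedge n \<mu> (\<lambda>w. \<Sum>U\<in>triangular n \<mu> lam. f (pair_content (diagram \<mu>) U w))"
      by (rule psi_eq_wedge[OF \<mu> gap])
    then have "psi n lam \<mu> f S
        = (\<Sum>U\<in>triangular n \<mu> lam. wedge n \<mu> (\<lambda>w. f (pair_content (diagram \<mu>) U w)) S)"
      by (simp only: wedge_sum)
    also have "\<dots> = (\<Sum>U\<in>triangular n \<mu> lam. \<Sum>B\<in>?D. f B * of_int (alternant \<mu> S B U))"
    proof (rule sum.cong[OF refl])
      fix U assume U: "U \<in> triangular n \<mu> lam"
      show "wedge n \<mu> (\<lambda>w. f (pair_content (diagram \<mu>) U w)) S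
          = (\<Sum>B\<in>?D. f B * of_int (alternant \<mu> S B U))"
        by (rule wedge_pair_content_eq_sum_alternant[OF S fin(1)
              tableaux_range[OF triangularD(1)[OF U]] triangularD(3)[OF U]])
    qed
    also have "\<dots> = (\<Sum>B\<in>?D. f B * ?P S B)"
      unfolding of_int_sum sum_distrib_left by (rule sum.swap)
    finally show ?thesis .
  qed
  have proj: "weyl_proj n lam f S' = (\<Sum>B\<in>?D. f B * of_int (alternant lam S' B fst))"
    if "S' \<in> col_tableaux n lam" for f :: "(nat \<Rightarrow> nat \<Rightarrow> nat) \<Rightarrow> 'a" and S'
    unfolding weyl_proj_def polarize_def row_content_eq_pair_content
    by (rule wedge_pair_content_eq_sum_alternant[OF that fin(2) fst_in_range[OF lamc]])
      (auto simp: card_row)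
  have "\<exists>c. \<forall>B. ?P S B = (\<Sum>S'\<in>col_tableaux n lam. c S' * of_int (alternant lam S' B fst))"
    if S: "S \<in> col_tableaux n \<mu>" for S
  proof (rule invariants_spanned_by_bideterminants[OF lam])
    note ST = col_tableaux_tableaux[OF S]
    show "B \<in> ?D" if nz: "?P S B \<noteq> 0" for B
    proof -
      have "(\<Sum>U\<in>triangular n \<mu> lam. alternant \<mu> S B U) \<noteq> 0" using nz by (metis of_int_0)
      then obtain U where U: "U \<in> triangular n \<mu> lam" "alternant \<mu> S B U \<noteq> 0"
        by (rule sum.not_neutral_contains_not_neutral)
      obtain \<sigma> where \<sigma>: "\<sigma> \<in> column_perms \<mu>"
          "sign \<sigma> * of_bool (pair_content (diagram \<mu>) U (S \<circ> \<sigma>) = B) \<noteq> 0"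
        using U(2) unfolding alternant_def by (rule sum.not_neutral_contains_not_neutral)
      have "pair_content (diagram \<mu>) U (S \<circ> \<sigma>) \<in> ?D"
        by (rule pair_content_in_D_basis[OF fin(1) tableaux_range[OF triangularD(1)[OF U(1)]]
              tableaux_range[OF tableaux_comp[OF ST \<sigma>(1)]] triangularD(3)[OF U(1)]])
      moreover have "pair_content (diagram \<mu>) U (S \<circ> \<sigma>) = B" using \<sigma>(2) by auto
      ultimately show ?thesis by simp
    qed
    show "row_raise n s t (?P S) M = 0" if st: "s \<in> {1..<n}" "t \<ge> 1" for s t M
      by (rule triangular_sum_invariant[where lam = lam, OF char \<mu> ST st le[OF st(1)]]) (rule dvd[OF st])
  qed
  then have "\<exists>c. \<forall>S\<in>col_tableaux n \<mu>. \<forall>B.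
      ?P S B = (\<Sum>S'\<in>col_tableaux n lam. c S S' * of_int (alternant lam S' B fst))"
    by (intro bchoice ballI)
  then obtain c where c: "\<And>S B. S \<in> col_tableaux n \<mu> \<Longrightarrow>
      ?P S B = (\<Sum>S'\<in>col_tableaux n lam. c S S' * of_int (alternant lam S' B fst))" by blast
  let ?c = "\<lambda>S S'. if S \<in> col_tableaux n \<mu> then c S S' else 0"
  have factor: "psi n lam \<mu> f S = (\<Sum>S'\<in>col_tableaux n lam. ?c S S' * weyl_proj n lam f S')"
    for f S
  proof (cases "S \<in> col_tableaux n \<mu>")
    case False
    have "psi n lam \<mu> f S = 0"
      unfolding psi_def phi_def weyl_proj_def wedge_def using False by simp
    then show ?thesis using False by simp
  next
    case True
    have "psi n lam \<mu> f S
        = (\<Sum>B\<in>?D. \<Sum>S'\<in>col_tableaux n lam. f B * (c S S' * of_int (alternant lam S' B fst)))"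
      unfolding psi[OF True] by (intro sum.cong refl) (simp only: c[OF True] sum_distrib_left)
    also have "\<dots> = (\<Sum>S'\<in>col_tableaux n lam. \<Sum>B\<in>?D.
        f B * (c S S' * of_int (alternant lam S' B fst)))" by (rule sum.swap)
    also have "\<dots> = (\<Sum>S'\<in>col_tableaux n lam. ?c S S' * weyl_proj n lam f S')"
    proof (rule sum.cong[OF refl])
      fix S' assume S': "S' \<in> col_tableaux n lam"
      show "(\<Sum>B\<in>?D. f B * (c S S' * of_int (alternant lam S' B fst))) = ?c S S' * weyl_proj n lam f S'"
        unfolding proj[OF S'] using True
        by (simp only: if_True sum_distrib_left) (intro sum.cong refl, simp only: mult_ac)
    qed
    finally show ?thesis .
  qed
  show ?thesis by (rule exI[of _ ?c], intro allI, rule factor)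
qed

lemma psi_in_weyl:
  fixes f :: "(nat \<Rightarrow> nat \<Rightarrow> nat) \<Rightarrow> 'a::field"
  assumes \<mu>: "\<mu> \<in> compositions n r"
  shows "psi n lam \<mu> f \<in> weyl n \<mu>"
proof -
  let ?h = "\<lambda>T. D_mult n {1..n} {1..n}
         (D_comult n {1..n} {1..n} (\<lambda>(i, j). row_content \<mu> T i j) f)"
  let ?F = "\<lambda>C. if C \<in> D_basis n {1..n} \<mu> then \<Sum>T\<in>SST n lam \<mu>. ?h T C else 0"
  have "psi n lam \<mu> f S = wedge n \<mu> (\<lambda>w. \<Sum>T\<in>SST n lam \<mu>. polarize \<mu> (?h T) w) S" for S
    unfolding psi_def phi_def weyl_proj_def by (rule wedge_sum[symmetric])
  then have "psi n lam \<mu> f = wedge n \<mu> (\<lambda>w. \<Sum>T\<in>SST n lam \<mu>. polarize \<mu> (?h T) w)" by (intro ext)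
  also have "\<dots> = weyl_proj n \<mu> ?F"
    unfolding weyl_proj_def
  proof (rule wedge_cong)
    fix w assume w: "w \<in> tableaux n \<mu>"
    have "row_content \<mu> w \<in> D_basis n {1..n} \<mu>"
      by (rule row_content_in_D_basis[OF \<mu> tableaux_range[OF w]])
    then show "(\<Sum>T\<in>SST n lam \<mu>. polarize \<mu> (?h T) w) = polarize \<mu> ?F w"
      by (simp only: polarize_def if_True)
  qed
  finally have eq: "psi n lam \<mu> f = weyl_proj n \<mu> ?F" .
  have "?F \<in> D n \<mu>"
    unfolding D_space_def
  proof (rule CollectI, intro allI impI)
    fix B assume nz: "?F B \<noteq> 0"
    show "B \<in> D_basis n {1..n} \<mu>"
    proof (rule ccontr)
      assume "B \<notin> D_basis n {1..n} \<mu>"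
      then have "?F B = 0" by (simp only: if_False)
      with nz show False by (rule notE)
    qed
  qed
  then show ?thesis unfolding weyl_def eq by (rule imageI)
qed

lemma partition_nonzero_iff_le_len:
  assumes \<mu>: "\<mu> \<in> partitions n r" and i: "i \<in> {1..n}"
  shows "\<mu> i \<noteq> 0 \<longleftrightarrow> i \<le> len n \<mu>"
proof
  assume nz: "\<mu> i \<noteq> 0"
  have "{1..i} \<subseteq> {i\<in>{1..n}. \<mu> i \<noteq> 0}"
  proof
    fix j assume j: "j \<in> {1..i}"
    then have "\<mu> i \<le> \<mu> j" by (intro partitions_antimono[OF \<mu>]) auto
    then show "j \<in> {i\<in>{1..n}. \<mu> i \<noteq> 0}" using nz i j by auto
  qed
  then have "card {1..i} \<le> len n \<mu>" unfolding len_def by (intro card_mono) auto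
  then show "i \<le> len n \<mu>" by simp
next
  assume le: "i \<le> len n \<mu>"
  show "\<mu> i \<noteq> 0"
  proof
    assume z: "\<mu> i = 0"
    have "{i\<in>{1..n}. \<mu> i \<noteq> 0} \<subseteq> {1..<i}"
    proof
      fix j assume j: "j \<in> {i\<in>{1..n}. \<mu> i \<noteq> 0}"
      have "\<not> i \<le> j"
      proof
        assume "i \<le> j"
        then have "\<mu> j \<le> \<mu> i" using i by (intro partitions_antimono[OF \<mu>]) auto
        then show False using z j by simp
      qed
      then show "j \<in> {1..<i}" using j by auto
    qed
    then have "len n \<mu> \<le> card {1..<i}" unfolding len_def by (intro card_mono) auto
    then show False using le i by auto
  qed
qed

theorem theorem5p2:
  fixes n r p m :: nat and lam \<mu> :: "nat \<Rightarrow> nat"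
  assumes "infinite (UNIV :: 'a::field set)"
    and "p > 0" and "CHAR('a) = p"
    and "r > 0"
    and "lam \<in> partitions n r" and "\<mu> \<in> partitions n r"
    and "dominated n lam \<mu>" and "lam \<in> Pset n r \<mu>"
    and "m = len n \<mu>"
    and "\<forall>s\<in>{1..m-2}.
           int (p ^ lp p (nat (cdiff lam \<mu> s))) dvd int (lam s) - int (\<mu> (s+1)) + 1"
    and "m \<ge> 2 \<longrightarrow>
           int (p ^ lp p (nat (min (cdiff lam \<mu> (m-1)) (int (lam m)))))
             dvd int (lam (m-1)) - int (\<mu> m) + 1"
    and "\<forall>s\<in>{m..n-1}. p ^ lp p (lam (s+1)) dvd lam s + 1"
  shows "\<exists>\<psi>'. \<psi>' \<in> weyl_hom n lam \<mu> \<and>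
           (\<exists>u\<in>weyl n lam. \<psi>' u \<noteq> (\<lambda>_. 0 :: 'a)) \<and>
           (\<forall>f\<in>D n lam. psi n lam \<mu> f = \<psi>' (weyl_proj n lam f))"
proof -
  note lam = assms(5) and \<mu> = assms(6) and dom = assms(7) and m = assms(9)
  note lamc = partitions_compositions[OF lam] and \<mu>c = partitions_compositions[OF \<mu>]
  have prime: "prime p" using prime_CHAR_semidom[where 'a = 'a] assms(2,3) by simp
  then have p2: "p \<ge> 2" by (rule prime_ge_2_nat)
  have gap_at: "(\<Sum>j=1..s-1. \<mu> j) + \<mu> (Suc s) \<le> (\<Sum>j=1..s. lam j)"
    if s: "s \<in> {1..<n}" and nz: "\<mu> (Suc s) \<noteq> 0" for s
  proof -
    have sm: "Suc s \<le> m" using partition_nonzero_iff_le_len[OF \<mu>, of "Suc s"] s nz m by simp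
    then have "\<forall>i\<in>{2..m}. (\<Sum>j=1..i-2. \<mu> j) + \<mu> i \<le> (\<Sum>j=1..i-1. lam j)"
      using assms(8) s m by (auto simp: Pset_def split: if_splits)
    moreover have "Suc s \<in> {2..m}" using sm s by auto
    ultimately have "(\<Sum>j=1..Suc s-2. \<mu> j) + \<mu> (Suc s) \<le> (\<Sum>j=1..Suc s-1. lam j)" by blast
    moreover have "Suc s - 2 = s - 1" "Suc s - 1 = s" by auto
    ultimately show ?thesis by (simp only:)
  qed
  then have gap: "row_gap n lam \<mu>" by (simp add: row_gap_def)
  have dom': "(\<Sum>j=1..s. lam j) \<le> (\<Sum>j=1..s. \<mu> j)" if "s \<le> n" for s
    using dom that unfolding dominated_def by (cases "s = 0") auto
  have le: "\<mu> (Suc s) \<le> lam s" if s: "s \<in> {1..<n}" for s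
  proof (cases "\<mu> (Suc s) = 0")
    case False
    have "(\<Sum>j=1..s. lam j) = (\<Sum>j=1..s-1. lam j) + lam s" using s by (cases s) auto
    moreover have "(\<Sum>j=1..s-1. lam j) \<le> (\<Sum>j=1..s-1. \<mu> j)" using s by (intro dom') auto
    ultimately show ?thesis using gap_at[OF s False] by simp
  qed simp
  have dvd: "p dvd ((lam s - \<mu> (Suc s) + t) choose t)"
    if s: "s \<in> {1..<n}" and t: "1 \<le> t" "t \<le> lam (Suc s)"
      "(\<Sum>i=1..s. lam i) + t \<le> (\<Sum>i=1..s. \<mu> i)" for s t
  proof -
    have tc: "int t \<le> cdiff lam \<mu> s"
      using t(3) unfolding cdiff_def sum_subtractf by (simp flip: of_nat_sum)
    have shift: "int (lam s) - int (\<mu> (s+1)) + 1 = int (lam s - \<mu> (Suc s) + 1)"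
      using le[OF s] by (simp add: of_nat_diff)
    obtain l where l: "p ^ l dvd lam s - \<mu> (Suc s) + 1" "t < p ^ l"
    proof -
      \<comment> \<open>the ranges of the three divisibility hypotheses; in the last one \<open>\<mu> (s + 1) = 0\<close>\<close>
      consider "s \<in> {1..m-2}" | "m \<ge> 2" "s = m - 1" | "s \<in> {m..n-1}"
        using s by (auto simp: not_le) linarith
      then show thesis
      proof cases
        case 1
        have "t < p ^ lp p (nat (cdiff lam \<mu> s))" using tc by (intro less_power_lp[OF p2 t(1)]) simp
        moreover have "int (p ^ lp p (nat (cdiff lam \<mu> s))) dvd int (lam s) - int (\<mu> (s+1)) + 1"
          using assms(10) 1 by blast
        then have "p ^ lp p (nat (cdiff lam \<mu> s)) dvd lam s - \<mu> (Suc s) + 1"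
          unfolding shift of_nat_dvd_iff .
        ultimately show thesis by (intro that)
      next
        case 2
        then have ms: "m = Suc s" using s by simp
        let ?a = "nat (min (cdiff lam \<mu> (m-1)) (int (lam m)))"
        have "int t \<le> min (cdiff lam \<mu> (m-1)) (int (lam m))" using tc t(2) ms by simp
        then have "t \<le> ?a" by linarith
        then have "t < p ^ lp p ?a" by (rule less_power_lp[OF p2 t(1)])
        moreover have "int (p ^ lp p ?a) dvd int (lam (m-1)) - int (\<mu> m) + 1"
          using assms(11) 2(1) by (rule mp)
        then have "int (p ^ lp p ?a) dvd int (lam s) - int (\<mu> (s+1)) + 1"
          unfolding ms by (simp only: diff_Suc_1 Suc_eq_plus1[symmetric])
        then have "p ^ lp p ?a dvd lam s - \<mu> (Suc s) + 1" unfolding shift of_nat_dvd_iff .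
        ultimately show thesis by (intro that)
      next
        case 3
        have "\<mu> (Suc s) = 0"
          using partition_nonzero_iff_le_len[OF \<mu>, of "Suc s"] s 3 m by auto
        moreover have "p ^ lp p (lam (Suc s)) dvd lam s + 1" using assms(12) 3 by simp
        moreover have "t < p ^ lp p (lam (Suc s))" using t(2) by (rule less_power_lp[OF p2 t(1)])
        ultimately show thesis using that by simp
      qed
    qed
    show ?thesis by (rule prime_dvd_shifted_binomial[OF prime l(1) t(1) l(2)])
  qed
  obtain c where c: "\<And>(f :: (nat \<Rightarrow> nat \<Rightarrow> nat) \<Rightarrow> 'a) S. psi n lam \<mu> f S
      = (\<Sum>S'\<in>col_tableaux n lam. c S S' * weyl_proj n lam f S')"
    using psi_factors_through_weyl_proj[where lam = lam and \<mu> = \<mu>, OF assms(3) lam \<mu> gap le dvd]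
    by blast
  define \<psi>' where "\<psi>' u = (\<lambda>S. \<Sum>S'\<in>col_tableaux n lam. c S S' * u S')"
    for u :: "(nat \<times> nat \<Rightarrow> nat) \<Rightarrow> 'a"
  have factor: "psi n lam \<mu> f = \<psi>' (weyl_proj n lam f)" for f
    unfolding \<psi>'_def by (intro ext) (rule c)
  have psi_w: "psi n lam \<mu> f
      = wedge n \<mu> (\<lambda>w. \<Sum>U\<in>triangular n \<mu> lam. f (pair_content (diagram \<mu>) U w))"
    for f :: "(nat \<Rightarrow> nat \<Rightarrow> nat) \<Rightarrow> 'a"
    by (rule psi_eq_wedge[OF \<mu> gap])
  have "\<psi>' \<in> weyl_hom n lam \<mu>"
    unfolding weyl_hom_def
  proof (rule CollectI, intro conjI ballI allI)
    fix u :: "(nat \<times> nat \<Rightarrow> nat) \<Rightarrow> 'a" assume u: "u \<in> weyl n lam"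
    then obtain f where f: "u = weyl_proj n lam f" unfolding weyl_def by blast
    show "\<psi>' u \<in> weyl n \<mu>" unfolding f factor[symmetric] by (rule psi_in_weyl[OF \<mu>c])
    show "\<psi>' (\<lambda>S. u S + v S) = (\<lambda>S. \<psi>' u S + \<psi>' v S)" for v
      unfolding \<psi>'_def by (simp add: distrib_left sum.distrib)
    show "\<psi>' (\<lambda>S. a * u S) = (\<lambda>S. a * \<psi>' u S)" for a
      unfolding \<psi>'_def sum_distrib_left by (simp only: mult.left_commute)
    show "\<psi>' (weyl_act n lam g u) = weyl_act n \<mu> g (\<psi>' u)" for g
    proof -
      have "\<psi>' (weyl_act n lam g u) = psi n lam \<mu> (D_act n lam g f)"
        unfolding f weyl_act_weyl_proj[OF lamc] factor ..
      also have "\<dots> = weyl_act n \<mu> g (psi n lam \<mu> f)"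
        unfolding psi_w by (rule weyl_act_triangular_wedge[OF lamc \<mu>c, symmetric])
      finally show ?thesis unfolding f factor .
    qed
  qed
  moreover have "\<exists>u\<in>weyl n lam. \<psi>' u \<noteq> (\<lambda>_. 0)"
  proof -
    let ?f = "\<lambda>B. of_bool (B = diagonal_content n lam) :: 'a"
    obtain U where U: "U \<in> triangular n \<mu> lam" using ex_triangular[OF \<mu>c lamc dom] by blast
    have "row_content \<mu> U \<in> D_basis n {1..n} \<mu>"
      by (rule row_content_in_D_basis[OF \<mu>c tableaux_range[OF triangularD(1)[OF U]]])
    then obtain T where T: "T \<in> tableaux n \<mu>" "row_weakly_increasing \<mu> T"
        "row_content \<mu> T = row_content \<mu> U"
      using ex_row_sorted_tableau[OF \<mu>c] by blast
    have "T \<in> triangular n \<mu> lam" by (rule triangular_of_row_content_eq[OF \<mu>c U T(1,3)])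
    then have T_SST: "T \<in> SST n lam \<mu>"
      by (intro sorted_triangular_SST[OF \<mu> gap] T(2))
    have "psi n lam \<mu> ?f T = 1" by (rule psi_diagonal[OF \<mu> gap T_SST])
    then have "\<psi>' (weyl_proj n lam ?f) T = 1" by (simp only: factor)
    then have "\<psi>' (weyl_proj n lam ?f) \<noteq> (\<lambda>_. 0)" by (metis zero_neq_one)
    moreover have "?f \<in> D n lam"
      using diagonal_content_in_D_basis[of n lam] by (auto simp: D_space_def)
    then have "weyl_proj n lam ?f \<in> weyl n lam" unfolding weyl_def by (rule imageI)
    ultimately show ?thesis by blast
  qed
  ultimately show ?thesis using factor by blast
qed

end
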